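(* Let $0<\beta<1$, $H\in(1/2,1)$ and $T>0$. For every $p,q\ge1$, the operator $$\nabla_1:\mathcal{F}C_{b,H}^\infty\longrightarrow L^p\big(\mathbb{W}\times\mathbb{R}^+,\mathcal{F}^{X_{\beta,2H,T}},\mathbb{P}_H\otimes\mathbb{P}_{Y_\beta};\mathcal{H}_H\big)$$ is closable on $L^q(\mathbb{W}\times\mathbb{R}^+,\mathcal{F}^{X_{\beta,2H,T}},\mathbb{P}_H\otimes\mathbb{P}_{Y_\beta})$; that is, if $(F_n)_{n\in\mathbb{N}}\subset\mathcal{F}C_{b,H}^\infty$ satisfies $F_n\to0$ in $L^q$ and $\nabla_1F_n\to Z$ in $L^p(\,\cdot\,;\mathcal{H}_H)$, then $Z=0$.
   Context: $\mathbb{R}^+=[0,\infty)$. $\mathbb{W}$ is the space of continuous $w:\mathbb{R}^+\to\mathbb{R}$ with $w(0)=0$, with the topology of locally uniform convergence. $\mathbb{P}_H$ is the unique probability measure on $\mathbb{W}$ under which the canonical process $w\mapsto w(t)$ is a fractional Brownian motion with Hurst index $H$, i.e. centered Gaussian with covariance $R_H(t,s)=\frac12(t^{2H}+s^{2H}-|t-s|^{2H})$. $\mathbb{P}_{Y_\beta}$ is the probability measure on $\mathbb{R}^+$ with density $M_\beta$ determined by $\int_0^\infty e^{-s\tau}M_\beta(\tau)\,d\tau=E_\beta(-s)$, $s\ge0$, with $E_\beta(z)=\sum_{n\ge0}z^n/\Gamma(\beta n+1)$. Put $\tau_H:=\tau^{1/(2H)}$, $X_{\beta,2H,T}(t)(w,\tau)=w(t\tau_H)$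 for $t\in[0,T]$, and $\mathcal{F}^{X_{\beta,2H,T}}=\sigma(X_{\beta,2H,T}(t),t\in[0,T])$. Elements of $L^p$ spaces are identified when equal $\mathbb{P}_H\otimes\mathbb{P}_{Y_\beta}$-a.s. The Cameron--Martin space $\mathcal{H}_H$ is the completion of $\mathrm{span}\{R_H(t,\cdot):t\ge0\}$ for the scalar product determined by $(R_H(t,\cdot),R_H(s,\cdot))_{\mathcal{H}_H}=R_H(t,s)$, realized as a space of functions on $\mathbb{R}^+$ (the reproducing kernel Hilbert space of $R_H$; its elements lie in $\mathbb{W}$). $\mathcal{F}C_{b,H}^\infty$ (depending on $T$) is the class of functions $F(w,\tau)=f(w(t_1\tau_H),\dots,w(t_n\tau_H))$ on $\mathbb{W}\times\mathbb{R}^+$ with $n\in\mathbb{N}$, $0<t_1<\dots<t_n\le T$ and $f\in C_b^\infty(\mathbb{R}^n)$, the set of $C^\infty$ real-valued functions bounded together with all their partial derivatives. For such $F$ and $h\in\mathcal{H}_H$, $(\partial_{1,h}F)(w,\tau)=\lim_{\varepsilon\to0}\varepsilon^{-1}(F(w+\varepsilon h,\tau)-F(w,\tau))=\sum_i\partial_if(w(t_1\tau_H),\dots,w(t_n\tau_H))h(t_i\tau_H)$, and the gradient $\nabla_1F(w,\tau)\in\mathcal{H}_H$ is the unique element with $(\partial_{1,h}F)(w,\tau)=(\nabla_1F(w,\tau),h)_{\mathcal{H}_H}$ for all $h\in\mathcal{H}_H$; explicitly $\nabla_1F(w,\tau)=\sum_i\partial_if(w(t_1\tau_H),\dots,w(t_n\tau_H))R_H(t_i\tau_H,\cdot)$.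 *)

theory Defs
  imports "HOL-Probability.Probability"
begin

section \<open>The path space\<close>

text \<open>Paths live on \<open>[0, \<infinity>)\<close>; they are extended by \<open>0\<close> to negative times, so that equality in the type
  is equality of paths on \<open>[0, \<infinity>)\<close>.\<close>

typedef wpath = "{w :: real \<Rightarrow> real. continuous_on {0..} w \<and> (\<forall>t\<le>0. w t = 0)}"
  morphisms ev Abs_wpath
  by (rule exI[of _ "\<lambda>_. 0"]) auto

lemma ev_continuous_on: "continuous_on {0..} (ev w)"
  and ev_nonpos: "t \<le> 0 \<Longrightarrow> ev w t = 0"
  using ev[of w] by auto

lemma wpath_eqI: "(\<And>t. ev v t = ev w t) \<Longrightarrow> v = w"
  by (simp add: ev_inject[symmetric] ext)

instantiation wpath :: real_vector
begin

definition "0 = Abs_wpath (\<lambda>_. 0)"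
definition "v + w = Abs_wpath (\<lambda>t. ev v t + ev w t)"
definition "- w = Abs_wpath (\<lambda>t. - ev w t)"
definition "v - w = Abs_wpath (\<lambda>t. ev v t - ev w t)"
definition "c *\<^sub>R w = Abs_wpath (\<lambda>t. c * ev w t)"

lemma ev_simps [simp]:
  "ev 0 t = 0" "ev (v + w) t = ev v t + ev w t" "ev (- w) t = - ev w t"
  "ev (v - w) t = ev v t - ev w t" "ev (c *\<^sub>R w) t = c * ev w t"
  unfolding zero_wpath_def plus_wpath_def uminus_wpath_def minus_wpath_def scaleR_wpath_def
  by (subst Abs_wpath_inverse;
      auto intro!: continuous_intros simp: ev_continuous_on ev_nonpos)+

instance
  by standard (auto intro!: wpath_eqI simp: algebra_simps)

end

text \<open>The topology of locally uniform convergence on \<open>[0, \<infinity>)\<close>.\<close>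

instantiation wpath :: topological_space
begin

definition open_wpath :: "wpath set \<Rightarrow> bool" where
  "open_wpath U \<longleftrightarrow>
    (\<forall>w\<in>U. \<exists>K>0. \<exists>e>0. \<forall>v. (\<forall>t\<in>{0..K}. \<bar>ev v t - ev w t\<bar> < e) \<longrightarrow> v \<in> U)"

instance
proof
  show "open (UNIV :: wpath set)"
    unfolding open_wpath_def by (auto intro: exI[of _ 1])
  show "open (S \<inter> S')" if S: "open S" and S': "open S'" for S S' :: "wpath set"
    unfolding open_wpath_def
  proof
    fix w assume w: "w \<in> S \<inter> S'"
    obtain K e where "K > 0" "e > 0" and
      1: "\<And>v. (\<forall>t\<in>{0..K}. \<bar>ev v t - ev w t\<bar> < e) \<Longrightarrow> v \<in> S"
      using S w unfolding open_wpath_def by blast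
    obtain K' e' where "K' > 0" "e' > 0" and
      2: "\<And>v. (\<forall>t\<in>{0..K'}. \<bar>ev v t - ev w t\<bar> < e') \<Longrightarrow> v \<in> S'"
      using S' w unfolding open_wpath_def by blast
    have "v \<in> S \<inter> S'" if "\<forall>t\<in>{0..max K K'}. \<bar>ev v t - ev w t\<bar> < min e e'" for v
    proof
      show "v \<in> S" using that by (intro 1) auto
      show "v \<in> S'" using that by (intro 2) auto
    qed
    with \<open>K > 0\<close> \<open>e > 0\<close> \<open>e' > 0\<close>
    show "\<exists>K>0. \<exists>e>0. \<forall>v. (\<forall>t\<in>{0..K}. \<bar>ev v t - ev w t\<bar> < e) \<longrightarrow> v \<in> S \<inter> S'"
      by (intro exI[of _ "max K K'"] conjI exI[of _ "min e e'"]) auto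
  qed
  show "open (\<Union>\<A>)" if "\<forall>S\<in>\<A>. open S" for \<A> :: "wpath set set"
    unfolding open_wpath_def
  proof
    fix w assume "w \<in> \<Union>\<A>"
    then obtain S where "S \<in> \<A>" "w \<in> S" by blast
    moreover have "\<exists>K>0. \<exists>e>0. \<forall>v. (\<forall>t\<in>{0..K}. \<bar>ev v t - ev w t\<bar> < e) \<longrightarrow> v \<in> S"
      using that \<open>S \<in> \<A>\<close> \<open>w \<in> S\<close> unfolding open_wpath_def by blast
    ultimately show "\<exists>K>0. \<exists>e>0. \<forall>v. (\<forall>t\<in>{0..K}. \<bar>ev v t - ev w t\<bar> < e) \<longrightarrow> v \<in> \<Union>\<A>"
      by (meson UnionI)
  qed
qed

end


section \<open>Fractional Brownian motion\<close>

definition R_cov :: "real \<Rightarrow> real \<Rightarrow> real \<Rightarrow> real" where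
  "R_cov H t s = (t powr (2*H) + s powr (2*H) - \<bar>t - s\<bar> powr (2*H)) / 2"

text \<open>Degenerate normal distributions (Dirac measures) are included.\<close>

definition gaussian_law :: "real measure \<Rightarrow> bool" where
  "gaussian_law N \<longleftrightarrow>
    (\<exists>m \<sigma>. 0 \<le> \<sigma> \<and> N = (if \<sigma> = 0 then return borel m else density lborel (normal_density m \<sigma>)))"

definition fbm_law :: "real \<Rightarrow> wpath measure \<Rightarrow> bool" where
  "fbm_law H P \<longleftrightarrow> prob_space P \<and> sets P = sets borel \<and>
    (\<forall>n t a. (\<forall>i<n. 0 \<le> t i) \<longrightarrow>
      gaussian_law (distr P borel (\<lambda>w. \<Sum>i<(n::nat). a i * ev w (t i)))) \<and>
    (\<forall>t\<ge>0. (\<integral>w. ev w t \<partial>P) = 0) \<and>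
    (\<forall>t\<ge>0. \<forall>s\<ge>0. (\<integral>w. ev w t * ev w s \<partial>P) = R_cov H t s)"


section \<open>The random time change\<close>

definition mittag_leffler :: "real \<Rightarrow> real \<Rightarrow> real" where
  "mittag_leffler \<beta> z = (\<Sum>n. z ^ n / Gamma (\<beta> * real n + 1))"

definition Y_law :: "real \<Rightarrow> real measure \<Rightarrow> bool" where
  "Y_law \<beta> Q \<longleftrightarrow> (\<exists>M \<in> borel_measurable borel.
    (\<forall>\<tau>\<ge>0. 0 \<le> M \<tau>) \<and>
    (\<forall>s\<ge>0. has_bochner_integral (restrict_space lborel {0..})
              (\<lambda>\<tau>. exp (- s * \<tau>) * M \<tau>) (mittag_leffler \<beta> (- s))) \<and>
    Q = density (restrict_space lborel {0..}) (\<lambda>\<tau>. ennreal (M \<tau>)))"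

definition tau_H :: "real \<Rightarrow> real \<Rightarrow> real" where
  "tau_H H \<tau> = \<tau> powr (1 / (2*H))"

definition X_proc :: "real \<Rightarrow> real \<Rightarrow> wpath \<times> real \<Rightarrow> real" where
  "X_proc H t = (\<lambda>(w, \<tau>). ev w (t * tau_H H \<tau>))"

text \<open>The \<open>\<sigma>\<close>-algebra \<open>\<sigma>(X(t), t \<in> [0,T])\<close> on the product of the path space and \<open>[0, \<infinity>)\<close>, as a measurable
  space (the measure component is irrelevant).\<close>

definition F_X :: "real \<Rightarrow> real \<Rightarrow> (wpath \<times> real) measure" where
  "F_X H T = sigma (UNIV \<times> {0..})
     {X_proc H t -` B \<inter> (UNIV \<times> {0..}) | t B. t \<in> {0..T} \<and> B \<in> sets borel}"


section \<open>The Cameron--Martin space\<close>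

definition R_path :: "real \<Rightarrow> real \<Rightarrow> wpath" where
  "R_path H t = Abs_wpath (\<lambda>s. if s \<le> 0 then 0 else R_cov H t s)"

lemma ev_R_path:
  assumes "0 < H" "0 \<le> t" "0 \<le> s"
  shows "ev (R_path H t) s = R_cov H t s"
proof -
  have "continuous_on {0..} (\<lambda>s. R_cov H t s)"
    unfolding R_cov_def using assms by (intro continuous_intros continuous_on_powr') auto
  moreover have "R_cov H t 0 = 0"
    using assms by (simp add: R_cov_def)
  ultimately have "continuous_on {0..} (\<lambda>s. if s \<le> 0 then 0 else R_cov H t s)"
    by (subst continuous_on_cong[where g = "R_cov H t"]) auto
  then show ?thesis
    unfolding R_path_def using assms \<open>R_cov H t 0 = 0\<close> by (subst Abs_wpath_inverse) auto
qed

definition cm_span :: "real \<Rightarrow> wpath set" where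
  "cm_span H = span (R_path H ` {0..})"

text \<open>The bilinear extension of \<open>(R(t,\<cdot>), R(s,\<cdot>)) = R(t,s)\<close> to the span.\<close>

definition pre_inner :: "real \<Rightarrow> wpath \<Rightarrow> wpath \<Rightarrow> real" where
  "pre_inner H u v = (THE r. \<exists>A B a b.
      finite A \<and> A \<subseteq> {0..} \<and> finite B \<and> B \<subseteq> {0..} \<and>
      u = (\<Sum>t\<in>A. a t *\<^sub>R R_path H t) \<and> v = (\<Sum>s\<in>B. b s *\<^sub>R R_path H s) \<and>
      r = (\<Sum>t\<in>A. \<Sum>s\<in>B. a t * b s * R_cov H t s))"

definition pre_norm :: "real \<Rightarrow> wpath \<Rightarrow> real" where
  "pre_norm H u = sqrt (pre_inner H u u)"

text \<open>The completion is realized as a space of functions by identifying (the class of) a Cauchy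
  sequence with its pointwise limit.\<close>

definition cm_approx :: "real \<Rightarrow> (nat \<Rightarrow> wpath) \<Rightarrow> wpath \<Rightarrow> bool" where
  "cm_approx H u h \<longleftrightarrow> range u \<subseteq> cm_span H \<and>
    (\<forall>e>0. \<exists>N. \<forall>m\<ge>N. \<forall>n\<ge>N. pre_norm H (u m - u n) < e) \<and>
    (\<forall>t\<ge>0. (\<lambda>n. ev (u n) t) \<longlonglongrightarrow> ev h t)"

definition cm_space :: "real \<Rightarrow> wpath set" where
  "cm_space H = {h. \<exists>u. cm_approx H u h}"

definition cm_inner :: "real \<Rightarrow> wpath \<Rightarrow> wpath \<Rightarrow> real" where
  "cm_inner H g h = (THE r. \<exists>u v. cm_approx H u g \<and> cm_approx H v h \<and>
      (\<lambda>n. pre_inner H (u n) (v n)) \<longlonglongrightarrow> r)"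

definition cm_norm :: "real \<Rightarrow> wpath \<Rightarrow> real" where
  "cm_norm H h = sqrt (cm_inner H h h)"

text \<open>The Borel \<open>\<sigma>\<close>-algebra of the norm topology of the Cameron--Martin space. As that space is
  separable, measurability with respect to it is the same as strong (Bochner) measurability.\<close>

definition cm_borel :: "real \<Rightarrow> wpath measure" where
  "cm_borel H = sigma (cm_space H)
     {U. U \<subseteq> cm_space H \<and>
         (\<forall>h\<in>U. \<exists>e>0. \<forall>g\<in>cm_space H. cm_norm H (g - h) < e \<longrightarrow> g \<in> U)}"


section \<open>Smooth cylinder functions and the gradient\<close>

text \<open>Functions on \<open>\<real>\<^sup>n\<close> are rendered as functions of real sequences that depend only on the
  coordinates below \<open>n\<close>.\<close>

definition partial_deriv :: "nat \<Rightarrow> ((nat \<Rightarrow> real) \<Rightarrow> real) \<Rightarrow> (nat \<Rightarrow> real) \<Rightarrow> real" where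
  "partial_deriv i f x = deriv (\<lambda>s. f (x(i := s))) (x i)"

definition Cb_infinity :: "nat \<Rightarrow> ((nat \<Rightarrow> real) \<Rightarrow> real) set" where
  "Cb_infinity n = {f.
    (\<forall>x y. (\<forall>i<n. x i = y i) \<longrightarrow> f x = f y) \<and>
    (\<forall>is. set is \<subseteq> {..<n} \<longrightarrow>
      (let g = foldr partial_deriv is f in
        continuous_on UNIV g \<and> bounded (range g) \<and>
        (\<forall>i<n. \<forall>x. (\<lambda>s. g (x(i := s))) differentiable (at (x i)))))}"

definition FCb :: "real \<Rightarrow> real \<Rightarrow> (wpath \<times> real \<Rightarrow> real) set" where
  "FCb H T = {F. \<exists>n t f. 1 \<le> n \<and> (\<forall>i<n. 0 < t i \<and> t i \<le> T) \<and> strict_mono_on {..<n} t \<and>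
     f \<in> Cb_infinity n \<and> F = (\<lambda>(w, \<tau>). f (\<lambda>i. ev w (t i * tau_H H \<tau>)))}"

definition has_dir_deriv :: "(wpath \<times> real \<Rightarrow> real) \<Rightarrow> wpath \<Rightarrow> wpath \<times> real \<Rightarrow> real \<Rightarrow> bool" where
  "has_dir_deriv F h x d \<longleftrightarrow>
    ((\<lambda>\<epsilon>. (F (fst x + \<epsilon> *\<^sub>R h, snd x) - F x) / \<epsilon>) \<longlongrightarrow> d) (at 0)"

definition grad1 :: "real \<Rightarrow> (wpath \<times> real \<Rightarrow> real) \<Rightarrow> wpath \<times> real \<Rightarrow> wpath" where
  "grad1 H F x = (THE g. g \<in> cm_space H \<and>
      (\<forall>h\<in>cm_space H. has_dir_deriv F h x (cm_inner H g h)))"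

end

theory Submission
  imports Defs
begin

text \<open>
  \<^bold>\<open>Why the gradient is closable.\<close> Write \<open>\<Phi> = ev (Z x) s\<close> for a fixed \<open>s > 0\<close>, the inner product of the limit
  gradient with the kernel function \<open>R_path H s\<close>. A path that vanishes on a dense set of times is zero, so
  it suffices to show \<open>\<Phi> = 0\<close> almost everywhere for countably many \<open>s\<close>.

  For a cylinder function \<open>F\<close> the gradient is \<open>\<Sum>i<n. \<partial>\<^sub>i f \<cdot> R_path H (t\<^sub>i \<tau>\<^sub>H)\<close> (\<open>grad1_cylinder\<close>), and its
  value at \<open>s\<close> is the derivative of \<open>F\<close> in the direction of the kernel function at \<open>s\<close>. That derivative has an
  adjoint: for each frozen \<open>\<tau>\<close>, Gaussian integration by parts (\<open>cylinder_integration_by_parts\<close>) gives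
  \<open>E[D\<^sub>s F \<cdot> G] = E[F \<cdot> G\<^sup>*]\<close> with \<open>G\<^sup>* = G w(s) - D\<^sub>s G\<close>. The test functions
  \<open>G = cos (\<theta> + a \<tau> + \<Sum>j. b\<^sub>j w(v\<^sub>j)) / (1 + w(s)\<^sup>2)\<close> are chosen so that \<open>G\<close> and \<open>G\<^sup>*\<close> are both bounded: the
  denominator absorbs the unbounded factor \<open>w(s)\<close>. As the measure is finite, both convergences imply convergence in
  the first mean, and passing to the limit in \<open>E[D\<^sub>s F\<^sub>n \<cdot> G] = E[F\<^sub>n \<cdot> G\<^sup>*]\<close> yields \<open>E[\<Phi> G] = 0\<close>.

  The function \<open>\<Phi> / (1 + w(s)\<^sup>2)\<close> is therefore orthogonal to every cosine of a finite linear combination of \<open>\<tau>\<close> and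
  the values of \<open>w\<close> on a countable dense set of times. Uniqueness of characteristic functions, applied one coordinate
  at a time to signed densities (\<open>cos_uniqueness\<close>), makes it orthogonal to every event determined by these
  observations. By continuity of paths, such events include all those of the \<open>\<sigma>\<close>-algebra generated by the time-changed
  process, among them \<open>{\<Phi> > 0}\<close> and \<open>{\<Phi> < 0}\<close>; so \<open>\<Phi> = 0\<close>.

  Integration by parts is reduced to the real line: \<open>w(v\<^sub>j) = U\<^sub>j + c\<^sub>j w(s)\<close> with the regression coefficient \<open>c\<^sub>j\<close>
  makes the residuals \<open>U\<^sub>j\<close> uncorrelated with \<open>w(s)\<close>, and the same uniqueness lemma turns
  this into independence (\<open>residual_independent\<close>). Coinciding times and degenerate covariances are covered by this
  argument.

  The process also enters the Hilbert space part: the kernel \<open>R_cov H\<close> is positive semidefinite because it is a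
  covariance, so all facts about the Cameron--Martin space are proved in the presence of the law of fractional
  Brownian motion.
\<close>

section \<open>Signed densities with vanishing cosine transform\<close>

text \<open>The positive and the negative part of \<open>\<xi>\<close> have the same mass \<open>c\<close>. After division by \<open>c\<close> they are
  densities under which \<open>Y\<close> has two laws with equal characteristic functions, so Levy's uniqueness theorem applies.
  A free phase \<open>\<theta>\<close> in the cosine covers sines as well and keeps the statement real.\<close>

lemma cos_uniqueness_real:
  fixes Y \<xi> :: "'a \<Rightarrow> real"
  assumes Y [measurable]: "Y \<in> borel_measurable M" and \<xi>: "integrable M \<xi>"
    and zero: "\<And>a \<theta>. (\<integral>x. \<xi> x * cos (\<theta> + a * Y x) \<partial>M) = 0"
    and A [measurable]: "A \<in> sets borel"
  shows "(\<integral>x. \<xi> x * indicator A (Y x) \<partial>M) = 0"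
proof -
  note [measurable] = borel_measurable_integrable[OF \<xi>]
  define pos neg where "pos = (\<lambda>x. max (\<xi> x) 0)" and "neg = (\<lambda>x. max (- \<xi> x) 0)"
  have \<xi>_eq: "\<xi> x = pos x - neg x" for x
    by (simp add: pos_def neg_def max_def)
  have pn [simp]: "0 \<le> pos x" "0 \<le> neg x" for x
    by (auto simp: pos_def neg_def)
  have int: "integrable M pos" "integrable M neg"
    using \<xi> by (auto simp: pos_def neg_def)
  have [measurable]: "pos \<in> borel_measurable M" "neg \<in> borel_measurable M"
    using int by auto
  define c where "c = (\<integral>x. pos x \<partial>M)"
  have c: "(\<integral>x. neg x \<partial>M) = c"
    using zero[of 0 0] int by (simp add: \<xi>_eq c_def)
  have bnd: "integrable M (\<lambda>x. g x * h x)" 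
    if "integrable M g" "\<And>x. \<bar>h x\<bar> \<le> 1" "h \<in> borel_measurable M" for g h :: "'a \<Rightarrow> real"
    using that by (intro Bochner_Integration.integrable_bound[OF that(1)])
      (auto simp: abs_mult intro!: AE_I2 mult_left_le)
  show ?thesis
  proof (cases "c = 0")
    case True
    have "AE x in M. pos x = 0" "AE x in M. neg x = 0"
      using True c int integral_nonneg_eq_0_iff_AE[of M pos] integral_nonneg_eq_0_iff_AE[of M neg]
      by (simp_all add: c_def)
    then have "AE x in M. \<xi> x * indicator A (Y x) = 0"
      by eventually_elim (simp add: \<xi>_eq)
    then show ?thesis
      by (simp add: integral_eq_zero_AE)
  next
    case False
    then have "c > 0"
      by (simp add: c_def less_le)
    define D where "D g = distr (density M (\<lambda>x. ennreal (g x / c))) borel Y" for g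
    have D_integral: "(\<integral>y. f y \<partial>D g) = (\<integral>x. (g x / c) *\<^sub>R f (Y x) \<partial>M)"
      if [measurable]: "f \<in> borel_measurable borel" "g \<in> borel_measurable M" and "\<And>x. 0 \<le> g x"
      for f :: "real \<Rightarrow> 'b::{banach, second_countable_topology}" and g
      unfolding D_def using that \<open>c > 0\<close> by (simp add: integral_distr integral_density)
    have D_prob: "real_distribution (D g)" 
      if "integrable M g" "\<And>x. 0 \<le> g x" "(\<integral>x. g x \<partial>M) = c" for g
    proof -
      have [measurable]: "g \<in> borel_measurable M"
        using that by auto
      have "emeasure (density M (\<lambda>x. ennreal (g x / c))) (space M) = 1"
        using that \<open>c > 0\<close>
        by (simp add: emeasure_density nn_integral_eq_integral cong: nn_integral_cong)
      then have "prob_space (density M (\<lambda>x. ennreal (g x / c)))"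
        by (intro prob_spaceI) simp
      then have "prob_space (D g)"
        unfolding D_def by (intro prob_space.prob_space_distr) simp_all
      then show ?thesis
        by (simp add: real_distribution_def real_distribution_axioms_def D_def)
    qed
    \<comment> \<open>A phase of \<open>- pi / 2\<close> turns the cosine into the sine, the imaginary part of the characteristic function.\<close>
    have "char (D pos) = char (D neg)"
    proof
      fix t
      have exp_eq: "iexp (t * y) = complex_of_real (cos (t * y)) + \<i> * complex_of_real (sin (t * y))" for y
        by (simp only: exp_Euler cos_of_real sin_of_real)
      have s: "sin u = cos (- pi/2 + u)" for u :: real
        using cos_diff[of u "pi/2"] by simp
      have of_real_integral: "(\<integral>x. complex_of_real (u x) + \<i> * complex_of_real (v x) \<partial>M) =
          complex_of_real (\<integral>x. u x \<partial>M) + \<i> * complex_of_real (\<integral>x. v x \<partial>M)"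
        if "integrable M u" "integrable M v" for u v
        using that by (subst Bochner_Integration.integral_add) auto
      have split: "(\<integral>x. (g x / c) *\<^sub>R iexp (t * Y x) \<partial>M) =
          complex_of_real ((\<integral>x. g x * cos (0 + t * Y x) \<partial>M) / c) +
          \<i> * complex_of_real ((\<integral>x. g x * cos (- pi/2 + t * Y x) \<partial>M) / c)"
        if "integrable M g" for g
      proof -
        have [measurable]: "g \<in> borel_measurable M" using that by auto
        have 1: "integrable M (\<lambda>x. g x * cos (t * Y x))" "integrable M (\<lambda>x. g x * sin (t * Y x))"
          using that by (auto intro!: bnd)
        have "(\<integral>x. (g x / c) *\<^sub>R iexp (t * Y x) \<partial>M) =
          (\<integral>x. complex_of_real (g x * cos (t * Y x) / c) + \<i> * complex_of_real (g x * sin (t * Y x) / c) \<partial>M)"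
          unfolding exp_eq by (intro Bochner_Integration.integral_cong) (auto simp: scaleR_conv_of_real algebra_simps add_divide_distrib)
        also have "\<dots> = complex_of_real (\<integral>x. g x * cos (t * Y x) / c \<partial>M) +
          \<i> * complex_of_real (\<integral>x. g x * sin (t * Y x) / c \<partial>M)"
          using 1 by (intro of_real_integral integrable_divide)
        finally show ?thesis
          by (simp add: s)
      qed
      have eq: "(\<integral>x. pos x * cos (\<theta> + t * Y x) \<partial>M) = (\<integral>x. neg x * cos (\<theta> + t * Y x) \<partial>M)" for \<theta>
      proof -
        have "(\<integral>x. pos x * cos (\<theta> + t * Y x) - neg x * cos (\<theta> + t * Y x) \<partial>M) = 0"
          using zero[of \<theta> t] by (simp add: \<xi>_eq left_diff_distrib)
        then show ?thesis
          using int by (subst (asm) Bochner_Integration.integral_diff) (auto intro!: bnd)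
      qed
      have measurable_iexp_mult: "(\<lambda>y. iexp (t * y)) \<in> borel_measurable borel"
        by measurable
      show "char (D pos) t = char (D neg) t"
        unfolding char_def using int by (simp only: D_integral split eq pn measurable_iexp_mult \<open>pos \<in> borel_measurable M\<close> \<open>neg \<in> borel_measurable M\<close>)
    qed
    then have "D pos = D neg"
      using int c by (intro Levy_uniqueness D_prob) (auto simp: c_def)
    then have "(\<integral>y. indicator A y \<partial>D pos) = (\<integral>y. indicator A y \<partial>D neg :: real)"
      by simp
    then have "(\<integral>x. pos x * indicator A (Y x) \<partial>M) = (\<integral>x. neg x * indicator A (Y x) \<partial>M)"
      using \<open>c > 0\<close> by (subst (asm) (1 2) D_integral) auto
    moreover have "(\<integral>x. pos x * indicator A (Y x) - neg x * indicator A (Y x) \<partial>M) =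
      (\<integral>x. pos x * indicator A (Y x) \<partial>M) - (\<integral>x. neg x * indicator A (Y x) \<partial>M)"
      using int by (intro Bochner_Integration.integral_diff) (auto intro!: bnd simp: indicator_def)
    ultimately show ?thesis
      by (simp add: \<xi>_eq left_diff_distrib)
  qed
qed

text \<open>Coordinates are replaced by indicators one at a time: for a fixed phase in the remaining coordinates,
  \<open>\<xi>\<close> times that cosine is again a signed density to which the one-dimensional result applies, because a product of
  two cosines is a sum of cosines of the sum and the difference of the arguments. The induction hypothesis is then
  used for \<open>\<xi>\<close> times the new indicator.\<close>

lemma cos_uniqueness_rectangle:
  fixes X :: "nat \<Rightarrow> 'a \<Rightarrow> real" and \<xi> :: "'a \<Rightarrow> real"
  assumes X [measurable]: "\<And>j. X j \<in> borel_measurable M" and "integrable M \<xi>"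
    and "\<And>\<theta> b. (\<integral>x. \<xi> x * cos (\<theta> + (\<Sum>j<m. b j * X j x)) \<partial>M) = 0"
    and A [measurable]: "\<And>j. A j \<in> sets borel"
  shows "(\<integral>x. \<xi> x * (\<Prod>j<m. indicator (A j) (X j x)) \<partial>M) = 0"
  using assms(2,3)
proof (induction m arbitrary: \<xi>)
  case 0
  show ?case
    using 0(2)[of 0] by simp
next
  case (Suc m)
  note [measurable] = borel_measurable_integrable[OF Suc.prems(1)]
  have bnd: "integrable M (\<lambda>x. \<xi> x * h x)" 
    if "\<And>x. \<bar>h x\<bar> \<le> 1" "h \<in> borel_measurable M" for h :: "'a \<Rightarrow> real"
    using that by (intro Bochner_Integration.integrable_bound[OF Suc.prems(1)])
      (auto simp: abs_mult intro!: AE_I2 mult_left_le)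
  have "(\<integral>x. (\<xi> x * indicator (A m) (X m x)) * (\<Prod>j<m. indicator (A j) (X j x)) \<partial>M) = 0"
  proof (rule Suc.IH)
    show "integrable M (\<lambda>x. \<xi> x * indicator (A m) (X m x))"
      by (intro bnd) (auto simp: indicator_def)
    fix \<theta> :: real and b :: "nat \<Rightarrow> real"
    have "(\<integral>x. (\<xi> x * cos (\<theta> + (\<Sum>j<m. b j * X j x))) * indicator (A m) (X m x) \<partial>M) = 0"
    proof (rule cos_uniqueness_real)
      show "integrable M (\<lambda>x. \<xi> x * cos (\<theta> + (\<Sum>j<m. b j * X j x)))"
        by (intro bnd) auto
      fix a \<phi> :: real
      let ?S = "\<lambda>x. \<Sum>j<m. b j * X j x"
      have z: "(\<integral>x. \<xi> x * cos (\<psi> + (?S x + a' * X m x)) \<partial>M) = 0" for \<psi> a'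
        using Suc.prems(2)[of \<psi> "b(m := a')"] by (simp cong: sum.cong_simp)
      have "(\<integral>x. \<xi> x * cos (\<theta> + ?S x) * cos (\<phi> + a * X m x) \<partial>M) =
        (\<integral>x. (\<xi> x * cos ((\<theta> - \<phi>) + (?S x + (- a) * X m x))) / 2 +
              (\<xi> x * cos ((\<theta> + \<phi>) + (?S x + a * X m x))) / 2 \<partial>M)"
      proof (intro Bochner_Integration.integral_cong refl)
        fix x
        have "(\<theta> - \<phi>) + (?S x + (- a) * X m x) = (\<theta> + ?S x) - (\<phi> + a * X m x)"
          "(\<theta> + \<phi>) + (?S x + a * X m x) = (\<theta> + ?S x) + (\<phi> + a * X m x)"
          by simp_all
        then show "\<xi> x * cos (\<theta> + ?S x) * cos (\<phi> + a * X m x) =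
          (\<xi> x * cos ((\<theta> - \<phi>) + (?S x + (- a) * X m x))) / 2 +
          (\<xi> x * cos ((\<theta> + \<phi>) + (?S x + a * X m x))) / 2"
          using cos_times_cos[of "\<theta> + ?S x" "\<phi> + a * X m x"]
          by (simp only:) (simp add: field_simps)
      qed
      also have "\<dots> = (\<integral>x. \<xi> x * cos ((\<theta> - \<phi>) + (?S x + (- a) * X m x)) \<partial>M) / 2 +
        (\<integral>x. \<xi> x * cos ((\<theta> + \<phi>) + (?S x + a * X m x)) \<partial>M) / 2"
        by (subst Bochner_Integration.integral_add)
          (auto intro!: integrable_divide bnd)
      also have "\<dots> = 0"
        by (simp only: z)
      finally show "(\<integral>x. \<xi> x * cos (\<theta> + ?S x) * cos (\<phi> + a * X m x) \<partial>M) = 0" .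
    qed auto
    then show "(\<integral>x. (\<xi> x * indicator (A m) (X m x)) * cos (\<theta> + (\<Sum>j<m. b j * X j x)) \<partial>M) = 0"
      by (simp add: mult_ac)
  qed
  then show ?case
    by (simp add: mult_ac)
qed

text \<open>The sets with this property form a Dynkin system containing the finite-dimensional rectangles, which generate
  the Borel sets of the sequence space.\<close>

lemma cos_uniqueness:
  fixes X :: "nat \<Rightarrow> 'a \<Rightarrow> real" and \<xi> :: "'a \<Rightarrow> real"
  assumes X [measurable]: "\<And>j. X j \<in> borel_measurable M" and int: "integrable M \<xi>"
    and zero: "\<And>m \<theta> b. (\<integral>x. \<xi> x * cos (\<theta> + (\<Sum>j<m. b j * X j x)) \<partial>M) = 0"
    and A: "A \<in> sets (borel :: (nat \<Rightarrow> real) measure)"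
  shows "(\<integral>x. \<xi> x * indicator A (\<lambda>j. X j x) \<partial>M) = 0"
proof -
  note [measurable] = borel_measurable_integrable[OF int]
  let ?X = "\<lambda>x j. X j x" and ?G = "prod_algebra UNIV (\<lambda>j::nat. borel :: real measure)"
  have Xm [measurable]: "?X \<in> borel_measurable M"
    by (rule measurable_coordinatewise_then_product) simp
  have gen: "sets (borel :: (nat \<Rightarrow> real) measure) = sigma_sets UNIV ?G"
    unfolding sets_PiM_equal_borel[symmetric] sets_PiM by simp
  have "A \<in> sigma_sets UNIV ?G"
    using A gen by simp
  with Int_stable_prod_algebra subset_UNIV[of ?G, folded Pow_UNIV] show ?thesis
  proof (induction rule: sigma_sets_induct_disjoint)
    case (basic A)
    then obtain J E where A: "A = prod_emb UNIV (\<lambda>_. borel) J (Pi\<^sub>E J E)" "finite J"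
      and E: "\<And>j. j \<in> J \<Longrightarrow> E j \<in> sets borel"
      by (auto elim!: prod_algebraE)
    define E' where "E' j = (if j \<in> J then E j else UNIV)" for j
    obtain m where m: "J \<subseteq> {..<m}"
      using \<open>finite J\<close> by (meson finite_nat_iff_bounded)
    have "indicator A (?X x) = (\<Prod>j<m. indicator (E' j) (X j x) :: real)" for x
    proof -
      have "?X x \<in> A \<longleftrightarrow> (\<forall>j<m. X j x \<in> E' j)"
        using m by (auto simp: A prod_emb_def E'_def restrict_PiE_iff)
      then show ?thesis
        by (auto simp: indicator_def intro!: prod.neutral[symmetric])
    qed
    moreover have "(\<integral>x. \<xi> x * (\<Prod>j<m. indicator (E' j) (X j x)) \<partial>M) = 0"
      by (rule cos_uniqueness_rectangle[OF X int zero]) (auto simp: E'_def E)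
    ultimately show ?case
      by simp
  next
    case empty
    then show ?case by simp
  next
    case (compl A)
    then have [measurable]: "A \<in> sets borel"
      using gen by simp
    have "(\<integral>x. \<xi> x * indicator (UNIV - A) (?X x) \<partial>M) =
        (\<integral>x. \<xi> x - \<xi> x * indicator A (?X x) \<partial>M)"
      by (intro Bochner_Integration.integral_cong) (auto simp: indicator_def)
    also have "\<dots> = (\<integral>x. \<xi> x \<partial>M) - (\<integral>x. \<xi> x * indicator A (?X x) \<partial>M)"
      using int by (intro Bochner_Integration.integral_diff) (auto intro!: Bochner_Integration.integrable_bound[OF int] simp: indicator_def) 
    also have "(\<integral>x. \<xi> x \<partial>M) = 0"
      using zero[where m = 0 and \<theta> = 0] by simp
    finally show ?case
      using compl by simp
  next
    case (union A)
    then have [measurable]: "A i \<in> sets borel" for i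
      using gen by auto
    define B where "B i = ?X -` A i \<inter> space M" for i
    have set: "(LINT x:B i|M. \<xi> x) = (\<integral>x. \<xi> x * indicator (A i) (?X x) \<partial>M)" for i
      unfolding set_lebesgue_integral_def B_def
      by (intro Bochner_Integration.integral_cong) (auto simp: indicator_def)
    have setU: "(LINT x:(\<Union>i. B i)|M. \<xi> x) = (\<integral>x. \<xi> x * indicator (\<Union>i. A i) (?X x) \<partial>M)"
      unfolding set_lebesgue_integral_def B_def
      by (intro Bochner_Integration.integral_cong) (auto simp: indicator_def)
    have "(LINT x:(\<Union>i. B i)|M. \<xi> x) = (\<Sum>i. LINT x:B i|M. \<xi> x)"
    proof (rule lebesgue_integral_countable_add)
      show meas: "B i \<in> sets M" for i
        unfolding B_def by measurable
      show "B i \<inter> B j = {}" if "i \<noteq> j" for i j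
        using union(1) that by (auto simp: B_def disjoint_family_on_def)
      show "set_integrable M (\<Union>i. B i) \<xi>"
        unfolding set_integrable_def using int meas by (intro integrable_mult_indicator) auto
    qed
    then show ?case
      using union by (simp add: set setU)
  qed
qed

section \<open>Gaussian moments of fractional Brownian motion\<close>

text \<open>All that is needed about a centered Gaussian variable, including the degenerate case, in terms of its
  second moment alone.\<close>

lemma gaussian_law_centered:
  fixes Y :: "'a \<Rightarrow> real"
  assumes "prob_space M" and Y [measurable]: "Y \<in> borel_measurable M"
    and law: "gaussian_law (distr M borel Y)" and mean: "(\<integral>x. Y x \<partial>M) = 0"
  shows gaussian_law_square_integrable: "integrable M (\<lambda>x. (Y x)\<^sup>2)"
    and gaussian_law_cos: "(\<integral>x. cos (\<theta> + Y x) \<partial>M) = cos \<theta> * exp (- (\<integral>x. (Y x)\<^sup>2 \<partial>M) / 2)"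
    and gaussian_law_density: "0 < (\<integral>x. (Y x)\<^sup>2 \<partial>M) \<Longrightarrow>
      distr M borel Y = density lborel (normal_density 0 (sqrt (\<integral>x. (Y x)\<^sup>2 \<partial>M)))"
proof -
  interpret prob_space M by fact
  obtain m \<sigma> where "0 \<le> \<sigma>" and
    N: "distr M borel Y = (if \<sigma> = 0 then return borel m else density lborel (normal_density m \<sigma>))"
    using law unfolding gaussian_law_def by auto
  have to_distr: "(\<integral>x. f (Y x) \<partial>M) = (\<integral>y. f y \<partial>distr M borel Y)"
    if "f \<in> borel_measurable borel" for f :: "real \<Rightarrow> real"
    using that by (simp add: integral_distr)
  have int_distr: "integrable M (\<lambda>x. f (Y x)) \<longleftrightarrow> integrable (distr M borel Y) f"
    if "f \<in> borel_measurable borel" for f :: "real \<Rightarrow> real"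
    using that by (simp add: integrable_distr_eq)
  have "integrable M (\<lambda>x. (Y x)\<^sup>2) \<and>
    (\<integral>x. cos (\<theta> + Y x) \<partial>M) = cos \<theta> * exp (- (\<integral>x. (Y x)\<^sup>2 \<partial>M) / 2) \<and>
    (0 < (\<integral>x. (Y x)\<^sup>2 \<partial>M) \<longrightarrow>
      distr M borel Y = density lborel (normal_density 0 (sqrt (\<integral>x. (Y x)\<^sup>2 \<partial>M))))"
  proof (cases "\<sigma> = 0")
    case True
    have "m = 0"
      using mean to_distr[of "\<lambda>y. y"] True by (simp add: N integral_return)
    have "AE y in distr M borel Y. y = 0"
      unfolding N using True \<open>m = 0\<close> by (simp add: AE_return)
    then have "AE x in M. Y x = 0"
      by (subst (asm) AE_distr_iff) auto
    then have 2: "AE x in M. (Y x)\<^sup>2 = 0" and c: "AE x in M. cos (\<theta> + Y x) = cos \<theta>"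
      by (auto elim: AE_mp)
    have "integrable M (\<lambda>x. (Y x)\<^sup>2)"
      by (rule integrable_cong_AE_imp[OF integrable_zero]) (use 2 in auto)
    moreover have "(\<integral>x. (Y x)\<^sup>2 \<partial>M) = 0"
      using 2 by (rule integral_eq_zero_AE)
    moreover have "(\<integral>x. cos (\<theta> + Y x) \<partial>M) = (\<integral>x. cos \<theta> \<partial>M)"
      using c by (intro integral_cong_AE) auto
    ultimately show ?thesis
      by (simp add: prob_space)
  next
    case False
    with \<open>0 \<le> \<sigma>\<close> have "\<sigma> > 0" by simp
    have N': "distr M borel Y = density lborel (normal_density m \<sigma>)"
      using N False by simp
    have "m = 0"
      using mean to_distr[of "\<lambda>y. y"] integral_normal_moment_nz_1[OF \<open>\<sigma> > 0\<close>, of m]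
      by (simp add: N' integral_density)
    have D: "distributed M lborel Y (normal_density 0 \<sigma>)"
      using N' \<open>m = 0\<close> unfolding distributed_def by (auto cong: distr_cong)
    then have D': "distributed M lborel (\<lambda>x. Y x / \<sigma>) std_normal_density"
      using normal_standard_normal_convert[OF \<open>\<sigma> > 0\<close>, of Y 0] by simp
    then have std: "distr M borel (\<lambda>x. Y x / \<sigma>) = std_normal_distribution"
      unfolding distributed_def by (auto cong: distr_cong)
    have sq: "integrable M (\<lambda>x. (Y x)\<^sup>2)"
      using integrable_normal_moment[OF \<open>\<sigma> > 0\<close>, of 0 2] \<open>m = 0\<close>
      by (subst int_distr) (auto simp: N' integrable_density)
    have var: "(\<integral>x. (Y x)\<^sup>2 \<partial>M) = \<sigma>\<^sup>2"
      using integral_normal_moment_even[OF \<open>\<sigma> > 0\<close>, of 0 1] \<open>m = 0\<close>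
      by (subst to_distr) (auto simp: N' integral_density)
    have "char std_normal_distribution \<sigma> = (\<integral>x. iexp (Y x) \<partial>M)"
      unfolding char_def std[symmetric] using \<open>\<sigma> > 0\<close> by (subst integral_distr) auto
    then have iexp: "(\<integral>x. iexp (Y x) \<partial>M) = complex_of_real (exp (- \<sigma>\<^sup>2 / 2))"
      by (simp add: char_std_normal_distribution)
    have "(\<integral>x. cos (\<theta> + Y x) \<partial>M) = (\<integral>x. Re (cis \<theta> * iexp (Y x)) \<partial>M)"
      by (simp add: cis_conv_exp[symmetric] cis_mult)
    also have "\<dots> = Re (\<integral>x. cis \<theta> * iexp (Y x) \<partial>M)"
      by (intro integral_Re integrable_const_bound[where B = 1]) (auto simp: norm_mult)
    also have "\<dots> = Re (cis \<theta> * complex_of_real (exp (- \<sigma>\<^sup>2 / 2)))"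
      using iexp by (simp del: of_real_exp)
    also have "\<dots> = cos \<theta> * exp (- \<sigma>\<^sup>2 / 2)"
      by (simp del: of_real_exp)
    finally show ?thesis
      using sq var N' \<open>m = 0\<close> \<open>\<sigma> > 0\<close> by simp
  qed
  then show "integrable M (\<lambda>x. (Y x)\<^sup>2)"
    "(\<integral>x. cos (\<theta> + Y x) \<partial>M) = cos \<theta> * exp (- (\<integral>x. (Y x)\<^sup>2 \<partial>M) / 2)"
    "0 < (\<integral>x. (Y x)\<^sup>2 \<partial>M) \<Longrightarrow>
      distr M borel Y = density lborel (normal_density 0 (sqrt (\<integral>x. (Y x)\<^sup>2 \<partial>M)))"
    by auto
qed

lemma continuous_on_ev: "continuous_on UNIV (\<lambda>w. ev w t)"
proof (cases "0 < t")
  case True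
  have "open ((\<lambda>w. ev w t) -` S)" if "open S" for S
    unfolding open_wpath_def
  proof
    fix w assume "w \<in> (\<lambda>w. ev w t) -` S"
    then obtain e where "e > 0" "\<And>y. dist y (ev w t) < e \<Longrightarrow> y \<in> S"
      using \<open>open S\<close> by (auto simp: open_dist)
    then show "\<exists>K>0. \<exists>e>0. \<forall>v. (\<forall>s\<in>{0..K}. \<bar>ev v s - ev w s\<bar> < e) \<longrightarrow> v \<in> (\<lambda>w. ev w t) -` S"
      using True by (intro exI[of _ t] exI[of _ e] conjI) (auto simp: dist_real_def)
  qed
  then show ?thesis
    by (simp add: continuous_on_open_vimage)
qed (simp add: ev_nonpos)

lemma ev_sum: "ev (\<Sum>i\<in>I. f i) t = (\<Sum>i\<in>I. ev (f i) t)"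
  by (induction I rule: infinite_finite_induct) auto

lemma R_cov_commute: "R_cov H t s = R_cov H s t"
  by (simp add: R_cov_def abs_minus_commute)

lemma R_cov_diag: "R_cov H t t = t powr (2 * H)"
  by (simp add: R_cov_def)

locale fractional_brownian_motion =
  fixes H :: real and P :: "wpath measure"
  assumes H_pos: "0 < H" and law: "fbm_law H P"
begin

sublocale prob_space P
  using law unfolding fbm_law_def by (elim conjE)

lemma fbm_gaussian:
    "(\<And>i. i < n \<Longrightarrow> 0 \<le> t i) \<Longrightarrow> gaussian_law (distr P borel (\<lambda>w. \<Sum>i<(n::nat). a i * ev w (t i)))"
  and fbm_mean: "0 \<le> r \<Longrightarrow> expectation (\<lambda>w. ev w r) = 0"
  and fbm_covariance: "0 \<le> r \<Longrightarrow> 0 \<le> s \<Longrightarrow> expectation (\<lambda>w. ev w r * ev w s) = R_cov H r s"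
  using law unfolding fbm_law_def by blast+

lemma sets_P [measurable_cong, simp]: "sets P = sets borel"
  using law unfolding fbm_law_def by (elim conjE)

lemma space_P [simp]: "space P = UNIV"
  using sets_eq_imp_space_eq[OF sets_P] by simp

lemma ev_measurable [measurable]: "(\<lambda>w. ev w t) \<in> borel_measurable P"
  using borel_measurable_continuous_onI[OF continuous_on_ev[of t]]
  by (simp add: measurable_cong_sets[OF sets_P refl])

text \<open>The definition of the law speaks about combinations indexed by an initial segment of the natural numbers;
  arbitrary finite index sets are more convenient.\<close>

lemma gaussian_combination:
  fixes t :: "'i \<Rightarrow> real"
  assumes "finite I" and nn: "\<And>i. i \<in> I \<Longrightarrow> 0 \<le> t i"
  shows "gaussian_law (distr P borel (\<lambda>w. \<Sum>i\<in>I. a i * ev w (t i)))"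
proof -
  obtain h where h: "bij_betw h {..<card I} I"
    using ex_bij_betw_nat_finite[OF \<open>finite I\<close>] by (auto simp: atLeast0LessThan)
  have "(\<Sum>i\<in>I. a i * ev w (t i)) = (\<Sum>k<card I. a (h k) * ev w (t (h k)))" for w
    by (rule sum.reindex_bij_betw[OF h, symmetric])
  moreover have "0 \<le> t (h k)" if "k < card I" for k
    using that h nn by (auto simp: bij_betw_def)
  ultimately show ?thesis
    using fbm_gaussian[of "card I" "\<lambda>k. t (h k)" "\<lambda>k. a (h k)"] by simp
qed

lemma
  assumes "0 \<le> t"
  shows integrable_ev_square: "integrable P (\<lambda>w. (ev w t)\<^sup>2)"
    and integrable_ev: "integrable P (\<lambda>w. ev w t)"
proof -
  have "gaussian_law (distr P borel (\<lambda>w. ev w t))"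
    using gaussian_combination[of "{()}" "\<lambda>_. t" "\<lambda>_. 1"] assms by simp
  then show "integrable P (\<lambda>w. (ev w t)\<^sup>2)"
    using fbm_mean[OF assms] by (intro gaussian_law_square_integrable prob_space_axioms) auto
  then show "integrable P (\<lambda>w. ev w t)"
    by (rule square_integrable_imp_integrable[rotated]) simp
qed

lemma integrable_ev_mult:
  assumes "0 \<le> t" "0 \<le> s"
  shows "integrable P (\<lambda>w. ev w t * ev w s)"
proof (rule Bochner_Integration.integrable_bound)
  show "integrable P (\<lambda>w. (ev w t)\<^sup>2 + (ev w s)\<^sup>2)"
    using assms by (auto intro: integrable_ev_square)
  have "\<bar>x * y\<bar> \<le> x\<^sup>2 + y\<^sup>2" for x y :: real
  proof -
    have "2 * (\<bar>x\<bar> * \<bar>y\<bar>) \<le> x\<^sup>2 + y\<^sup>2"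
      using sum_squares_bound[of "\<bar>x\<bar>" "\<bar>y\<bar>"] by simp
    moreover have "0 \<le> \<bar>x\<bar> * \<bar>y\<bar>" by simp
    ultimately show ?thesis by (simp only: abs_mult)
  qed
  then show "AE w in P. norm (ev w t * ev w s) \<le> norm ((ev w t)\<^sup>2 + (ev w s)\<^sup>2)"
    by (intro AE_I2) (simp add: abs_mult)
qed auto

lemma expectation_combination_mult:
  assumes "finite I" "\<And>i. i \<in> I \<Longrightarrow> 0 \<le> t i" "finite J" "\<And>j. j \<in> J \<Longrightarrow> 0 \<le> u j"
  shows "expectation (\<lambda>w. (\<Sum>i\<in>I. a i * ev w (t i)) * (\<Sum>j\<in>J. b j * ev w (u j))) =
    (\<Sum>i\<in>I. \<Sum>j\<in>J. a i * b j * R_cov H (t i) (u j))"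
proof -
  have "expectation (\<lambda>w. (\<Sum>i\<in>I. a i * ev w (t i)) * (\<Sum>j\<in>J. b j * ev w (u j))) =
    expectation (\<lambda>w. \<Sum>i\<in>I. \<Sum>j\<in>J. (a i * b j) * (ev w (t i) * ev w (u j)))"
    unfolding sum_product by (intro Bochner_Integration.integral_cong sum.cong refl) (simp add: mult_ac)
  also have "\<dots> = (\<Sum>i\<in>I. \<Sum>j\<in>J. (a i * b j) * expectation (\<lambda>w. ev w (t i) * ev w (u j)))"
  proof (subst Bochner_Integration.integral_sum)
    show "(\<Sum>i\<in>I. expectation (\<lambda>w. \<Sum>j\<in>J. (a i * b j) * (ev w (t i) * ev w (u j)))) =
      (\<Sum>i\<in>I. \<Sum>j\<in>J. (a i * b j) * expectation (\<lambda>w. ev w (t i) * ev w (u j)))"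
      using assms by (intro sum.cong refl, subst Bochner_Integration.integral_sum)
        (auto intro!: integrable_mult_right integrable_ev_mult)
  qed (use assms in \<open>auto intro!: Bochner_Integration.integrable_sum integrable_mult_right integrable_ev_mult\<close>)
  also have "\<dots> = (\<Sum>i\<in>I. \<Sum>j\<in>J. a i * b j * R_cov H (t i) (u j))"
    using assms by (intro sum.cong refl) (simp add: fbm_covariance)
  finally show ?thesis .
qed

lemma expectation_combination:
  assumes "finite I" "\<And>i. i \<in> I \<Longrightarrow> 0 \<le> t i"
  shows "expectation (\<lambda>w. \<Sum>i\<in>I. a i * ev w (t i)) = 0"
  using assms by (subst Bochner_Integration.integral_sum) (auto intro: integrable_ev simp: fbm_mean)

end

section \<open>The Cameron--Martin space as a reproducing kernel space\<close>

text \<open>The representation uses each kernel function at most once, so that the coefficients can be indexed by times.\<close>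

lemma cm_span_cases:
  assumes "v \<in> cm_span H"
  obtains B b where "finite B" "B \<subseteq> {0..}" "v = (\<Sum>s\<in>B. b s *\<^sub>R R_path H s)"
proof -
  obtain T r where T: "finite T" "T \<subseteq> R_path H ` {0..}" and v: "v = (\<Sum>x\<in>T. r x *\<^sub>R x)"
    using assms unfolding cm_span_def span_explicit by blast
  obtain B where B: "B \<subseteq> {0..}" "inj_on (R_path H) B" "T = R_path H ` B"
    using T(2) unfolding subset_image_inj by blast
  have "finite B"
    using T(1) B by (simp add: finite_image_iff)
  moreover have "v = (\<Sum>s\<in>B. r (R_path H s) *\<^sub>R R_path H s)"
    unfolding v B(3) using B(2) by (simp add: sum.reindex)
  ultimately show ?thesis
    using B(1) that[of B "\<lambda>s. r (R_path H s)"] by blast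
qed

lemma cm_span_sum:
  assumes "\<And>i. i \<in> I \<Longrightarrow> 0 \<le> t i"
  shows "(\<Sum>i\<in>I. a i *\<^sub>R R_path H (t i)) \<in> cm_span H"
  unfolding cm_span_def by (intro span_sum span_scale span_base) (use assms in auto)

context fractional_brownian_motion
begin

lemma ev_R_path_sum:
  assumes "\<And>i. i \<in> I \<Longrightarrow> 0 \<le> t i" "0 \<le> s"
  shows "ev (\<Sum>i\<in>I. a i *\<^sub>R R_path H (t i)) s = (\<Sum>i\<in>I. a i * R_cov H (t i) s)"
  using assms H_pos by (auto simp: ev_sum ev_R_path)

text \<open>The double sum in the definition of the pre-inner product equals \<open>\<Sum>t\<in>A. a t * v(t)\<close>, which involves no
  representation of \<open>v\<close>, and by symmetry also \<open>\<Sum>s\<in>B. b s * u(s)\<close>, which involves none of \<open>u\<close>. Its value is therefore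
  independent of both representations; this is what makes the definite description meaningful.\<close>

lemma pre_inner_R_path_sum:
  assumes A: "finite A" "A \<subseteq> {0..}" and v: "v \<in> cm_span H"
  shows "pre_inner H (\<Sum>t\<in>A. a t *\<^sub>R R_path H t) v = (\<Sum>t\<in>A. a t * ev v t)"
proof -
  let ?u = "\<Sum>t\<in>A. a t *\<^sub>R R_path H t"
  obtain B b where B: "finite B" "B \<subseteq> {0..}" "v = (\<Sum>s\<in>B. b s *\<^sub>R R_path H s)"
    using v by (rule cm_span_cases)
  have left: "(\<Sum>t\<in>A. \<Sum>s\<in>B. a t * b s * R_cov H t s) = (\<Sum>t\<in>A. a t * ev w t)"
    if "A \<subseteq> {0..}" "B \<subseteq> {0..}" "w = (\<Sum>s\<in>B. b s *\<^sub>R R_path H s)"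
    for A B :: "real set" and a b w
  proof (intro sum.cong refl)
    fix t assume "t \<in> A"
    then have "ev w t = (\<Sum>s\<in>B. b s * R_cov H s t)"
      unfolding that(3) using that(1,2) by (intro ev_R_path_sum) auto
    then show "(\<Sum>s\<in>B. a t * b s * R_cov H t s) = a t * ev w t"
      by (simp add: sum_distrib_left mult.assoc R_cov_commute[of H t])
  qed
  have right: "(\<Sum>t\<in>A. \<Sum>s\<in>B. a t * b s * R_cov H t s) = (\<Sum>s\<in>B. b s * ev w s)"
    if "A \<subseteq> {0..}" "B \<subseteq> {0..}" "w = (\<Sum>t\<in>A. a t *\<^sub>R R_path H t)"
    for A B :: "real set" and a b w
    using left[OF that(2,1,3), of b] by (subst sum.swap) (simp add: mult_ac R_cov_commute[of H _ s for s])
  show ?thesis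
    unfolding pre_inner_def
  proof (rule the_equality)
    show "\<exists>A' B a' b. finite A' \<and> A' \<subseteq> {0..} \<and> finite B \<and> B \<subseteq> {0..} \<and>
        ?u = (\<Sum>t\<in>A'. a' t *\<^sub>R R_path H t) \<and> v = (\<Sum>s\<in>B. b s *\<^sub>R R_path H s) \<and>
        (\<Sum>t\<in>A. a t * ev v t) = (\<Sum>t\<in>A'. \<Sum>s\<in>B. a' t * b s * R_cov H t s)"
      by (rule exI[of _ A], rule exI[of _ B], rule exI[of _ a], rule exI[of _ b])
        (intro conjI A B refl left[OF A(2) B(2,3), symmetric])
    fix r
    assume "\<exists>A' B a' b. finite A' \<and> A' \<subseteq> {0..} \<and> finite B \<and> B \<subseteq> {0..} \<and>
        ?u = (\<Sum>t\<in>A'. a' t *\<^sub>R R_path H t) \<and> v = (\<Sum>s\<in>B. b s *\<^sub>R R_path H s) \<and>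
        r = (\<Sum>t\<in>A'. \<Sum>s\<in>B. a' t * b s * R_cov H t s)"
    then obtain A' B' a' b' where 
      *: "A' \<subseteq> {0..}" "B' \<subseteq> {0..}" "?u = (\<Sum>t\<in>A'. a' t *\<^sub>R R_path H t)" "v = (\<Sum>s\<in>B'. b' s *\<^sub>R R_path H s)"
      and r: "r = (\<Sum>t\<in>A'. \<Sum>s\<in>B'. a' t * b' s * R_cov H t s)"
      by blast
    have "r = (\<Sum>s\<in>B'. b' s * ev ?u s)"
      unfolding r by (rule right[OF *(1,2,3)])
    also have "\<dots> = (\<Sum>t\<in>A. \<Sum>s\<in>B'. a t * b' s * R_cov H t s)"
      by (rule right[OF A(2) *(2) refl, symmetric])
    also have "\<dots> = (\<Sum>t\<in>A. a t * ev v t)"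
      by (rule left[OF A(2) *(2,4)])
    finally show "r = (\<Sum>t\<in>A. a t * ev v t)" .
  qed
qed

lemma pre_inner_commute:
  assumes "u \<in> cm_span H" "v \<in> cm_span H"
  shows "pre_inner H u v = pre_inner H v u"
proof -
  obtain A a where A: "finite A" "A \<subseteq> {0..}" "u = (\<Sum>t\<in>A. a t *\<^sub>R R_path H t)"
    using assms(1) by (rule cm_span_cases)
  obtain B b where B: "finite B" "B \<subseteq> {0..}" "v = (\<Sum>s\<in>B. b s *\<^sub>R R_path H s)"
    using assms(2) by (rule cm_span_cases)
  have "pre_inner H u v = (\<Sum>t\<in>A. a t * ev v t)"
    unfolding A(3) by (rule pre_inner_R_path_sum[OF A(1,2) assms(2)])
  also have "\<dots> = (\<Sum>t\<in>A. \<Sum>s\<in>B. a t * b s * R_cov H t s)"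
    unfolding B(3) using A(2) B(2)
    by (intro sum.cong refl, subst ev_R_path_sum) (auto simp: sum_distrib_left mult_ac R_cov_commute[of H _ t for t])
  also have "\<dots> = (\<Sum>s\<in>B. b s * ev u s)"
    unfolding A(3) using A(2) B(2)
    by (subst sum.swap, intro sum.cong refl, subst ev_R_path_sum) (auto simp: sum_distrib_left mult_ac)
  also have "\<dots> = pre_inner H v u"
    unfolding B(3) by (rule pre_inner_R_path_sum[OF B(1,2) assms(1), symmetric])
  finally show ?thesis .
qed

lemma cm_span_closed:
  "u \<in> cm_span H \<Longrightarrow> v \<in> cm_span H \<Longrightarrow> u - v \<in> cm_span H"
  "u \<in> cm_span H \<Longrightarrow> v \<in> cm_span H \<Longrightarrow> u + v \<in> cm_span H"
  "u \<in> cm_span H \<Longrightarrow> c *\<^sub>R u \<in> cm_span H"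
  "0 \<le> t \<Longrightarrow> R_path H t \<in> cm_span H"
  unfolding cm_span_def by (auto intro: span_diff span_add span_scale span_base)

lemma
  assumes "u \<in> cm_span H" "v \<in> cm_span H"
  shows pre_inner_diff_right: "w \<in> cm_span H \<Longrightarrow> pre_inner H u (v - w) = pre_inner H u v - pre_inner H u w"
    and pre_inner_add_right: "w \<in> cm_span H \<Longrightarrow> pre_inner H u (v + w) = pre_inner H u v + pre_inner H u w"
    and pre_inner_scale_right: "pre_inner H u (c *\<^sub>R v) = c * pre_inner H u v"
proof -
  obtain A a where A: "finite A" "A \<subseteq> {0..}" "u = (\<Sum>t\<in>A. a t *\<^sub>R R_path H t)"
    using assms(1) by (rule cm_span_cases)
  show "w \<in> cm_span H \<Longrightarrow> pre_inner H u (v - w) = pre_inner H u v - pre_inner H u w"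
    "w \<in> cm_span H \<Longrightarrow> pre_inner H u (v + w) = pre_inner H u v + pre_inner H u w"
    "pre_inner H u (c *\<^sub>R v) = c * pre_inner H u v"
    unfolding A(3) using A(1,2) assms(2)
    by (auto simp: pre_inner_R_path_sum cm_span_closed sum.distrib sum_subtractf sum_distrib_left algebra_simps)
qed

lemma
  assumes "u \<in> cm_span H" "v \<in> cm_span H"
  shows pre_inner_diff_left: "w \<in> cm_span H \<Longrightarrow> pre_inner H (v - w) u = pre_inner H v u - pre_inner H w u"
    and pre_inner_add_left: "w \<in> cm_span H \<Longrightarrow> pre_inner H (v + w) u = pre_inner H v u + pre_inner H w u"
    and pre_inner_scale_left: "pre_inner H (c *\<^sub>R v) u = c * pre_inner H v u"
  using pre_inner_diff_right[OF assms] pre_inner_add_right[OF assms] pre_inner_scale_right[OF assms] assms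
  by (simp_all add: pre_inner_commute[of _ u] cm_span_closed)

lemmas pre_inner_linear_right = pre_inner_diff_right pre_inner_add_right pre_inner_scale_right
lemmas pre_inner_linear_left = pre_inner_diff_left pre_inner_add_left pre_inner_scale_left

lemma pre_inner_R_path_left:
  assumes "0 \<le> s" "u \<in> cm_span H"
  shows "pre_inner H (R_path H s) u = ev u s"
  using pre_inner_R_path_sum[of "{s}" u "\<lambda>_. 1"] assms by simp

text \<open>The quadratic form of the covariance is the second moment of \<open>\<Sum>t\<in>A. a t * w(t)\<close>.\<close>

lemma pre_inner_nonneg:
  assumes "u \<in> cm_span H"
  shows "0 \<le> pre_inner H u u"
proof -
  obtain A a where A: "finite A" "A \<subseteq> {0..}" "u = (\<Sum>t\<in>A. a t *\<^sub>R R_path H t)"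
    using assms by (rule cm_span_cases)
  have "pre_inner H u u = (\<Sum>t\<in>A. a t * ev u t)"
    using pre_inner_R_path_sum[OF A(1,2) assms, of a] by (simp add: A(3))
  also have "\<dots> = (\<Sum>t\<in>A. \<Sum>s\<in>A. a t * a s * R_cov H t s)"
    unfolding A(3) using A(2)
    by (intro sum.cong refl, subst ev_R_path_sum) (auto simp: sum_distrib_left mult_ac R_cov_commute[of H _ t for t])
  also have "\<dots> = expectation (\<lambda>w. (\<Sum>t\<in>A. a t * ev w t) * (\<Sum>t\<in>A. a t * ev w t))"
    using A by (intro expectation_combination_mult[symmetric]) auto
  also have "\<dots> \<ge> 0"
    by (intro Bochner_Integration.integral_nonneg) simp
  finally show ?thesis .
qed

lemma pre_norm_nonneg [simp]: "u \<in> cm_span H \<Longrightarrow> 0 \<le> pre_norm H u"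
  by (simp add: pre_norm_def pre_inner_nonneg)

lemma pre_norm_square: "u \<in> cm_span H \<Longrightarrow> pre_norm H u * pre_norm H u = pre_inner H u u"
  by (simp add: pre_norm_def pre_inner_nonneg)

lemma pre_Cauchy_Schwarz:
  assumes u: "u \<in> cm_span H" and v: "v \<in> cm_span H"
  shows "\<bar>pre_inner H u v\<bar> \<le> pre_norm H u * pre_norm H v"
proof -
  let ?a = "pre_inner H u u" and ?b = "pre_inner H u v" and ?c = "pre_inner H v v"
  \<comment> \<open>The form may be degenerate a priori, so the discriminant argument has to treat \<open>?c = 0\<close> separately.\<close>
  have q: "0 \<le> ?a + 2 * x * ?b + x * x * ?c" for x
  proof -
    have "pre_inner H (u + x *\<^sub>R v) (u + x *\<^sub>R v) = ?a + 2 * x * ?b + x * x * ?c"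
      using u v pre_inner_commute[OF v u]
      by (simp add: pre_inner_linear_right pre_inner_linear_left cm_span_closed algebra_simps)
    then show ?thesis
      using pre_inner_nonneg[of "u + x *\<^sub>R v"] u v by (simp add: cm_span_closed)
  qed
  have "?b * ?b \<le> ?a * ?c"
  proof (cases "?c = 0")
    case True
    have "?b = 0"
    proof (rule ccontr)
      assume "?b \<noteq> 0"
      then show False
        using q[of "- (?a + 1) / (2 * ?b)"] True by (simp add: field_simps)
    qed
    then show ?thesis
      using True by simp
  next
    case False
    then have c: "0 < ?c"
      using pre_inner_nonneg[OF v] by simp
    have "?a + 2 * (- ?b / ?c) * ?b + (- ?b / ?c) * (- ?b / ?c) * ?c = (?a * ?c - ?b * ?b) / ?c"
      using c by (simp add: field_simps)
    then have "0 \<le> (?a * ?c - ?b * ?b) / ?c"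
      using q[of "- ?b / ?c"] by simp
    then show ?thesis
      using c by (simp add: zero_le_divide_iff)
  qed
  then show ?thesis
    unfolding pre_norm_def real_sqrt_mult[symmetric]
    by (intro real_le_rsqrt) (simp add: power2_eq_square)
qed

definition cm_Cauchy :: "(nat \<Rightarrow> wpath) \<Rightarrow> bool" where
  "cm_Cauchy u \<longleftrightarrow> range u \<subseteq> cm_span H \<and>
    (\<forall>e>0. \<exists>N. \<forall>m\<ge>N. \<forall>n\<ge>N. pre_norm H (u m - u n) < e)"

lemma cm_approx_iff:
  "cm_approx H u h \<longleftrightarrow> cm_Cauchy u \<and> (\<forall>t\<ge>0. (\<lambda>n. ev (u n) t) \<longlonglongrightarrow> ev h t)"
  unfolding cm_approx_def cm_Cauchy_def by blast

lemma cm_Cauchy_span: "cm_Cauchy u \<Longrightarrow> u n \<in> cm_span H"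
  unfolding cm_Cauchy_def by auto

lemma pre_norm_triangle:
  assumes u: "u \<in> cm_span H" and v: "v \<in> cm_span H"
  shows "pre_norm H (u + v) \<le> pre_norm H u + pre_norm H v"
proof (rule power2_le_imp_le)
  have "(pre_norm H (u + v))\<^sup>2 = pre_inner H u u + 2 * pre_inner H u v + pre_inner H v v"
    using u v pre_inner_commute[OF v u]
    by (simp add: power2_eq_square pre_norm_square pre_inner_linear_right pre_inner_linear_left cm_span_closed)
  also have "\<dots> \<le> (pre_norm H u + pre_norm H v)\<^sup>2"
    using pre_Cauchy_Schwarz[OF u v] pre_norm_square[OF u] pre_norm_square[OF v]
    by (simp add: power2_eq_square algebra_simps)
  finally show "(pre_norm H (u + v))\<^sup>2 \<le> (pre_norm H u + pre_norm H v)\<^sup>2" .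
qed (use u v in auto)

lemma cm_Cauchy_bounded:
  assumes "cm_Cauchy u"
  obtains C where "0 < C" "\<And>n. pre_norm H (u n) \<le> C"
proof -
  obtain N where N: "\<And>m n. m \<ge> N \<Longrightarrow> n \<ge> N \<Longrightarrow> pre_norm H (u m - u n) < 1"
    using assms unfolding cm_Cauchy_def by (meson zero_less_one)
  define C where "C = (\<Sum>k\<le>N. pre_norm H (u k)) + 1"
  note span = cm_Cauchy_span[OF assms]
  have *: "pre_norm H (u k) \<le> C - 1" if "k \<le> N" for k
    unfolding C_def using that span by (auto intro!: member_le_sum)
  show ?thesis
  proof (rule that[of C])
    show "0 < C"
      unfolding C_def using span by (auto intro!: add_nonneg_pos sum_nonneg)
    fix n
    show "pre_norm H (u n) \<le> C"
    proof (cases "n \<le> N")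
      case False
      then have "pre_norm H (u n - u N) < 1"
        by (intro N) auto
      moreover have "pre_norm H (u n) \<le> pre_norm H (u n - u N) + pre_norm H (u N)"
        using pre_norm_triangle[of "u n - u N" "u N"] span by (simp add: cm_span_closed)
      ultimately show ?thesis
        using *[of N] by simp
    qed (use * in force)
  qed
qed

lemma cm_Cauchy_diff:
  assumes u: "cm_Cauchy u" and v: "cm_Cauchy v"
  shows "cm_Cauchy (\<lambda>n. u n - v n)"
  unfolding cm_Cauchy_def
proof (intro conjI allI impI)
  note span = cm_Cauchy_span[OF u] cm_Cauchy_span[OF v]
  show "range (\<lambda>n. u n - v n) \<subseteq> cm_span H"
    using span by (auto intro: cm_span_closed)
  fix e :: real assume "e > 0"
  then have "e / 2 > 0" by simp
  obtain N where N: "\<And>m n. m \<ge> N \<Longrightarrow> n \<ge> N \<Longrightarrow> pre_norm H (u m - u n) < e / 2"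
    using u \<open>e / 2 > 0\<close> unfolding cm_Cauchy_def by meson
  obtain N' where N': "\<And>m n. m \<ge> N' \<Longrightarrow> n \<ge> N' \<Longrightarrow> pre_norm H (v m - v n) < e / 2"
    using v \<open>e / 2 > 0\<close> unfolding cm_Cauchy_def by meson
  have "pre_norm H ((u m - v m) - (u n - v n)) < e" if "m \<ge> max N N'" "n \<ge> max N N'" for m n
  proof -
    have eq: "(u m - v m) - (u n - v n) = (u m - u n) + (v n - v m)"
      by simp
    have "pre_norm H ((u m - v m) - (u n - v n)) \<le> pre_norm H (u m - u n) + pre_norm H (v n - v m)"
      unfolding eq using span by (intro pre_norm_triangle cm_span_closed)
    then show ?thesis
      using N[of m n] N'[of n m] that by simp
  qed
  then show "\<exists>N. \<forall>m\<ge>N. \<forall>n\<ge>N. pre_norm H ((u m - v m) - (u n - v n)) < e"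
    by blast
qed

text \<open>This is the point where the completion can be realized by functions: a Cauchy sequence tending to zero pointwise
  is weakly null on the span, since pairing with a combination of kernel functions only sees finitely many values.
  Splitting \<open>(u\<^sub>n, u\<^sub>n) = (u\<^sub>n - u\<^sub>N, u\<^sub>n) + (u\<^sub>N, u\<^sub>n)\<close> then makes it null in norm.\<close>

lemma cm_Cauchy_null:
  assumes u: "cm_Cauchy u" and null: "\<And>t. 0 \<le> t \<Longrightarrow> (\<lambda>n. ev (u n) t) \<longlonglongrightarrow> 0"
  shows "(\<lambda>n. pre_norm H (u n)) \<longlonglongrightarrow> 0"
proof -
  note span = cm_Cauchy_span[OF u]
  obtain C where C: "0 < C" "\<And>n. pre_norm H (u n) \<le> C"
    using cm_Cauchy_bounded[OF u] by blast
  have "(\<lambda>n. pre_inner H (u n) (u n)) \<longlonglongrightarrow> 0"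
  proof (rule LIMSEQ_I)
    fix e :: real assume "e > 0"
    then have e: "e / (2 * C) > 0" using C by simp
    obtain N where N: "\<And>m n. m \<ge> N \<Longrightarrow> n \<ge> N \<Longrightarrow> pre_norm H (u m - u n) < e / (2 * C)"
      using u e unfolding cm_Cauchy_def by meson
    obtain A a where A: "finite A" "A \<subseteq> {0..}" "u N = (\<Sum>t\<in>A. a t *\<^sub>R R_path H t)"
      using span by (rule cm_span_cases)
    have "(\<lambda>n. \<Sum>t\<in>A. a t * ev (u n) t) \<longlonglongrightarrow> (\<Sum>t\<in>A. a t * 0)"
      using A(2) by (intro tendsto_intros null) auto
    then have "(\<lambda>n. pre_inner H (u N) (u n)) \<longlonglongrightarrow> 0"
      unfolding A(3) using A(1,2) span by (simp add: pre_inner_R_path_sum)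
    then obtain N' where N': "\<And>n. n \<ge> N' \<Longrightarrow> \<bar>pre_inner H (u N) (u n)\<bar> < e / 2"
      using LIMSEQ_D[of _ 0 "e / 2"] \<open>e > 0\<close> by (metis diff_zero half_gt_zero real_norm_def)
    have "norm (pre_inner H (u n) (u n) - 0) < e" if "n \<ge> max N N'" for n
    proof -
      have "pre_inner H (u n) (u n) = pre_inner H (u n - u N) (u n) + pre_inner H (u N) (u n)"
        using span by (simp add: pre_inner_linear_left)
      moreover have "\<bar>pre_inner H (u n - u N) (u n)\<bar> \<le> pre_norm H (u n - u N) * pre_norm H (u n)"
        using span by (intro pre_Cauchy_Schwarz cm_span_closed)
      moreover have "pre_norm H (u n - u N) * pre_norm H (u n) \<le> e / (2 * C) * C"
        using N[of n N] C span that e by (intro mult_mono) (auto simp: cm_span_closed less_imp_le)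
      moreover have "e / (2 * C) * C = e / 2"
        using C by simp
      ultimately show ?thesis
        using N'[of n] that by simp
    qed
    then show "\<exists>N. \<forall>n\<ge>N. norm (pre_inner H (u n) (u n) - 0) < e"
      by blast
  qed
  then show ?thesis
    unfolding pre_norm_def using tendsto_real_sqrt by fastforce
qed

lemma cm_Cauchy_inner_convergent:
  assumes u: "cm_Cauchy u" and v: "cm_Cauchy v"
  shows "convergent (\<lambda>n. pre_inner H (u n) (v n))"
proof (rule real_Cauchy_convergent, rule metric_CauchyI)
  note span = cm_Cauchy_span[OF u] cm_Cauchy_span[OF v]
  obtain C where C: "0 < C" "\<And>n. pre_norm H (u n) \<le> C"
    using cm_Cauchy_bounded[OF u] by blast
  obtain D where D: "0 < D" "\<And>n. pre_norm H (v n) \<le> D"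
    using cm_Cauchy_bounded[OF v] by blast
  fix e :: real assume "e > 0"
  then have e: "e / (2 * D) > 0" "e / (2 * C) > 0" using C D by simp_all
  obtain N where N: "\<And>m n. m \<ge> N \<Longrightarrow> n \<ge> N \<Longrightarrow> pre_norm H (u m - u n) < e / (2 * D)"
    using u e(1) unfolding cm_Cauchy_def by meson
  obtain N' where N': "\<And>m n. m \<ge> N' \<Longrightarrow> n \<ge> N' \<Longrightarrow> pre_norm H (v m - v n) < e / (2 * C)"
    using v e(2) unfolding cm_Cauchy_def by meson
  have "dist (pre_inner H (u m) (v m)) (pre_inner H (u n) (v n)) < e"
    if "m \<ge> max N N'" "n \<ge> max N N'" for m n
  proof -
    have "pre_inner H (u m) (v m) - pre_inner H (u n) (v n) =
        pre_inner H (u m - u n) (v m) + pre_inner H (u n) (v m - v n)"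
      using span by (simp add: pre_inner_linear_left pre_inner_linear_right)
    moreover have "\<bar>pre_inner H (u m - u n) (v m)\<bar> \<le> pre_norm H (u m - u n) * pre_norm H (v m)"
      "\<bar>pre_inner H (u n) (v m - v n)\<bar> \<le> pre_norm H (u n) * pre_norm H (v m - v n)"
      using span by (intro pre_Cauchy_Schwarz cm_span_closed; simp)+
    moreover have "pre_norm H (u m - u n) * pre_norm H (v m) \<le> pre_norm H (u m - u n) * D"
      "pre_norm H (u n) * pre_norm H (v m - v n) \<le> C * pre_norm H (v m - v n)"
      using span C D by (auto intro!: mult_left_mono mult_right_mono simp: cm_span_closed)
    moreover have "pre_norm H (u m - u n) * D < e / 2" "C * pre_norm H (v m - v n) < e / 2"
      using N[of m n] N'[of m n] that C D by (auto simp: field_simps)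
    ultimately show ?thesis
      by (simp add: dist_real_def)
  qed
  then show "\<exists>M. \<forall>m\<ge>M. \<forall>n\<ge>M. dist (pre_inner H (u m) (v m)) (pre_inner H (u n) (v n)) < e"
    by blast
qed

text \<open>Independence of the approximating sequences: two of them with the same pointwise limit differ by a
  pointwise null Cauchy sequence, hence by one that is null in norm.\<close>

lemma cm_inner_limit:
  assumes g: "cm_approx H u g" and h: "cm_approx H v h"
  shows "(\<lambda>n. pre_inner H (u n) (v n)) \<longlonglongrightarrow> cm_inner H g h"
proof -
  have uv: "cm_Cauchy u" "cm_Cauchy v"
    using g h by (auto simp: cm_approx_iff)
  obtain l where l: "(\<lambda>n. pre_inner H (u n) (v n)) \<longlonglongrightarrow> l"
    using cm_Cauchy_inner_convergent[OF uv] by (auto simp: convergent_def)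
  have "cm_inner H g h = l"
    unfolding cm_inner_def
  proof (rule the_equality)
    show "\<exists>u v. cm_approx H u g \<and> cm_approx H v h \<and> (\<lambda>n. pre_inner H (u n) (v n)) \<longlonglongrightarrow> l"
      using g h l by blast
    fix r assume "\<exists>u v. cm_approx H u g \<and> cm_approx H v h \<and> (\<lambda>n. pre_inner H (u n) (v n)) \<longlonglongrightarrow> r"
    then obtain u' v' where g': "cm_approx H u' g" and h': "cm_approx H v' h"
      and r: "(\<lambda>n. pre_inner H (u' n) (v' n)) \<longlonglongrightarrow> r"
      by blast
    have uv': "cm_Cauchy u'" "cm_Cauchy v'"
      using g' h' by (auto simp: cm_approx_iff)
    note span = uv[THEN cm_Cauchy_span] uv'[THEN cm_Cauchy_span]
    have du: "(\<lambda>n. pre_norm H (u n - u' n)) \<longlonglongrightarrow> 0"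
    proof (rule cm_Cauchy_null)
      fix t :: real assume "0 \<le> t"
      then show "(\<lambda>n. ev (u n - u' n) t) \<longlonglongrightarrow> 0"
        using g g' tendsto_diff[of "\<lambda>n. ev (u n) t" "ev g t" sequentially "\<lambda>n. ev (u' n) t" "ev g t"]
        by (simp add: cm_approx_iff)
    qed (intro cm_Cauchy_diff uv uv')
    have dv: "(\<lambda>n. pre_norm H (v n - v' n)) \<longlonglongrightarrow> 0"
    proof (rule cm_Cauchy_null)
      fix t :: real assume "0 \<le> t"
      then show "(\<lambda>n. ev (v n - v' n) t) \<longlonglongrightarrow> 0"
        using h h' tendsto_diff[of "\<lambda>n. ev (v n) t" "ev h t" sequentially "\<lambda>n. ev (v' n) t" "ev h t"]
        by (simp add: cm_approx_iff)
    qed (intro cm_Cauchy_diff uv uv')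
    obtain C where C: "\<And>n. pre_norm H (v n) \<le> C"
      using cm_Cauchy_bounded[OF uv(2)] by metis
    obtain D where D: "\<And>n. pre_norm H (u' n) \<le> D"
      using cm_Cauchy_bounded[OF uv'(1)] by metis
    have "(\<lambda>n. pre_inner H (u n) (v n) - pre_inner H (u' n) (v' n)) \<longlonglongrightarrow> 0"
    proof (rule Lim_null_comparison)
      show "(\<lambda>n. pre_norm H (u n - u' n) * C + D * pre_norm H (v n - v' n)) \<longlonglongrightarrow> 0"
        using tendsto_add[OF tendsto_mult_right[OF du, of C] tendsto_mult_left[OF dv, of D]] by simp
      have "norm (pre_inner H (u n) (v n) - pre_inner H (u' n) (v' n)) \<le>
          pre_norm H (u n - u' n) * C + D * pre_norm H (v n - v' n)" for n
      proof -
        have "pre_inner H (u n) (v n) - pre_inner H (u' n) (v' n) =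
            pre_inner H (u n - u' n) (v n) + pre_inner H (u' n) (v n - v' n)"
          using span by (simp add: pre_inner_linear_left pre_inner_linear_right)
        moreover have "\<bar>pre_inner H (u n - u' n) (v n)\<bar> \<le> pre_norm H (u n - u' n) * pre_norm H (v n)"
          "\<bar>pre_inner H (u' n) (v n - v' n)\<bar> \<le> pre_norm H (u' n) * pre_norm H (v n - v' n)"
          using span by (intro pre_Cauchy_Schwarz cm_span_closed; simp)+
        moreover have "pre_norm H (u n - u' n) * pre_norm H (v n) \<le> pre_norm H (u n - u' n) * C"
          "pre_norm H (u' n) * pre_norm H (v n - v' n) \<le> D * pre_norm H (v n - v' n)"
          using span C D by (auto intro!: mult_left_mono mult_right_mono simp: cm_span_closed)
        ultimately show ?thesis
          by simp
      qed
      then show "\<forall>\<^sub>F n in sequentially. norm (pre_inner H (u n) (v n) - pre_inner H (u' n) (v' n)) \<le>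
          pre_norm H (u n - u' n) * C + D * pre_norm H (v n - v' n)"
        by simp
    qed
    from tendsto_diff[OF l this] have "(\<lambda>n. pre_inner H (u' n) (v' n)) \<longlonglongrightarrow> l"
      by simp
    then show "r = l"
      using r LIMSEQ_unique by blast
  qed
  then show ?thesis
    using l by simp
qed

lemma cm_approx_const:
  assumes "g \<in> cm_span H"
  shows "cm_approx H (\<lambda>_. g) g"
proof -
  have "pre_norm H 0 = 0"
    using pre_inner_R_path_sum[of "{}" 0 "\<lambda>_. 0"] by (simp add: pre_norm_def cm_span_def span_zero)
  then show ?thesis
    using assms by (auto simp: cm_approx_def)
qed

lemma cm_span_subset: "cm_span H \<subseteq> cm_space H"
  using cm_approx_const by (auto simp: cm_space_def)

lemma cm_space_diff:
  assumes "g \<in> cm_space H" "h \<in> cm_space H"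
  shows "g - h \<in> cm_space H"
proof -
  obtain u v where "cm_approx H u g" "cm_approx H v h"
    using assms by (auto simp: cm_space_def)
  then have "cm_approx H (\<lambda>n. u n - v n) (g - h)"
    by (auto simp: cm_approx_iff cm_Cauchy_diff intro!: tendsto_diff)
  then show ?thesis
    by (auto simp: cm_space_def)
qed

lemma cm_inner_R_path_sum:
  assumes "finite I" and t: "\<And>i. i \<in> I \<Longrightarrow> 0 \<le> t i" and h: "h \<in> cm_space H"
  shows "cm_inner H (\<Sum>i\<in>I. a i *\<^sub>R R_path H (t i)) h = (\<Sum>i\<in>I. a i * ev h (t i))"
proof -
  obtain v where v: "cm_approx H v h"
    using h by (auto simp: cm_space_def)
  then have span: "v n \<in> cm_span H" for n
    by (auto simp: cm_approx_iff intro: cm_Cauchy_span)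
  have "pre_inner H (\<Sum>i\<in>I. a i *\<^sub>R R_path H (t i)) (v n) = (\<Sum>i\<in>I. a i * ev (v n) (t i))" for n
    using \<open>finite I\<close> t
  proof (induction I)
    case empty
    then show ?case
      using pre_inner_R_path_sum[of "{}" "v n"] span by simp
  next
    case (insert i I)
    then show ?case
      using span by (simp add: pre_inner_linear_left cm_span_closed cm_span_sum pre_inner_R_path_left)
  qed
  then have "(\<lambda>n. pre_inner H (\<Sum>i\<in>I. a i *\<^sub>R R_path H (t i)) (v n)) \<longlonglongrightarrow> (\<Sum>i\<in>I. a i * ev h (t i))"
    using v t by (auto simp: cm_approx_iff intro!: tendsto_intros)
  moreover have "(\<lambda>n. pre_inner H (\<Sum>i\<in>I. a i *\<^sub>R R_path H (t i)) (v n)) \<longlonglongrightarrow>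
      cm_inner H (\<Sum>i\<in>I. a i *\<^sub>R R_path H (t i)) h"
    using cm_inner_limit[OF cm_approx_const v] cm_span_sum t by metis
  ultimately show ?thesis
    using LIMSEQ_unique by blast
qed

lemma cm_inner_R_path_right:
  assumes "h \<in> cm_space H" "0 \<le> s"
  shows "cm_inner H h (R_path H s) = ev h s"
proof -
  obtain u where u: "cm_approx H u h"
    using assms by (auto simp: cm_space_def)
  then have span: "u n \<in> cm_span H" for n
    by (auto simp: cm_approx_iff intro: cm_Cauchy_span)
  have "pre_inner H (u n) (R_path H s) = ev (u n) s" for n
    using pre_inner_commute[of "u n" "R_path H s"] assms span
    by (simp add: pre_inner_R_path_left cm_span_closed)
  then have "(\<lambda>n. pre_inner H (u n) (R_path H s)) \<longlonglongrightarrow> ev h s"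
    using u assms by (simp add: cm_approx_iff)
  moreover have "(\<lambda>n. pre_inner H (u n) (R_path H s)) \<longlonglongrightarrow> cm_inner H h (R_path H s)"
    using cm_inner_limit[OF u cm_approx_const] assms by (simp add: cm_span_closed)
  ultimately show ?thesis
    using LIMSEQ_unique by blast
qed

text \<open>Cauchy--Schwarz for \<open>h(s) = (h, R_path H s)\<close>, where the kernel function has norm \<open>s powr H\<close>.\<close>

lemma ev_le_cm_norm:
  assumes "h \<in> cm_space H" "0 \<le> s"
  shows "\<bar>ev h s\<bar> \<le> s powr H * cm_norm H h"
proof -
  obtain u where u: "cm_approx H u h"
    using assms by (auto simp: cm_space_def)
  then have span: "u n \<in> cm_span H" for n
    by (auto simp: cm_approx_iff intro: cm_Cauchy_span)
  have 1: "(\<lambda>n. \<bar>ev (u n) s\<bar>) \<longlonglongrightarrow> \<bar>ev h s\<bar>"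
    using u assms by (auto simp: cm_approx_iff intro!: tendsto_intros)
  have 2: "(\<lambda>n. s powr H * pre_norm H (u n)) \<longlonglongrightarrow> s powr H * cm_norm H h"
    unfolding pre_norm_def cm_norm_def by (intro tendsto_intros cm_inner_limit u)
  have "pre_norm H (R_path H s) = sqrt (s powr (2 * H))"
    using assms H_pos by (simp add: pre_norm_def pre_inner_R_path_left cm_span_closed ev_R_path R_cov_diag)
  also have "\<dots> = s powr H"
    by (simp add: powr_half_sqrt[symmetric] powr_powr)
  finally have "\<bar>ev (u n) s\<bar> \<le> s powr H * pre_norm H (u n)" for n
    using pre_Cauchy_Schwarz[of "R_path H s" "u n"] assms span
    by (simp add: pre_inner_R_path_left cm_span_closed)
  then show ?thesis
    by (intro LIMSEQ_le[OF 1 2]) blast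
qed

lemma cm_norm_nonneg:
  assumes "h \<in> cm_space H"
  shows "0 \<le> cm_norm H h"
proof -
  have "\<bar>ev h 1\<bar> \<le> cm_norm H h"
    using ev_le_cm_norm[OF assms, of 1] by simp
  then show ?thesis
    by simp
qed

lemma space_cm_borel: "space (cm_borel H) = cm_space H"
  unfolding cm_borel_def by (rule space_measure_of) auto

text \<open>Evaluations are Lipschitz in the Cameron--Martin norm; the \<open>1\<close> added to the Lipschitz constant avoids a division by
  zero at \<open>s = 0\<close>.\<close>

lemma ev_measurable_cm_borel:
  assumes "0 \<le> s"
  shows "(\<lambda>h. ev h s) \<in> borel_measurable (cm_borel H)"
proof (rule borel_measurableI)
  fix S :: "real set" assume "open S"
  have "\<exists>e>0. \<forall>g\<in>cm_space H. cm_norm H (g - h) < e \<longrightarrow> ev g s \<in> S"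
    if h: "h \<in> cm_space H" "ev h s \<in> S" for h
  proof -
    obtain e where e: "e > 0" "\<And>y. \<bar>y - ev h s\<bar> < e \<Longrightarrow> y \<in> S"
      using \<open>open S\<close> h by (auto simp: open_dist dist_real_def)
    have "ev g s \<in> S" if g: "g \<in> cm_space H" "cm_norm H (g - h) < e / (s powr H + 1)" for g
    proof (rule e(2))
      have "0 < s powr H + 1"
        by (simp add: add_nonneg_pos)
      have "\<bar>ev g s - ev h s\<bar> \<le> s powr H * cm_norm H (g - h)"
        using ev_le_cm_norm[OF cm_space_diff[OF g(1) h(1)] assms] by simp
      also have "\<dots> \<le> (s powr H + 1) * cm_norm H (g - h)"
        using cm_norm_nonneg[OF cm_space_diff[OF g(1) h(1)]] by (intro mult_right_mono) auto
      also have "\<dots> < e"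
        using g(2) \<open>0 < s powr H + 1\<close> by (simp add: field_simps)
      finally show "\<bar>ev g s - ev h s\<bar> < e" .
    qed
    then show ?thesis
      using e(1) by (intro exI[of _ "e / (s powr H + 1)"]) (auto simp: add_nonneg_pos)
  qed
  then show "(\<lambda>h. ev h s) -` S \<inter> space (cm_borel H) \<in> sets (cm_borel H)"
    unfolding space_cm_borel unfolding cm_borel_def by (subst sets_measure_of) auto
qed

end

section \<open>Cylinder functions and their gradients\<close>

lemma tendsto_coordinatewise:
  fixes g :: "'a \<Rightarrow> nat \<Rightarrow> real"
  assumes "\<And>i. ((\<lambda>c. g c i) \<longlongrightarrow> l i) F"
  shows "(g \<longlongrightarrow> l) F"
  using limitin_componentwise[of "\<lambda>_. euclidean" UNIV g l F] assms
  by (simp add: euclidean_product_topology)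

lemma MVT_increment:
  fixes g g' :: "real \<Rightarrow> real"
  assumes "\<And>x. (g has_real_derivative g' x) (at x)"
  shows "\<exists>z. \<bar>z - a\<bar> \<le> \<bar>h\<bar> \<and> g (a + h) - g a = h * g' z"
proof -
  consider "h = 0" | "h > 0" | "h < 0" by linarith
  then show ?thesis
  proof cases
    case 1
    then show ?thesis by (intro exI[of _ a]) simp
  next
    case 2
    then obtain z where "z > a" "z < a + h" "g (a + h) - g a = (a + h - a) * g' z"
      using MVT2[of a "a + h" g g'] assms by auto
    then show ?thesis
      by (intro exI[of _ z]) auto
  next
    case 3
    then obtain z where "z > a + h" "z < a" "g a - g (a + h) = (a - (a + h)) * g' z"
      using MVT2[of "a + h" a g g'] assms by auto
    then show ?thesis
      by (intro exI[of _ z]) (auto simp: algebra_simps)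
  qed
qed

lemma
  assumes "f \<in> Cb_infinity n"
  shows Cb_infinity_cong: "(\<And>i. i < n \<Longrightarrow> x i = y i) \<Longrightarrow> f x = f y"
    and Cb_infinity_continuous: "continuous_on UNIV f"
    and Cb_infinity_bounded: "bounded (range f)"
    and partial_deriv_continuous: "i < n \<Longrightarrow> continuous_on UNIV (partial_deriv i f)"
    and partial_deriv_bounded: "i < n \<Longrightarrow> bounded (range (partial_deriv i f))"
    and has_partial_deriv:
      "i < n \<Longrightarrow> ((\<lambda>s. f (x(i := s))) has_real_derivative partial_deriv i f (x(i := r))) (at r)"
proof -
  have *: "continuous_on UNIV (foldr partial_deriv is f)" "bounded (range (foldr partial_deriv is f))"
    "\<And>i x. i < n \<Longrightarrow> (\<lambda>s. foldr partial_deriv is f (x(i := s))) differentiable (at (x i))"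
    if "set is \<subseteq> {..<n}" for "is"
    using assms that unfolding Cb_infinity_def Let_def by blast+
  show "(\<And>i. i < n \<Longrightarrow> x i = y i) \<Longrightarrow> f x = f y"
    using assms unfolding Cb_infinity_def by blast
  show "continuous_on UNIV f" "bounded (range f)"
    using *(1,2)[of "[]"] by simp_all
  assume i: "i < n"
  show "continuous_on UNIV (partial_deriv i f)" "bounded (range (partial_deriv i f))"
    using *(1,2)[of "[i]"] i by simp_all
  have "(\<lambda>s. f (x(i := s))) differentiable (at r)"
    using *(3)[of "[]" i "x(i := r)"] i by simp
  then show "((\<lambda>s. f (x(i := s))) has_real_derivative partial_deriv i f (x(i := r))) (at r)"
    unfolding partial_deriv_def by (simp add: DERIV_deriv_iff_real_differentiable)
qed

lemma partial_deriv_cong: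
  assumes "f \<in> Cb_infinity n" "i < n" "\<And>i. i < n \<Longrightarrow> x i = y i"
  shows "partial_deriv i f x = partial_deriv i f y"
proof -
  have "f (x(i := s)) = f (y(i := s))" for s
    using assms(3) by (intro Cb_infinity_cong[OF assms(1)]) simp
  then show ?thesis
    using assms by (simp add: partial_deriv_def)
qed

text \<open>Smoothness is only given coordinate by coordinate. Moving one coordinate at a time, each increment is a
  one-dimensional one, and joint continuity of the partial derivatives identifies the limit of its difference quotient.\<close>

lemma Cb_infinity_chain_rule_0:
  assumes f: "f \<in> Cb_infinity n"
  shows "((\<lambda>\<epsilon>. f (\<lambda>i. x i + \<epsilon> * y i)) has_real_derivative (\<Sum>i<n. partial_deriv i f x * y i)) (at 0)"
proof -
  define z where "z k \<epsilon> = (\<lambda>i. if i < k then x i + \<epsilon> * y i else x i)" for k :: nat and \<epsilon> :: real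
  have "((\<lambda>\<epsilon>. f (z k \<epsilon>)) has_real_derivative (\<Sum>i<k. partial_deriv i f x * y i)) (at 0)" if "k \<le> n" for k
    using that
  proof (induction k)
    case 0
    then show ?case by (simp add: z_def)
  next
    case (Suc k)
    then have "k < n" by simp
    have "\<exists>r. \<bar>r - x k\<bar> \<le> \<bar>\<epsilon> * y k\<bar> \<and> f (z (Suc k) \<epsilon>) - f (z k \<epsilon>) = \<epsilon> * y k * partial_deriv k f ((z k \<epsilon>)(k := r))" for \<epsilon>
    proof -
      have eq: "z (Suc k) \<epsilon> = (z k \<epsilon>)(k := x k + \<epsilon> * y k)" "z k \<epsilon> = (z k \<epsilon>)(k := x k)"
        by (auto simp: z_def fun_eq_iff less_Suc_eq)
      show ?thesis
        using MVT_increment[OF has_partial_deriv[OF f \<open>k < n\<close>, of "z k \<epsilon>"], of "x k" "\<epsilon> * y k"]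
        by (simp flip: eq)
    qed
    then obtain r where r: "\<And>\<epsilon>. \<bar>r \<epsilon> - x k\<bar> \<le> \<bar>\<epsilon> * y k\<bar>"
      and inc: "\<And>\<epsilon>. f (z (Suc k) \<epsilon>) - f (z k \<epsilon>) = \<epsilon> * y k * partial_deriv k f ((z k \<epsilon>)(k := r \<epsilon>))"
      by metis
    have "((\<lambda>\<epsilon>. r \<epsilon> - x k) \<longlongrightarrow> 0) (at 0)"
    proof (rule Lim_null_comparison)
      show "\<forall>\<^sub>F \<epsilon> in at 0. norm (r \<epsilon> - x k) \<le> \<bar>\<epsilon> * y k\<bar>"
        using r by simp
      have "((\<lambda>\<epsilon>. \<bar>\<epsilon> * y k\<bar>) \<longlongrightarrow> \<bar>0 * y k\<bar>) (at 0)"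
        by (intro tendsto_intros)
      then show "((\<lambda>\<epsilon>. \<bar>\<epsilon> * y k\<bar>) \<longlongrightarrow> 0) (at 0)"
        by simp
    qed
    then have r_lim: "(r \<longlongrightarrow> x k) (at 0)"
      by (simp add: LIM_zero_iff)
    have "((\<lambda>\<epsilon>. (z k \<epsilon>)(k := r \<epsilon>)) \<longlongrightarrow> x) (at 0)"
    proof (rule tendsto_coordinatewise)
      fix i
      have "((\<lambda>\<epsilon>. x i + \<epsilon> * y i) \<longlongrightarrow> x i + 0 * y i) (at 0)"
        by (intro tendsto_intros)
      then show "((\<lambda>\<epsilon>. ((z k \<epsilon>)(k := r \<epsilon>)) i) \<longlongrightarrow> x i) (at 0)"
        using r_lim by (cases "i = k"; cases "i < k") (simp_all add: z_def)
    qed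
    note p_lim = this
    have "isCont (partial_deriv k f) x"
      using partial_deriv_continuous[OF f \<open>k < n\<close>] by (simp add: continuous_on_eq_continuous_at)
    from isCont_tendsto_compose[OF this p_lim] have lim: "((\<lambda>\<epsilon>. y k * partial_deriv k f ((z k \<epsilon>)(k := r \<epsilon>))) \<longlongrightarrow> y k * partial_deriv k f x) (at 0)"
      by (intro tendsto_mult tendsto_const)
    have "((\<lambda>\<epsilon>. f (z (Suc k) \<epsilon>) - f (z k \<epsilon>)) has_real_derivative y k * partial_deriv k f x) (at 0)"
      unfolding DERIV_def
    proof (rule Lim_transform_eventually[OF lim])
      have "z (Suc k) 0 = z k 0"
        by (simp add: z_def fun_eq_iff)
      then show "\<forall>\<^sub>F \<epsilon> in at 0. y k * partial_deriv k f ((z k \<epsilon>)(k := r \<epsilon>)) =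
          (f (z (Suc k) (0 + \<epsilon>)) - f (z k (0 + \<epsilon>)) - (f (z (Suc k) 0) - f (z k 0))) / \<epsilon>"
        by (auto simp: inc eventually_at_filter)
    qed
    from DERIV_add[OF Suc.IH this] show ?case
      using \<open>k < n\<close> by (simp add: mult.commute)
  qed
  from this[of n] show ?thesis
    using Cb_infinity_cong[OF f, of "z n \<epsilon>" "\<lambda>i. x i + \<epsilon> * y i" for \<epsilon>] by (simp add: z_def)
qed

lemma Cb_infinity_chain_rule:
  assumes f: "f \<in> Cb_infinity n"
  shows "((\<lambda>a. f (\<lambda>i. x i + a * y i)) has_real_derivative
    (\<Sum>i<n. partial_deriv i f (\<lambda>i. x i + a * y i) * y i)) (at a)"
proof -
  have "((\<lambda>a. f (\<lambda>i. x i + a * y i)) has_real_derivative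
    (\<Sum>i<n. partial_deriv i f (\<lambda>i. x i + a * y i) * y i)) (at (0 + a))"
    unfolding DERIV_shift
    using Cb_infinity_chain_rule_0[OF f, of "\<lambda>i. x i + a * y i" y] by (simp add: algebra_simps)
  then show ?thesis
    by simp
qed

context fractional_brownian_motion
begin

text \<open>Uniqueness in the defining description follows by testing with kernel functions, which recover all values of a
  candidate gradient.\<close>

lemma grad1_cylinder:
  assumes f: "f \<in> Cb_infinity n" and t: "\<And>i. i < n \<Longrightarrow> 0 \<le> t i"
  shows "grad1 H (\<lambda>(w, \<tau>). f (\<lambda>i. ev w (t i * tau_H H \<tau>))) (w, \<tau>) =
    (\<Sum>i<n. partial_deriv i f (\<lambda>i. ev w (t i * tau_H H \<tau>)) *\<^sub>R R_path H (t i * tau_H H \<tau>))"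
    (is "grad1 H ?F _ = ?g")
proof -
  have t\<tau>: "0 \<le> t i * tau_H H \<tau>" if "i < n" for i
    using t[OF that] by (simp add: tau_H_def)
  have deriv: "has_dir_deriv ?F h (w, \<tau>) (\<Sum>i<n. partial_deriv i f (\<lambda>i. ev w (t i * tau_H H \<tau>)) * ev h (t i * tau_H H \<tau>))" for h
    using Cb_infinity_chain_rule_0[OF f, of "\<lambda>i. ev w (t i * tau_H H \<tau>)" "\<lambda>i. ev h (t i * tau_H H \<tau>)"]
    by (simp add: has_dir_deriv_def DERIV_def)
  have g_space: "?g \<in> cm_space H"
    using t\<tau> by (intro subsetD[OF cm_span_subset] cm_span_sum) auto
  have inner: "cm_inner H ?g h = (\<Sum>i<n. partial_deriv i f (\<lambda>i. ev w (t i * tau_H H \<tau>)) * ev h (t i * tau_H H \<tau>))"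
    if "h \<in> cm_space H" for h
    using that t\<tau> by (intro cm_inner_R_path_sum) auto
  show ?thesis
    unfolding grad1_def
  proof (rule the_equality)
    show "?g \<in> cm_space H \<and> (\<forall>h\<in>cm_space H. has_dir_deriv ?F h (w, \<tau>) (cm_inner H ?g h))"
      using g_space deriv inner by simp
    fix g' assume g': "g' \<in> cm_space H \<and> (\<forall>h\<in>cm_space H. has_dir_deriv ?F h (w, \<tau>) (cm_inner H g' h))"
    show "g' = ?g"
    proof (rule wpath_eqI)
      fix s
      show "ev g' s = ev ?g s"
      proof (cases "0 \<le> s")
        case True
        then have R: "R_path H s \<in> cm_space H"
          using cm_span_subset cm_span_closed(4) by blast
        have "has_dir_deriv ?F (R_path H s) (w, \<tau>) (cm_inner H g' (R_path H s))"
          "has_dir_deriv ?F (R_path H s) (w, \<tau>) (cm_inner H ?g (R_path H s))"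
          using g' R deriv inner by simp_all
        then have "cm_inner H g' (R_path H s) = cm_inner H ?g (R_path H s)"
          unfolding has_dir_deriv_def by (rule tendsto_unique[rotated]) simp
        then show ?thesis
          using True g' g_space by (simp only: cm_inner_R_path_right)
      qed (simp add: ev_nonpos)
    qed
  qed
qed

end

section \<open>Gaussian integration by parts\<close>

text \<open>The derivative of \<open>\<psi>\<close> times the density \<open>n\<close> is \<open>n \<psi>' - n \<psi> x / \<sigma>\<^sup>2\<close>, and the product vanishes at both ends of the
  line.\<close>

lemma gaussian_integration_by_parts_real:
  fixes \<psi> \<psi>' :: "real \<Rightarrow> real"
  assumes \<sigma>: "0 < \<sigma>"
    and deriv: "\<And>x. (\<psi> has_real_derivative \<psi>' x) (at x)"
    and cont: "continuous_on UNIV \<psi>'"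
    and bound: "\<And>x. \<bar>\<psi> x\<bar> \<le> B" "\<And>x. \<bar>\<psi>' x\<bar> \<le> B'"
  shows "(\<integral>x. normal_density 0 \<sigma> x * (\<psi> x * x) \<partial>lborel) = \<sigma>\<^sup>2 * (\<integral>x. normal_density 0 \<sigma> x * \<psi>' x \<partial>lborel)"
proof -
  let ?n = "normal_density 0 \<sigma>"
  have n_deriv: "(?n has_real_derivative - (x / \<sigma>\<^sup>2) * ?n x) (at x)" for x
    unfolding normal_density_def using \<sigma>
    by (auto intro!: derivative_eq_intros simp: field_simps power2_eq_square)
  have \<psi>_cont: "continuous_on UNIV \<psi>"
    using deriv by (meson DERIV_isCont continuous_at_imp_continuous_on)
  have n_cont: "continuous_on UNIV ?n"
    using n_deriv by (meson DERIV_isCont continuous_at_imp_continuous_on)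
  have [measurable]: "\<psi> \<in> borel_measurable borel" "\<psi>' \<in> borel_measurable borel"
    by (intro borel_measurable_continuous_onI \<psi>_cont cont)+
  have int': "integrable lborel (\<lambda>x. ?n x * \<psi>' x)"
  proof (rule Bochner_Integration.integrable_bound)
    show "integrable lborel (\<lambda>x. B' * ?n x)"
      using integrable_normal_density[OF \<sigma>] by simp
    show "AE x in lborel. norm (?n x * \<psi>' x) \<le> norm (B' * ?n x)"
    proof (intro AE_I2)
      fix x
      have "\<bar>\<psi>' x\<bar> \<le> \<bar>B'\<bar>"
        using bound(2)[of x] by linarith
      then show "norm (?n x * \<psi>' x) \<le> norm (B' * ?n x)"
        by (simp add: abs_mult mult.commute[of "?n x"] mult_right_mono)
    qed
  qed simp
  have int: "integrable lborel (\<lambda>x. ?n x * (\<psi> x * x))"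
  proof (rule Bochner_Integration.integrable_bound)
    show "integrable lborel (\<lambda>x. B * (?n x * \<bar>x\<bar>))"
      using integrable_normal_moment_abs[OF \<sigma>, of 0 1] by simp
    show "AE x in lborel. norm (?n x * (\<psi> x * x)) \<le> norm (B * (?n x * \<bar>x\<bar>))"
    proof (intro AE_I2)
      fix x
      have "\<bar>\<psi> x\<bar> \<le> \<bar>B\<bar>"
        using bound(1)[of x] by linarith
      then have "\<bar>\<psi> x\<bar> * (?n x * \<bar>x\<bar>) \<le> \<bar>B\<bar> * (?n x * \<bar>x\<bar>)"
        by (intro mult_right_mono) auto
      then show "norm (?n x * (\<psi> x * x)) \<le> norm (B * (?n x * \<bar>x\<bar>))"
        by (simp add: abs_mult mult_ac)
    qed
  qed simp
  have dint: "integrable lborel (\<lambda>x. ?n x * \<psi>' x - (?n x * (\<psi> x * x)) / \<sigma>\<^sup>2)"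
    using int int' by auto
  have n_lim: "(?n \<longlongrightarrow> 0) at_top" "(?n \<longlongrightarrow> 0) at_bot"
    unfolding normal_density_def using \<sigma> by real_asymp+
  have prod_lim: "((\<lambda>x. ?n x * \<psi> x) \<longlongrightarrow> 0) G" if "(?n \<longlongrightarrow> 0) G" for G
  proof (rule Lim_null_comparison)
    show "((\<lambda>x. B * ?n x) \<longlongrightarrow> 0) G"
      using tendsto_mult_left[OF that, of B] by simp
    have "norm (?n x * \<psi> x) \<le> B * ?n x" for x
      using bound(1)[of x] by (simp add: abs_mult mult.commute[of "?n x"] mult_right_mono)
    then show "\<forall>\<^sub>F x in G. norm (?n x * \<psi> x) \<le> B * ?n x"
      by simp
  qed
  have "(LBINT x=-\<infinity>..\<infinity>. ?n x * \<psi>' x - (?n x * (\<psi> x * x)) / \<sigma>\<^sup>2) = 0 - 0"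
  proof (rule interval_integral_FTC_integrable)
    show "((\<lambda>x. ?n x * \<psi> x) has_vector_derivative ?n x * \<psi>' x - (?n x * (\<psi> x * x)) / \<sigma>\<^sup>2) (at x)" for x
      unfolding has_real_derivative_iff_has_vector_derivative[symmetric]
      by (rule DERIV_cong[OF DERIV_mult[OF n_deriv deriv]]) (simp add: algebra_simps)
    show "isCont (\<lambda>x. ?n x * \<psi>' x - (?n x * (\<psi> x * x)) / \<sigma>\<^sup>2) x" for x
      using \<psi>_cont n_cont cont \<sigma> by (auto intro!: continuous_intros simp: continuous_on_eq_continuous_at)
    show "set_integrable lborel (einterval (- \<infinity>) \<infinity>) (\<lambda>x. ?n x * \<psi>' x - (?n x * (\<psi> x * x)) / \<sigma>\<^sup>2)"
      using dint by (simp add: set_integrable_def)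
  qed (auto simp: ereal_tendsto_simps intro: prod_lim n_lim)
  then have "(\<integral>x. ?n x * \<psi>' x - (?n x * (\<psi> x * x)) / \<sigma>\<^sup>2 \<partial>lborel) = 0"
    by (simp add: interval_lebesgue_integral_def set_lebesgue_integral_def)
  then have "(\<integral>x. ?n x * \<psi>' x \<partial>lborel) - (\<integral>x. ?n x * (\<psi> x * x) \<partial>lborel) / \<sigma>\<^sup>2 = 0"
    using Bochner_Integration.integral_diff[OF int' integrable_divide[OF int]] by simp
  then show ?thesis
    using \<sigma> by (simp add: field_simps)
qed

context fractional_brownian_motion
begin

definition regression_coeff :: "real \<Rightarrow> real \<Rightarrow> real" where
  "regression_coeff s t = R_cov H t s / s powr (2 * H)"

text \<open>The part of \<open>w(v\<^sub>j)\<close> that is not explained by linear regression on \<open>w(s)\<close>.\<close>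

definition residual :: "real \<Rightarrow> (nat \<Rightarrow> real) \<Rightarrow> wpath \<Rightarrow> nat \<Rightarrow> real" where
  "residual s v w = (\<lambda>j. ev w (v j) - regression_coeff s (v j) * ev w s)"

lemma residual_measurable [measurable]:
  "residual s v \<in> borel_measurable P" "(\<lambda>w. residual s v w j) \<in> borel_measurable P"
  unfolding residual_def by (intro measurable_coordinatewise_then_product; simp) simp

text \<open>The residuals are uncorrelated with \<open>w(s)\<close>, so the variance of a combination splits and the expected cosine
  factorizes.\<close>

lemma residual_gaussian:
  fixes b :: "nat \<Rightarrow> real" and m :: nat
  assumes v: "\<And>j. 0 \<le> v j" and s: "0 < s"
  defines "V \<equiv> \<lambda>w. \<Sum>j<m. b j * residual s v w j"
  shows "expectation (\<lambda>w. cos (\<theta> + (V w + a * ev w s))) =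
    cos \<theta> * exp (- expectation (\<lambda>w. (V w)\<^sup>2) / 2) * exp (- (a\<^sup>2 * s powr (2 * H)) / 2)"
proof -
  define c where "c = (\<Sum>j<m. b j * regression_coeff s (v j))"
  define t where "t = v(m := s)"
  define \<alpha> where "\<alpha> a = b(m := a - c)" for a
  have t: "0 \<le> t i" for i
    using v s by (simp add: t_def)
  \<comment> \<open>As a combination of path values, \<open>V + a w(s)\<close> has the coefficient \<open>a - c\<close> at time \<open>s\<close>, placed at index \<open>m\<close>.\<close>
  have L: "V w + a * ev w s = (\<Sum>i<Suc m. \<alpha> a i * ev w (t i))" for w a
    by (simp add: V_def residual_def \<alpha>_def t_def c_def sum_subtractf algebra_simps sum_distrib_right sum_distrib_left)
  have gauss: "gaussian_law (distr P borel (\<lambda>w. V w + a * ev w s))"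
    "expectation (\<lambda>w. V w + a * ev w s) = 0" for a
    unfolding L by (intro gaussian_combination expectation_combination; use t in simp)+
  have [measurable]: "V \<in> borel_measurable P"
    by (simp add: V_def)
  have sq: "integrable P (\<lambda>w. (V w + a * ev w s)\<^sup>2)" for a
    by (rule gaussian_law_square_integrable[OF prob_space_axioms _ gauss]) simp
  have V2: "integrable P (\<lambda>w. (V w)\<^sup>2)"
    using sq[of 0] by simp
  have W2: "integrable P (\<lambda>w. (ev w s)\<^sup>2)"
    using s by (intro integrable_ev_square) simp
  have "integrable P (\<lambda>w. ((V w + 1 * ev w s)\<^sup>2 - (V w)\<^sup>2 - (ev w s)\<^sup>2) / 2)"
    using sq[of 1] V2 W2 by auto
  then have VW: "integrable P (\<lambda>w. V w * ev w s)"
    by (simp add: power2_eq_square algebra_simps)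
  have orth: "expectation (\<lambda>w. V w * ev w s) = 0"
  proof -
    have "expectation (\<lambda>w. V w * ev w s) =
        expectation (\<lambda>w. (\<Sum>i<Suc m. \<alpha> 0 i * ev w (t i)) * (\<Sum>j\<in>{()}. 1 * ev w s))"
      using L[of _ 0] by simp
    also have "\<dots> = (\<Sum>i<Suc m. \<Sum>j\<in>{()}. \<alpha> 0 i * 1 * R_cov H (t i) s)"
      using t s by (intro expectation_combination_mult) auto
    also have "\<dots> = (\<Sum>j<m. b j * R_cov H (v j) s) - c * s powr (2 * H)"
      by (simp add: \<alpha>_def t_def R_cov_diag)
    also have "\<dots> = 0"
      using s by (simp add: c_def regression_coeff_def sum_distrib_right)
    finally show ?thesis .
  qed
  have var: "expectation (\<lambda>w. (V w + a * ev w s)\<^sup>2) = expectation (\<lambda>w. (V w)\<^sup>2) + a\<^sup>2 * s powr (2 * H)"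
  proof -
    have "expectation (\<lambda>w. (V w + a * ev w s)\<^sup>2) =
        expectation (\<lambda>w. (V w)\<^sup>2 + (2 * a * (V w * ev w s) + a\<^sup>2 * (ev w s)\<^sup>2))"
      by (intro Bochner_Integration.integral_cong) (auto simp: power2_eq_square algebra_simps)
    also have "\<dots> = expectation (\<lambda>w. (V w)\<^sup>2) +
        (2 * a * expectation (\<lambda>w. V w * ev w s) + a\<^sup>2 * expectation (\<lambda>w. (ev w s)\<^sup>2))"
      using V2 VW W2 by (subst Bochner_Integration.integral_add; (subst Bochner_Integration.integral_add)?; auto)+
    also have "expectation (\<lambda>w. (ev w s)\<^sup>2) = s powr (2 * H)"
      using fbm_covariance[of s s] s by (simp add: power2_eq_square R_cov_diag)
    finally show ?thesis
      using orth by simp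
  qed
  have "expectation (\<lambda>w. cos (\<theta> + (V w + a * ev w s))) =
      cos \<theta> * exp (- expectation (\<lambda>w. (V w + a * ev w s)\<^sup>2) / 2)"
    by (rule gaussian_law_cos[OF prob_space_axioms _ gauss]) simp
  also have "\<dots> = cos \<theta> * exp (- expectation (\<lambda>w. (V w)\<^sup>2) / 2) * exp (- (a\<^sup>2 * s powr (2 * H)) / 2)"
    unfolding var by (simp add: mult.assoc exp_add[symmetric] diff_divide_distrib)
  finally show ?thesis .
qed

lemma integrable_bounded:
  fixes f :: "wpath \<Rightarrow> real"
  assumes "f \<in> borel_measurable P" "\<And>w. \<bar>f w\<bar> \<le> B"
  shows "integrable P f"
  using assms by (intro integrable_const_bound[where B = B]) auto

lemma expectation_indicator_vimage:
  "expectation (\<lambda>w. indicator C (g w) :: real) = prob (g -` C)"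
proof -
  have "(\<lambda>w. indicator C (g w) :: real) = indicator (g -` C)"
    by (auto simp: indicator_def fun_eq_iff)
  then show ?thesis
    by simp
qed

text \<open>The factorization of expected cosines is lifted to events in two steps of \<open>cos_uniqueness\<close>: first in
  the residuals, with the centered variable \<open>cos (\<phi> + a w(s))\<close> as signed density, then in \<open>w(s)\<close>,
  with a centered indicator of the residuals.\<close>

lemma residual_independent:
  assumes v: "\<And>j. 0 \<le> v j" and s: "0 < s"
  shows "distr P borel (residual s v) \<Otimes>\<^sub>M distr P borel (\<lambda>w. ev w s) =
    distr P (borel \<Otimes>\<^sub>M borel) (\<lambda>w. (residual s v w, ev w s))"
proof -
  let ?U = "residual s v" and ?W = "\<lambda>w. ev w s"
  have cos_factor: "expectation (\<lambda>w. (cos (\<phi> + a * ?W w) - expectation (\<lambda>w. cos (\<phi> + a * ?W w))) *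
      cos (\<theta> + (\<Sum>j<m. b j * ?U w j))) = 0" for \<phi> a \<theta> b and m :: nat
  proof -
    let ?V = "\<lambda>w. \<Sum>j<m. b j * ?U w j"
    define e where "e = exp (- expectation (\<lambda>w. (?V w)\<^sup>2) / 2)"
    define d where "d = exp (- (a\<^sup>2 * s powr (2 * H)) / 2)"
    have 1: "expectation (\<lambda>w. cos (\<phi> + a * ?W w)) = cos \<phi> * d"
      using residual_gaussian[OF v s, where \<theta> = \<phi> and m = 0 and a = a] by (simp add: d_def)
    have 2: "expectation (\<lambda>w. cos (\<theta> + ?V w)) = cos \<theta> * e"
      using residual_gaussian[OF v s, where \<theta> = \<theta> and m = m and b = b and a = 0] by (simp add: e_def)
    have 3: "expectation (\<lambda>w. cos (\<psi> + (?V w + a' * ?W w))) = cos \<psi> * e * d" if "a'\<^sup>2 = a\<^sup>2" for \<psi> a'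
      using residual_gaussian[OF v s, where \<theta> = \<psi> and m = m and b = b and a = a'] that by (simp add: e_def d_def)
    have eq: "(cos (\<phi> + a * ?W w) - cos \<phi> * d) * cos (\<theta> + ?V w) =
        cos ((\<theta> - \<phi>) + (?V w + (- a) * ?W w)) / 2 + cos ((\<theta> + \<phi>) + (?V w + a * ?W w)) / 2
        - cos \<phi> * d * cos (\<theta> + ?V w)" for w
    proof -
      have "(\<theta> - \<phi>) + (?V w + (- a) * ?W w) = (\<theta> + ?V w) - (\<phi> + a * ?W w)"
        "(\<theta> + \<phi>) + (?V w + a * ?W w) = (\<theta> + ?V w) + (\<phi> + a * ?W w)"
        by simp_all
      then show ?thesis
        using cos_times_cos[of "\<theta> + ?V w" "\<phi> + a * ?W w"]
        by (simp only:) (simp add: field_simps)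
    qed
    have "expectation (\<lambda>w. (cos (\<phi> + a * ?W w) - cos \<phi> * d) * cos (\<theta> + ?V w)) =
        expectation (\<lambda>w. cos ((\<theta> - \<phi>) + (?V w + (- a) * ?W w))) / 2 +
        expectation (\<lambda>w. cos ((\<theta> + \<phi>) + (?V w + a * ?W w))) / 2
        - cos \<phi> * d * expectation (\<lambda>w. cos (\<theta> + ?V w))"
    proof -
      have int: "integrable P (\<lambda>w. cos (f w))" if "f \<in> borel_measurable P" for f :: "wpath \<Rightarrow> real"
        using that by (intro integrable_bounded[where B = 1]) auto
      have i: "integrable P (\<lambda>w. cos ((\<theta> - \<phi>) + (?V w + (- a) * ?W w)) / 2)"
        "integrable P (\<lambda>w. cos ((\<theta> + \<phi>) + (?V w + a * ?W w)) / 2)"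
        "integrable P (\<lambda>w. cos \<phi> * d * cos (\<theta> + ?V w))"
        by (intro integrable_divide integrable_mult_right int; measurable)+
      show ?thesis
        unfolding eq
        unfolding Bochner_Integration.integral_diff[OF Bochner_Integration.integrable_add[OF i(1,2)] i(3)]
          Bochner_Integration.integral_add[OF i(1,2)]
        by simp
    qed
    also have "\<dots> = (cos (\<theta> - \<phi>) + cos (\<theta> + \<phi>)) / 2 * (e * d) - cos \<phi> * d * (cos \<theta> * e)"
      by (subst 3, simp, subst 3, simp, subst 2) (simp add: algebra_simps add_divide_distrib)
    also have "\<dots> = 0"
      by (simp add: cos_add cos_diff)
    finally show ?thesis
      unfolding 1 .
  qed
  have U_set: "expectation (\<lambda>w. (cos (\<phi> + a * ?W w) - expectation (\<lambda>w. cos (\<phi> + a * ?W w))) *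
      indicator A (?U w)) = 0" if "A \<in> sets borel" for \<phi> a A
  proof -
    have "expectation (\<lambda>w. (cos (\<phi> + a * ?W w) - expectation (\<lambda>w. cos (\<phi> + a * ?W w))) *
      indicator A (\<lambda>j. ?U w j)) = 0"
    proof (rule cos_uniqueness[OF _ _ cos_factor that])
      have "integrable P (\<lambda>w. cos (\<phi> + a * ?W w))"
        by (rule integrable_bounded[where B = 1]) auto
      then show "integrable P (\<lambda>w. cos (\<phi> + a * ?W w) - expectation (\<lambda>w. cos (\<phi> + a * ?W w)))"
        by simp
    qed simp
    then show ?thesis
      by simp
  qed
  have UW_set: "expectation (\<lambda>w. (indicator A (?U w) - expectation (\<lambda>w. indicator A (?U w) :: real)) *
      indicator B (?W w)) = (0::real)" if [measurable]: "A \<in> sets borel" "B \<in> sets borel" for A B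
  proof (rule cos_uniqueness_real)
    have iA: "integrable P (\<lambda>w. indicator A (?U w) :: real)"
      by (rule integrable_bounded[where B = 1]) (auto simp: indicator_def)
    show "integrable P (\<lambda>w. indicator A (?U w) - expectation (\<lambda>w. indicator A (?U w) :: real))"
      using iA by simp
    fix a \<theta>
    let ?c = "\<lambda>w. cos (\<theta> + a * ?W w)"
    have ic: "integrable P ?c"
      by (rule integrable_bounded[where B = 1]) auto
    have ip: "integrable P (\<lambda>w. ?c w * indicator A (?U w))"
      by (rule integrable_bounded[where B = 1]) (auto simp: indicator_def)
    have "0 = expectation (\<lambda>w. ?c w * indicator A (?U w) - expectation ?c * indicator A (?U w))"
      using U_set[OF that(1), of \<theta> a] by (simp add: left_diff_distrib)
    also have "\<dots> = expectation (\<lambda>w. ?c w * indicator A (?U w)) - expectation ?c * expectation (\<lambda>w. indicator A (?U w) :: real)"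
      using ip iA by (subst Bochner_Integration.integral_diff) auto
    finally have f: "expectation (\<lambda>w. ?c w * indicator A (?U w)) = expectation ?c * expectation (\<lambda>w. indicator A (?U w) :: real)"
      by simp
    have "expectation (\<lambda>w. (indicator A (?U w) - expectation (\<lambda>w. indicator A (?U w) :: real)) * ?c w) =
        expectation (\<lambda>w. ?c w * indicator A (?U w) - expectation (\<lambda>w. indicator A (?U w) :: real) * ?c w)"
      by (intro Bochner_Integration.integral_cong refl) (simp add: algebra_simps)
    also have "\<dots> = 0"
      using ip ic f by (subst Bochner_Integration.integral_diff) auto
    finally show "expectation (\<lambda>w. (indicator A (?U w) - expectation (\<lambda>w. indicator A (?U w) :: real)) * ?c w) = 0" .
  qed auto
  show ?thesis
  proof (rule pair_measure_eqI)
    show "sigma_finite_measure (distr P borel ?U)" "sigma_finite_measure (distr P borel ?W)"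
      by (intro prob_space_imp_sigma_finite prob_space_distr; simp)+
    fix A :: "(nat \<Rightarrow> real) set" and B :: "real set"
    assume "A \<in> sets (distr P borel ?U)" "B \<in> sets (distr P borel ?W)"
    then have [measurable]: "A \<in> sets borel" "B \<in> sets borel"
      by auto
    have AB: "A \<times> B \<in> sets (borel \<Otimes>\<^sub>M borel)"
      by simp
    have i: "integrable P (\<lambda>w. indicator A (?U w) * indicator B (?W w) :: real)" "integrable P (\<lambda>w. indicator B (?W w) :: real)"
      by (rule integrable_bounded[where B = 1]; auto simp: indicator_def)+
    have "0 = expectation (\<lambda>w. indicator A (?U w) * indicator B (?W w) - expectation (\<lambda>w. indicator A (?U w) :: real) * indicator B (?W w))"
      using UW_set[of A B] by (simp add: left_diff_distrib)
    also have "\<dots> = expectation (\<lambda>w. indicator A (?U w) * indicator B (?W w)) -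
        expectation (\<lambda>w. indicator A (?U w) :: real) * expectation (\<lambda>w. indicator B (?W w) :: real)"
      using i by (subst Bochner_Integration.integral_diff) auto
    also have "expectation (\<lambda>w. indicator A (?U w) :: real) = prob (?U -` A)"
      by (rule expectation_indicator_vimage)
    also have "expectation (\<lambda>w. indicator B (?W w) :: real) = prob (?W -` B)"
      by (rule expectation_indicator_vimage)
    also have "expectation (\<lambda>w. indicator A (?U w) * indicator B (?W w)) = prob (?U -` A \<inter> ?W -` B)"
      using expectation_indicator_vimage[where C = "A \<times> B" and g = "\<lambda>w. (?U w, ?W w)"]
      by (simp add: indicator_times vimage_Times comp_def)
    finally have "prob (?U -` A) * prob (?W -` B) = prob (?U -` A \<inter> ?W -` B)"
      by simp
    then have "ennreal (prob (?U -` A)) * ennreal (prob (?W -` B)) = ennreal (prob (?U -` A \<inter> ?W -` B))"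
      by (simp add: ennreal_mult[symmetric])
    moreover have "(\<lambda>w. (?U w, ?W w)) -` (A \<times> B) = ?U -` A \<inter> ?W -` B"
      by auto
    ultimately show "emeasure (distr P borel ?U) A * emeasure (distr P borel ?W) B =
        emeasure (distr P (borel \<Otimes>\<^sub>M borel) (\<lambda>w. (?U w, ?W w))) (A \<times> B)"
      using AB by (simp add: emeasure_distr emeasure_eq_measure)
  qed (unfold sets_distr, intro sets_pair_measure_cong sets_distr)
qed

text \<open>Integrate over \<open>w(s)\<close> first, with the independent residuals frozen.\<close>

lemma gaussian_integration_by_parts:
  fixes \<psi> \<psi>' :: "(nat \<Rightarrow> real) \<Rightarrow> real \<Rightarrow> real"
  assumes v: "\<And>j. 0 \<le> v j" and s: "0 < s"
    and [measurable]: "case_prod \<psi> \<in> borel_measurable (borel \<Otimes>\<^sub>M borel)" "case_prod \<psi>' \<in> borel_measurable (borel \<Otimes>\<^sub>M borel)"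
    and deriv: "\<And>u x. (\<psi> u has_real_derivative \<psi>' u x) (at x)"
    and cont: "\<And>u. continuous_on UNIV (\<psi>' u)"
    and bound: "\<And>u x. \<bar>\<psi> u x\<bar> \<le> B" "\<And>u x. \<bar>\<psi>' u x\<bar> \<le> B'"
  shows "expectation (\<lambda>w. \<psi> (residual s v w) (ev w s) * ev w s) =
    s powr (2 * H) * expectation (\<lambda>w. \<psi>' (residual s v w) (ev w s))"
proof -
  let ?U = "residual s v" and ?W = "\<lambda>w. ev w s"
  let ?N = "distr P borel ?W" and ?D = "distr P borel ?U"
  have var: "expectation (\<lambda>w. (?W w)\<^sup>2) = s powr (2 * H)"
    using fbm_covariance[of s s] s by (simp add: power2_eq_square R_cov_diag)
  have "?N = density lborel (normal_density 0 (sqrt (expectation (\<lambda>w. (?W w)\<^sup>2))))"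
    using gaussian_combination[of "{()}" "\<lambda>_. s" "\<lambda>_. 1"] s var fbm_mean
    by (intro gaussian_law_density prob_space_axioms) auto
  then have N: "?N = density lborel (normal_density 0 (s powr H))"
    unfolding var using s by (simp add: powr_half_sqrt[symmetric] powr_powr)
  have sq: "(s powr H)\<^sup>2 = s powr (2 * H)"
    using s by (simp add: powr_power mult.commute)
  interpret U: prob_space ?D
    by (rule prob_space_distr) simp
  interpret W: prob_space ?N
    by (rule prob_space_distr) simp
  interpret UW: pair_sigma_finite ?D ?N ..
  have integral: "expectation (\<lambda>w. h (?U w) (?W w)) = (\<integral>u. (\<integral>x. normal_density 0 (s powr H) x * h u x \<partial>lborel) \<partial>?D)"
    if [measurable]: "case_prod h \<in> borel_measurable (borel \<Otimes>\<^sub>M borel)" and int: "integrable P (\<lambda>w. h (?U w) (?W w))"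
    for h :: "(nat \<Rightarrow> real) \<Rightarrow> real \<Rightarrow> real"
  proof -
    have meas: "(\<lambda>w. (?U w, ?W w)) \<in> P \<rightarrow>\<^sub>M borel \<Otimes>\<^sub>M borel"
      by simp
    have "integrable (distr P (borel \<Otimes>\<^sub>M borel) (\<lambda>w. (?U w, ?W w))) (case_prod h)"
      using int by (subst integrable_distr_eq[OF meas]) auto
    then have int': "integrable (?D \<Otimes>\<^sub>M ?N) (case_prod h)"
      by (simp add: residual_independent[OF v s])
    have "expectation (\<lambda>w. h (?U w) (?W w)) = (\<integral>p. case_prod h p \<partial>distr P (borel \<Otimes>\<^sub>M borel) (\<lambda>w. (?U w, ?W w)))"
      by (subst integral_distr[OF meas]) auto
    also have "\<dots> = (\<integral>p. case_prod h p \<partial>(?D \<Otimes>\<^sub>M ?N))"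
      by (simp add: residual_independent[OF v s])
    also have "\<dots> = (\<integral>u. (\<integral>x. h u x \<partial>?N) \<partial>?D)"
      by (rule UW.integral_fst'[OF int', symmetric, simplified])
    also have "\<dots> = (\<integral>u. (\<integral>x. normal_density 0 (s powr H) x * h u x \<partial>lborel) \<partial>?D)"
    proof (rule Bochner_Integration.integral_cong[OF refl])
      fix u
      have "(\<lambda>x. case_prod h (u, x)) \<in> borel_measurable borel"
        by measurable
      then show "(\<integral>x. h u x \<partial>?N) = (\<integral>x. normal_density 0 (s powr H) x * h u x \<partial>lborel)"
        unfolding N by (subst integral_density) auto
    qed
    finally show ?thesis .
  qed
  have [measurable]: "(\<lambda>w. \<psi> (?U w) (?W w)) \<in> borel_measurable P" "(\<lambda>w. \<psi>' (?U w) (?W w)) \<in> borel_measurable P"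
    using measurable_compose[of "\<lambda>w. (?U w, ?W w)" P "borel \<Otimes>\<^sub>M borel" "case_prod \<psi>"]
      measurable_compose[of "\<lambda>w. (?U w, ?W w)" P "borel \<Otimes>\<^sub>M borel" "case_prod \<psi>'"] by auto
  have int: "integrable P (\<lambda>w. \<psi> (?U w) (?W w) * ?W w)"
  proof (rule Bochner_Integration.integrable_bound)
    show "integrable P (\<lambda>w. B * ?W w)"
      using s by (intro integrable_mult_right integrable_ev) auto
    have "\<bar>\<psi> (?U w) (?W w)\<bar> \<le> \<bar>B\<bar>" for w
      using bound(1)[of "?U w" "?W w"] by linarith
    then show "AE w in P. norm (\<psi> (?U w) (?W w) * ?W w) \<le> norm (B * ?W w)"
      by (intro AE_I2) (simp add: abs_mult mult_right_mono)
  qed simp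
  have int': "integrable P (\<lambda>w. \<psi>' (?U w) (?W w))"
    using bound(2) by (intro integrable_bounded[where B = B']) auto
  have "expectation (\<lambda>w. \<psi> (?U w) (?W w) * ?W w) =
      (\<integral>u. (\<integral>x. normal_density 0 (s powr H) x * (\<psi> u x * x) \<partial>lborel) \<partial>?D)"
    using int by (intro integral) (auto simp: split_beta')
  also have "\<dots> = (\<integral>u. s powr (2 * H) * (\<integral>x. normal_density 0 (s powr H) x * \<psi>' u x \<partial>lborel) \<partial>?D)"
    using s by (subst gaussian_integration_by_parts_real[OF _ deriv cont bound]) (simp_all add: sq)
  also have "\<dots> = s powr (2 * H) * expectation (\<lambda>w. \<psi>' (?U w) (?W w))"
    using int' by (subst integral) auto
  finally show ?thesis .
qed

end

text \<open>The damping factor of the test functions, up to a constant the density of the Cauchy distribution: it is bounded together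
  with its derivative and its product with \<open>x\<close>.\<close>

definition cauchy_weight :: "real \<Rightarrow> real" where
  "cauchy_weight x = 1 / (1 + x\<^sup>2)"

definition cauchy_weight_deriv :: "real \<Rightarrow> real" where
  "cauchy_weight_deriv x = - (2 * x) / (1 + x\<^sup>2)\<^sup>2"

lemma one_plus_square_pos: "0 < 1 + (x::real)\<^sup>2"
  by (simp add: add_pos_nonneg)

lemma cauchy_weight_pos: "0 < cauchy_weight x"
  using one_plus_square_pos by (simp add: cauchy_weight_def)

lemma two_abs_le: "2 * \<bar>x\<bar> \<le> 1 + (x::real)\<^sup>2"
  using sum_squares_bound[of "\<bar>x\<bar>" 1] by simp

lemma cauchy_weight_bounds:
  "\<bar>cauchy_weight x\<bar> \<le> 1" "\<bar>cauchy_weight x * x\<bar> \<le> 1" "\<bar>cauchy_weight_deriv x\<bar> \<le> 1"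
proof -
  show "\<bar>cauchy_weight x\<bar> \<le> 1"
    using one_plus_square_pos[of x] by (simp add: cauchy_weight_def)
  show "\<bar>cauchy_weight x * x\<bar> \<le> 1"
    using one_plus_square_pos[of x] two_abs_le[of x] by (simp add: cauchy_weight_def abs_mult)
  have "1 + x\<^sup>2 \<le> (1 + x\<^sup>2)\<^sup>2"
    by (rule self_le_power) simp_all
  then have "2 * \<bar>x\<bar> \<le> (1 + x\<^sup>2)\<^sup>2"
    using two_abs_le[of x] by linarith
  then show "\<bar>cauchy_weight_deriv x\<bar> \<le> 1"
    using one_plus_square_pos[of x] by (simp add: cauchy_weight_deriv_def abs_mult)
qed

lemma cauchy_weight_has_deriv: "(cauchy_weight has_real_derivative cauchy_weight_deriv x) (at x)"
  unfolding cauchy_weight_def cauchy_weight_deriv_def using one_plus_square_pos[of x]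
  by (auto intro!: derivative_eq_intros simp: power2_eq_square)

lemma cauchy_weight_continuous [continuous_intros]:
  "continuous_on A g \<Longrightarrow> continuous_on A (\<lambda>x. cauchy_weight (g x))"
  "continuous_on A g \<Longrightarrow> continuous_on A (\<lambda>x. cauchy_weight_deriv (g x))"
  unfolding cauchy_weight_def cauchy_weight_deriv_def
  using one_plus_square_pos by (auto intro!: continuous_intros simp: less_imp_neq[symmetric])

lemma cauchy_weight_measurable [measurable]:
  "cauchy_weight \<in> borel_measurable borel" "cauchy_weight_deriv \<in> borel_measurable borel"
  by (intro borel_measurable_continuous_onI continuous_intros)+

context fractional_brownian_motion
begin

definition test_weight :: "real \<Rightarrow> nat \<Rightarrow> (nat \<Rightarrow> real) \<Rightarrow> (nat \<Rightarrow> real) \<Rightarrow> real \<Rightarrow> wpath \<Rightarrow> real" where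
  "test_weight s m b v \<theta> w = cauchy_weight (ev w s) * cos (\<theta> + (\<Sum>j<m. b j * ev w (v j)))"

text \<open>The image of \<open>test_weight\<close> under the formal adjoint of the derivative in the direction of the kernel function
  at \<open>s\<close>: multiplication by \<open>w(s)\<close> minus that derivative.\<close>

definition adjoint_weight :: "real \<Rightarrow> nat \<Rightarrow> (nat \<Rightarrow> real) \<Rightarrow> (nat \<Rightarrow> real) \<Rightarrow> real \<Rightarrow> wpath \<Rightarrow> real" where
  "adjoint_weight s m b v \<theta> w =
    (cauchy_weight (ev w s) * ev w s - s powr (2 * H) * cauchy_weight_deriv (ev w s)) *
      cos (\<theta> + (\<Sum>j<m. b j * ev w (v j))) +
    cauchy_weight (ev w s) * sin (\<theta> + (\<Sum>j<m. b j * ev w (v j))) * (\<Sum>j<m. b j * R_cov H (v j) s)"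

lemma test_weight_bound: "\<bar>test_weight s m b v \<theta> w\<bar> \<le> 1"
  unfolding test_weight_def abs_mult using cauchy_weight_bounds(1)
  by (intro mult_le_one) auto

lemma adjoint_weight_bound:
  "\<bar>adjoint_weight s m b v \<theta> w\<bar> \<le> 1 + s powr (2 * H) + \<bar>\<Sum>j<m. b j * R_cov H (v j) s\<bar>"
proof -
  let ?W = "ev w s" and ?p = "\<theta> + (\<Sum>j<m. b j * ev w (v j))" and ?S = "\<Sum>j<m. b j * R_cov H (v j) s"
  have "\<bar>adjoint_weight s m b v \<theta> w\<bar> \<le>
      \<bar>cauchy_weight ?W * ?W - s powr (2 * H) * cauchy_weight_deriv ?W\<bar> * \<bar>cos ?p\<bar> +
      \<bar>cauchy_weight ?W * sin ?p\<bar> * \<bar>?S\<bar>"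
    unfolding adjoint_weight_def by (rule order_trans[OF abs_triangle_ineq]) (simp add: abs_mult)
  also have "\<dots> \<le> (1 + s powr (2 * H)) * 1 + 1 * \<bar>?S\<bar>"
  proof (intro add_mono mult_mono)
    have "\<bar>s powr (2 * H) * cauchy_weight_deriv ?W\<bar> \<le> s powr (2 * H)"
      using cauchy_weight_bounds(3)[of ?W] by (simp add: abs_mult mult_left_le)
    then show "\<bar>cauchy_weight ?W * ?W - s powr (2 * H) * cauchy_weight_deriv ?W\<bar> \<le> 1 + s powr (2 * H)"
      using cauchy_weight_bounds(2)[of ?W] by linarith
    show "\<bar>cauchy_weight ?W * sin ?p\<bar> \<le> 1"
      unfolding abs_mult using cauchy_weight_bounds(1) by (intro mult_le_one) auto
  qed auto
  finally show ?thesis by simp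
qed

text \<open>The times of the cylinder function and those of the test function are concatenated to one sequence \<open>u\<close>; in terms
  of residuals both factors depend on \<open>w(s)\<close> through \<open>U\<^sub>i + c\<^sub>i w(s)\<close>, and \<open>s powr (2 * H) * c i\<close> is the
  covariance \<open>R_cov H (u i) s\<close>.\<close>

lemma cylinder_integration_by_parts:
  assumes f: "f \<in> Cb_infinity n" and t: "\<And>i. i < n \<Longrightarrow> 0 \<le> t i" and v: "\<And>j. 0 \<le> v j" and s: "0 < s"
  shows "expectation (\<lambda>w. (\<Sum>i<n. partial_deriv i f (\<lambda>i. ev w (t i)) * R_cov H (t i) s) * test_weight s m b v \<theta> w) =
    expectation (\<lambda>w. f (\<lambda>i. ev w (t i)) * adjoint_weight s m b v \<theta> w)"
proof -
  define u where "u i = (if i < n then t i else v (i - n))" for i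
  have u: "0 \<le> u i" for i
    using t v by (simp add: u_def)
  define c where "c i = regression_coeff s (u i)" for i
  define pt where "pt x r = (\<lambda>i. x i + r * c i)" for x :: "nat \<Rightarrow> real" and r :: real
  define ph where "ph x r = \<theta> + (\<Sum>j<m. b j * pt x r (n + j))" for x r
  define D where "D x r = (\<Sum>i<n. partial_deriv i f (pt x r) * c i)" for x r
  define S where "S = (\<Sum>j<m. b j * c (n + j))"
  define \<psi> where "\<psi> x r = f (pt x r) * (cauchy_weight r * cos (ph x r))" for x r
  define \<psi>' where "\<psi>' x r = D x r * (cauchy_weight r * cos (ph x r)) +
    f (pt x r) * (cauchy_weight_deriv r * cos (ph x r) - cauchy_weight r * sin (ph x r) * S)" for x r
  have f_meas [measurable]: "f \<in> borel_measurable borel"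
    by (intro borel_measurable_continuous_onI Cb_infinity_continuous[OF f])
  have pd_meas: "partial_deriv i f \<in> borel_measurable borel" if "i < n" for i
    using that by (intro borel_measurable_continuous_onI partial_deriv_continuous[OF f])
  have pt_meas [measurable]: "(\<lambda>(x, r). pt x r) \<in> borel_measurable (borel \<Otimes>\<^sub>M borel)"
    unfolding pt_def split_beta'
    by (intro measurable_coordinatewise_then_product borel_measurable_add borel_measurable_times
      measurable_compose[OF measurable_fst measurable_product_coordinates]) measurable
  have pt_meas': "(\<lambda>p. pt (fst p) (snd p)) \<in> borel_measurable (borel \<Otimes>\<^sub>M borel)"
    using pt_meas by (simp add: split_beta')
  have comp_meas: "(\<lambda>p. g (pt (fst p) (snd p))) \<in> borel_measurable (borel \<Otimes>\<^sub>M borel)"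
    if "g \<in> borel_measurable borel" for g :: "(nat \<Rightarrow> real) \<Rightarrow> real"
    using that pt_meas' by (rule measurable_compose[rotated])
  note [measurable] = comp_meas[OF f_meas]
  have ph_meas [measurable]: "(\<lambda>p. ph (fst p) (snd p)) \<in> borel_measurable (borel \<Otimes>\<^sub>M borel)"
    unfolding ph_def by (intro borel_measurable_add borel_measurable_sum borel_measurable_times
      borel_measurable_const comp_meas) measurable
  have D_meas [measurable]: "(\<lambda>p. D (fst p) (snd p)) \<in> borel_measurable (borel \<Otimes>\<^sub>M borel)"
    unfolding D_def by (intro borel_measurable_sum borel_measurable_times borel_measurable_const comp_meas pd_meas) simp
  have f_deriv: "((\<lambda>r. f (pt x r)) has_real_derivative D x r) (at r)" for x r
    unfolding pt_def D_def by (rule Cb_infinity_chain_rule[OF f])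
  have ph_deriv: "((\<lambda>r. ph x r) has_real_derivative S) (at r)" for x r
    unfolding ph_def pt_def S_def by (auto intro!: derivative_eq_intros simp: mult.commute)
  have pt_cont: "continuous_on UNIV (pt x)" for x
    unfolding pt_def by (intro continuous_on_coordinatewise_then_product continuous_intros)
  have cont: "continuous_on UNIV (\<psi>' x)" for x
  proof -
    have "continuous_on UNIV (\<lambda>r. g (pt x r))" if "continuous_on UNIV g" for g :: "(nat \<Rightarrow> real) \<Rightarrow> real"
      using continuous_on_compose2[OF that pt_cont] by simp
    then have "continuous_on UNIV (D x)" "continuous_on UNIV (\<lambda>r. f (pt x r))"
      unfolding D_def using Cb_infinity_continuous[OF f] partial_deriv_continuous[OF f]
      by (auto intro!: continuous_intros)
    moreover have "continuous_on UNIV (ph x)"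
      using ph_deriv by (meson DERIV_isCont continuous_at_imp_continuous_on)
    ultimately show ?thesis
      unfolding \<psi>'_def by (intro continuous_intros)
  qed
  obtain B where B: "\<And>x. \<bar>f x\<bar> \<le> B"
    using Cb_infinity_bounded[OF f] by (auto simp: bounded_iff)
  have "\<forall>i. \<exists>C. i < n \<longrightarrow> (\<forall>x. \<bar>partial_deriv i f x\<bar> \<le> C)"
    using partial_deriv_bounded[OF f] by (auto simp: bounded_iff)
  then obtain C where C: "\<And>i x. i < n \<Longrightarrow> \<bar>partial_deriv i f x\<bar> \<le> C i"
    by metis
  have weight: "\<bar>cauchy_weight r * cos p\<bar> \<le> 1" "\<bar>cauchy_weight r * sin p\<bar> \<le> 1" "\<bar>cauchy_weight_deriv r * cos p\<bar> \<le> 1" for r p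
    unfolding abs_mult using cauchy_weight_bounds by (intro mult_le_one; simp)+
  have B0: "0 \<le> B"
    using B[of undefined] by linarith
  have \<psi>_bound: "\<bar>\<psi> x r\<bar> \<le> B * 1" for x r
    unfolding \<psi>_def abs_mult[of "f _"] by (intro mult_mono B weight B0) auto
  have D_bound: "\<bar>D x r\<bar> \<le> (\<Sum>i<n. C i * \<bar>c i\<bar>)" for x r
    unfolding D_def
    by (rule order_trans[OF sum_abs]) (auto intro!: sum_mono mult_right_mono C simp: abs_mult)
  have \<psi>'_bound: "\<bar>\<psi>' x r\<bar> \<le> (\<Sum>i<n. C i * \<bar>c i\<bar>) * 1 + B * (1 + 1 * \<bar>S\<bar>)" for x r
  proof -
    have "\<bar>cauchy_weight_deriv r * cos (ph x r) - cauchy_weight r * sin (ph x r) * S\<bar> \<le>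
        \<bar>cauchy_weight_deriv r * cos (ph x r)\<bar> + \<bar>cauchy_weight r * sin (ph x r)\<bar> * \<bar>S\<bar>"
      by (rule order_trans[OF abs_triangle_ineq4]) (simp add: abs_mult)
    also have "\<dots> \<le> 1 + 1 * \<bar>S\<bar>"
      by (intro add_mono mult_mono weight) auto
    finally have 1: "\<bar>cauchy_weight_deriv r * cos (ph x r) - cauchy_weight r * sin (ph x r) * S\<bar> \<le> 1 + 1 * \<bar>S\<bar>" .
    have "\<bar>\<psi>' x r\<bar> \<le> \<bar>D x r\<bar> * \<bar>cauchy_weight r * cos (ph x r)\<bar> +
        \<bar>f (pt x r)\<bar> * \<bar>cauchy_weight_deriv r * cos (ph x r) - cauchy_weight r * sin (ph x r) * S\<bar>"
      unfolding \<psi>'_def by (rule order_trans[OF abs_triangle_ineq]) (simp add: abs_mult)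
    also have "\<dots> \<le> (\<Sum>i<n. C i * \<bar>c i\<bar>) * 1 + B * (1 + 1 * \<bar>S\<bar>)"
      using D_bound[of x r] by (intro add_mono mult_mono weight D_bound B 1 B0) auto
    finally show ?thesis .
  qed
  have \<psi>_meas: "(\<lambda>q. \<psi> (fst q) (snd q)) \<in> borel_measurable (borel \<Otimes>\<^sub>M borel)"
    unfolding \<psi>_def by measurable
  have \<psi>'_meas: "(\<lambda>q. \<psi>' (fst q) (snd q)) \<in> borel_measurable (borel \<Otimes>\<^sub>M borel)"
    unfolding \<psi>'_def by measurable
  have ibp: "expectation (\<lambda>w. \<psi> (residual s u w) (ev w s) * ev w s) =
      s powr (2 * H) * expectation (\<lambda>w. \<psi>' (residual s u w) (ev w s))"
  proof (rule gaussian_integration_by_parts[OF u s _ _ _ cont \<psi>_bound \<psi>'_bound])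
    show "case_prod \<psi> \<in> borel_measurable (borel \<Otimes>\<^sub>M borel)"
      using \<psi>_meas by (simp add: split_beta')
    show "case_prod \<psi>' \<in> borel_measurable (borel \<Otimes>\<^sub>M borel)"
      using \<psi>'_meas by (simp add: split_beta')
    show "(\<psi> x has_real_derivative \<psi>' x r) (at r)" for x r
      unfolding \<psi>_def \<psi>'_def
      by (rule DERIV_cong[OF DERIV_mult[OF f_deriv DERIV_mult[OF cauchy_weight_has_deriv
        DERIV_chain2[OF DERIV_cos ph_deriv]]]]) (simp add: algebra_simps)
  qed
  have pt_eq: "pt (residual s u w) (ev w s) i = ev w (u i)" for w i
    by (simp add: pt_def residual_def c_def)
  have f_eq: "f (pt (residual s u w) (ev w s)) = f (\<lambda>i. ev w (t i))" for w
    by (rule Cb_infinity_cong[OF f]) (simp add: pt_eq u_def)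
  have pd_eq: "partial_deriv i f (pt (residual s u w) (ev w s)) = partial_deriv i f (\<lambda>i. ev w (t i))" if "i < n" for i w
    by (rule partial_deriv_cong[OF f that]) (simp add: pt_eq u_def)
  have ph_eq: "ph (residual s u w) (ev w s) = \<theta> + (\<Sum>j<m. b j * ev w (v j))" for w
    by (simp add: ph_def pt_eq u_def)
  have c_eq: "s powr (2 * H) * c i = R_cov H (u i) s" for i
    using s by (simp add: c_def regression_coeff_def)
  have D_eq: "s powr (2 * H) * D (residual s u w) (ev w s) =
      (\<Sum>i<n. partial_deriv i f (\<lambda>i. ev w (t i)) * R_cov H (t i) s)" for w
  proof -
    have "s powr (2 * H) * D (residual s u w) (ev w s) =
        (\<Sum>i<n. partial_deriv i f (pt (residual s u w) (ev w s)) * (s powr (2 * H) * c i))"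
      by (simp add: D_def sum_distrib_left mult_ac)
    then show ?thesis
      by (simp add: c_eq pd_eq u_def)
  qed
  have S_eq: "s powr (2 * H) * S = (\<Sum>j<m. b j * R_cov H (v j) s)"
  proof -
    have "s powr (2 * H) * S = (\<Sum>j<m. b j * (s powr (2 * H) * c (n + j)))"
      by (simp add: S_def sum_distrib_left mult_ac)
    then show ?thesis
      by (simp add: c_eq u_def)
  qed
  have "(\<lambda>w. (\<Sum>i<n. partial_deriv i f (\<lambda>i. ev w (t i)) * R_cov H (t i) s) * test_weight s m b v \<theta> w) =
      (\<lambda>w. s powr (2 * H) * D (residual s u w) (ev w s) * (cauchy_weight (ev w s) * cos (ph (residual s u w) (ev w s))))"
    unfolding D_eq ph_eq test_weight_def ..
  moreover have "(\<lambda>w. f (\<lambda>i. ev w (t i)) * adjoint_weight s m b v \<theta> w) =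
      (\<lambda>w. \<psi> (residual s u w) (ev w s) * ev w s - s powr (2 * H) * \<psi>' (residual s u w) (ev w s) +
      s powr (2 * H) * D (residual s u w) (ev w s) * (cauchy_weight (ev w s) * cos (ph (residual s u w) (ev w s))))"
    unfolding \<psi>_def \<psi>'_def adjoint_weight_def f_eq ph_eq S_eq[symmetric] by (simp add: fun_eq_iff algebra_simps)
  moreover have "expectation (\<lambda>w. \<psi> (residual s u w) (ev w s) * ev w s - s powr (2 * H) * \<psi>' (residual s u w) (ev w s) +
      s powr (2 * H) * D (residual s u w) (ev w s) * (cauchy_weight (ev w s) * cos (ph (residual s u w) (ev w s)))) =
      expectation (\<lambda>w. s powr (2 * H) * D (residual s u w) (ev w s) * (cauchy_weight (ev w s) * cos (ph (residual s u w) (ev w s))))"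
  proof -
    let ?p = "\<lambda>w. (residual s u w, ev w s)"
    have p: "?p \<in> P \<rightarrow>\<^sub>M borel \<Otimes>\<^sub>M borel"
      by simp
    have meas: "(\<lambda>w. g (residual s u w) (ev w s)) \<in> borel_measurable P"
      if "(\<lambda>q. g (fst q) (snd q)) \<in> borel_measurable (borel \<Otimes>\<^sub>M borel)" for g :: "(nat \<Rightarrow> real) \<Rightarrow> real \<Rightarrow> real"
      using measurable_compose[OF p that] by (simp only: fst_conv snd_conv)
    have [measurable]: "(\<lambda>w. \<psi> (residual s u w) (ev w s)) \<in> borel_measurable P"
      "(\<lambda>w. \<psi>' (residual s u w) (ev w s)) \<in> borel_measurable P"
      "(\<lambda>w. D (residual s u w) (ev w s)) \<in> borel_measurable P"
      "(\<lambda>w. ph (residual s u w) (ev w s)) \<in> borel_measurable P"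
      by (rule meas \<psi>_meas \<psi>'_meas D_meas ph_meas)+
    have "integrable P (\<lambda>w. \<psi> (residual s u w) (ev w s) * ev w s)"
    proof (rule Bochner_Integration.integrable_bound)
      show "integrable P (\<lambda>w. B * ev w s)"
        using s by (intro integrable_mult_right integrable_ev) auto
      show "AE w in P. norm (\<psi> (residual s u w) (ev w s) * ev w s) \<le> norm (B * ev w s)"
        using \<psi>_bound B0 by (intro AE_I2) (simp add: abs_mult mult_right_mono)
    qed simp
    moreover have "integrable P (\<lambda>w. s powr (2 * H) * \<psi>' (residual s u w) (ev w s))"
      using \<psi>'_bound by (intro integrable_mult_right integrable_bounded) auto
    moreover have "integrable P (\<lambda>w. s powr (2 * H) * D (residual s u w) (ev w s) *
        (cauchy_weight (ev w s) * cos (ph (residual s u w) (ev w s))))"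
    proof (rule integrable_bounded)
      fix w
      show "\<bar>s powr (2 * H) * D (residual s u w) (ev w s) *
        (cauchy_weight (ev w s) * cos (ph (residual s u w) (ev w s)))\<bar> \<le> (s powr (2 * H) * (\<Sum>i<n. C i * \<bar>c i\<bar>)) * 1"
        using D_bound[of "residual s u w" "ev w s"] unfolding abs_mult[of "_ * _" "_ * _"]
        by (intro mult_mono weight) (auto simp: abs_mult intro: mult_left_mono)
    qed simp
    ultimately show ?thesis
      using ibp by simp
  qed
  ultimately show ?thesis
    by simp
qed

end

section \<open>Random times and the observed sigma-algebra\<close>

text \<open>This rests on \<open>y \<le> e + e powr (1 - p) * y powr p\<close>: the constant \<open>e\<close> has small integral because the measure is
  finite, and for fixed \<open>e\<close> the second term tends to zero.\<close>

lemma nn_integral_powr_tendsto_0: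
  fixes h :: "nat \<Rightarrow> 'a \<Rightarrow> real"
  assumes "finite_measure M" and [measurable]: "\<And>n. h n \<in> borel_measurable M" and nonneg: "\<And>n x. 0 \<le> h n x"
    and p: "1 \<le> p" and lim: "(\<lambda>n. \<integral>\<^sup>+ x. ennreal (h n x powr p) \<partial>M) \<longlonglongrightarrow> 0"
  shows "(\<lambda>n. \<integral>\<^sup>+ x. ennreal (h n x) \<partial>M) \<longlonglongrightarrow> 0"
proof (rule tendsto_zero_ennreal)
  interpret finite_measure M by fact
  fix r :: real assume "0 < r"
  define m where "m = measure M (space M) + 1"
  have m: "0 < m" "measure M (space M) < m"
    by (auto simp: m_def add_nonneg_pos)
  define e where "e = r / (2 * m)"
  have e: "0 < e"
    using \<open>0 < r\<close> m by (simp add: e_def)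
  define k where "k = e powr (1 - p)"
  have k: "0 < k"
    using e by (simp add: k_def)
  have bound: "y \<le> e + k * y powr p" if "0 \<le> y" for y
  proof (cases "y \<le> e")
    case True
    then show ?thesis
      using k by (intro order_trans[OF True]) simp
  next
    case False
    then have y: "e < y" "0 < y" using e by auto
    have "y = y powr (1 - p) * y powr p"
      using y by (simp add: powr_add[symmetric])
    also have "\<dots> \<le> k * y powr p"
      unfolding k_def using y e p by (intro mult_right_mono powr_mono2') auto
    finally show ?thesis
      using e by simp
  qed
  have le: "(\<integral>\<^sup>+ x. ennreal (h n x) \<partial>M) \<le> ennreal (e * measure M (space M)) + ennreal k * (\<integral>\<^sup>+ x. ennreal (h n x powr p) \<partial>M)" for n
  proof -
    have "(\<integral>\<^sup>+ x. ennreal (h n x) \<partial>M) \<le> (\<integral>\<^sup>+ x. ennreal e + ennreal k * ennreal (h n x powr p) \<partial>M)"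
      using bound nonneg e k
      by (intro nn_integral_mono) (simp add: ennreal_mult[symmetric] ennreal_plus[symmetric] del: ennreal_plus)
    also have "\<dots> = ennreal e * emeasure M (space M) + ennreal k * (\<integral>\<^sup>+ x. ennreal (h n x powr p) \<partial>M)"
      by (simp add: nn_integral_add nn_integral_cmult)
    also have "ennreal e * emeasure M (space M) = ennreal (e * measure M (space M))"
      using e by (simp add: emeasure_eq_measure ennreal_mult)
    finally show ?thesis .
  qed
  have "\<forall>\<^sub>F n in sequentially. (\<integral>\<^sup>+ x. ennreal (h n x powr p) \<partial>M) < ennreal (r / (2 * k))"
    using lim \<open>0 < r\<close> k by (intro order_tendstoD(2)[OF lim]) auto
  then show "\<forall>\<^sub>F n in sequentially. (\<integral>\<^sup>+ x. ennreal (h n x) \<partial>M) < ennreal r"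
  proof eventually_elim
    case (elim n)
    have "ennreal k * (\<integral>\<^sup>+ x. ennreal (h n x powr p) \<partial>M) \<le> ennreal k * ennreal (r / (2 * k))"
      using elim by (intro mult_left_mono) auto
    also have "\<dots> = ennreal (r / 2)"
      using k \<open>0 < r\<close> by (simp add: ennreal_mult[symmetric])
    finally have 1: "ennreal k * (\<integral>\<^sup>+ x. ennreal (h n x powr p) \<partial>M) \<le> ennreal (r / 2)" .
    have 2: "e * measure M (space M) < r / 2"
      using m \<open>0 < r\<close> by (simp add: e_def field_simps)
    have "(\<integral>\<^sup>+ x. ennreal (h n x) \<partial>M) \<le> ennreal (e * measure M (space M)) + ennreal (r / 2)"
      using le[of n] add_left_mono[OF 1] by (rule order_trans)
    also have "\<dots> = ennreal (e * measure M (space M) + r / 2)"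
      using e \<open>0 < r\<close> by (simp add: ennreal_plus)
    also have "\<dots> < ennreal r"
      using 2 e \<open>0 < r\<close> by (intro ennreal_lessI) auto
    finally show ?case .
  qed
qed

text \<open>An enumeration, with repetitions, of the nonnegative rationals.\<close>

definition grid :: "nat \<Rightarrow> real" where
  "grid k = (case prod_decode k of (i, n) \<Rightarrow> real i / real (Suc n))"

text \<open>The position in \<open>grid\<close> of \<open>t\<close> rounded down to a multiple of \<open>1 / Suc n\<close>.\<close>

definition grid_index :: "real \<Rightarrow> nat \<Rightarrow> nat" where
  "grid_index t n = prod_encode (nat \<lfloor>t * real (Suc n)\<rfloor>, n)"

lemma grid_nonneg: "0 \<le> grid k"
  by (simp add: grid_def split: prod.split)

lemma grid_index_tendsto:
  assumes "0 \<le> t"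
  shows "(\<lambda>n. grid (grid_index t n)) \<longlonglongrightarrow> t"
proof (rule Lim_transform_bound[where g = "\<lambda>n. inverse (real (Suc n))", THEN LIM_zero_cancel])
  show "(\<lambda>n. inverse (real (Suc n))) \<longlonglongrightarrow> 0"
    by (rule LIMSEQ_inverse_real_of_nat)
  have "norm (grid (grid_index t n) - t) \<le> norm (inverse (real (Suc n)))" for n
  proof -
    let ?N = "real (Suc n)"
    have "0 \<le> t * ?N" using assms by simp
    then have "real (nat \<lfloor>t * ?N\<rfloor>) \<le> t * ?N" "t * ?N < real (nat \<lfloor>t * ?N\<rfloor>) + 1"
      by linarith+
    then have "\<bar>real (nat \<lfloor>t * ?N\<rfloor>) - t * ?N\<bar> \<le> 1"
      by linarith
    then have "\<bar>real (nat \<lfloor>t * ?N\<rfloor>) - t * ?N\<bar> / ?N \<le> 1 / ?N"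
      by (intro divide_right_mono) auto
    moreover have "grid (grid_index t n) - t = (real (nat \<lfloor>t * ?N\<rfloor>) - t * ?N) / ?N"
      by (simp add: grid_def grid_index_def diff_divide_distrib)
    ultimately show ?thesis
      by (simp add: abs_divide inverse_eq_divide)
  qed
  then show "\<forall>\<^sub>F n in sequentially. norm (grid (grid_index t n) - t) \<le> norm (inverse (real (Suc n)))"
    by simp
qed

lemma ev_grid_tendsto:
  assumes "0 \<le> t"
  shows "(\<lambda>n. ev w (grid (grid_index t n))) \<longlonglongrightarrow> ev w t"
  using continuous_on_tendsto_compose[OF ev_continuous_on grid_index_tendsto[OF assms]] assms
  by (simp add: grid_nonneg)

text \<open>By continuity a path at a random time is the limit of its values at discretized times, each of which takes
  countably many values.\<close>

lemma measurable_ev_random_time: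
  assumes W: "\<And>k. (\<lambda>x. ev (W x) (grid k)) \<in> borel_measurable M"
    and g [measurable]: "g \<in> borel_measurable M" and nonneg: "\<And>x. x \<in> space M \<Longrightarrow> 0 \<le> g x"
  shows "(\<lambda>x. ev (W x) (g x)) \<in> borel_measurable M"
proof (rule borel_measurable_LIMSEQ_real)
  show "(\<lambda>n. ev (W x) (grid (grid_index (g x) n))) \<longlonglongrightarrow> ev (W x) (g x)" if "x \<in> space M" for x
    using nonneg[OF that] by (rule ev_grid_tendsto)
  fix n
  have "(\<lambda>x. grid_index (g x) n) \<in> M \<rightarrow>\<^sub>M count_space UNIV"
    unfolding grid_index_def by measurable
  then show "(\<lambda>x. ev (W x) (grid (grid_index (g x) n))) \<in> borel_measurable M"
    by (intro measurable_compose_countable[OF W])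
qed

locale time_changed_fbm = fractional_brownian_motion H P + Q: finite_measure Q
  for H P and Q :: "real measure" +
  assumes sets_Q: "sets Q = sets (restrict_space borel {0..})"
begin

abbreviation PQ :: "(wpath \<times> real) measure" where
  "PQ \<equiv> P \<Otimes>\<^sub>M Q"

lemma space_Q: "space Q = {0..}"
  using sets_eq_imp_space_eq[OF sets_Q] by (simp add: space_restrict_space)

lemma space_PQ: "space PQ = UNIV \<times> {0..}"
  by (simp add: space_pair_measure space_Q)

sublocale PQ: finite_measure PQ
  by (intro finite_measure_pair_measure) unfold_locales

sublocale pair_sigma_finite P Q ..

lemma snd_measurable [measurable]: "snd \<in> borel_measurable PQ"
proof -
  have "(\<lambda>\<tau>. \<tau>) \<in> borel_measurable Q"
    unfolding measurable_cong_sets[OF sets_Q refl] by (intro measurable_restrict_space1) simp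
  from measurable_compose[OF measurable_snd[of P Q] this] show ?thesis .
qed

lemma ev_fst_measurable [measurable]: "(\<lambda>x. ev (fst x) t) \<in> borel_measurable PQ"
  by (rule measurable_compose[OF measurable_fst ev_measurable])

lemma ev_random_time_measurable:
  assumes "g \<in> borel_measurable PQ" "\<And>x. x \<in> space PQ \<Longrightarrow> 0 \<le> g x"
  shows "(\<lambda>x. ev (fst x) (g x)) \<in> borel_measurable PQ"
  using assms by (rule measurable_ev_random_time[OF ev_fst_measurable])

text \<open>By continuity of paths these countably many coordinates determine the path and the random time.\<close>

definition obs :: "wpath \<times> real \<Rightarrow> nat \<Rightarrow> real" where
  "obs x j = (case j of 0 \<Rightarrow> snd x | Suc k \<Rightarrow> ev (fst x) (grid k))"

lemma obs_measurable [measurable]: "(\<lambda>x. obs x j) \<in> borel_measurable PQ"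
  by (cases j) (simp_all add: obs_def)

abbreviation obs_algebra :: "(wpath \<times> real) measure" where
  "obs_algebra \<equiv> vimage_algebra (UNIV \<times> {0..}) obs borel"

text \<open>The time \<open>\<tau>\<close> is itself a coordinate of \<open>obs\<close>, so \<open>X(t)\<close> is the path, known on a dense set, at a known random time.\<close>

lemma sets_F_X_subset: "sets (F_X H T) \<subseteq> sets obs_algebra"
proof -
  have "obs \<in> borel_measurable obs_algebra"
    by (rule measurable_vimage_algebra1) simp
  then have obs: "(\<lambda>x. obs x j) \<in> borel_measurable obs_algebra" for j
    by (rule measurable_product_then_coordinatewise)
  have snd: "snd \<in> borel_measurable obs_algebra"
    using obs[of 0] by (simp add: obs_def)
  have ev: "(\<lambda>x. ev (fst x) (grid k)) \<in> borel_measurable obs_algebra" for k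
    using obs[of "Suc k"] by (simp add: obs_def)
  have X: "X_proc H t \<in> borel_measurable obs_algebra" if "0 \<le> t" for t
  proof -
    have "(\<lambda>x. ev (fst x) (t * tau_H H (snd x))) \<in> borel_measurable obs_algebra"
    proof (rule measurable_ev_random_time[OF ev])
      show "(\<lambda>x. t * tau_H H (snd x)) \<in> borel_measurable obs_algebra"
        unfolding tau_H_def using snd by measurable
    qed (use that in \<open>simp add: tau_H_def\<close>)
    then show ?thesis
      by (simp add: X_proc_def split_beta')
  qed
  have "{X_proc H t -` B \<inter> (UNIV \<times> {0..}) | t B. t \<in> {0..T} \<and> B \<in> sets borel} \<subseteq> sets obs_algebra"
    using measurable_sets[OF X] by auto
  from sets.sigma_sets_subset[OF this] show ?thesis
    unfolding F_X_def by (subst sets_measure_of) auto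
qed

lemma space_F_X: "space (F_X H T) = UNIV \<times> {0..}"
  unfolding F_X_def by (rule space_measure_of) auto

lemma F_X_measurable_imp:
  assumes "\<Phi> \<in> borel_measurable (F_X H T)" "B \<in> sets borel"
  shows "\<exists>A\<in>sets borel. \<forall>x\<in>space PQ. \<Phi> x \<in> B \<longleftrightarrow> obs x \<in> A"
proof -
  have "\<Phi> -` B \<inter> (UNIV \<times> {0..}) \<in> sets obs_algebra"
    using measurable_sets[OF assms] sets_F_X_subset by (auto simp: space_F_X)
  then obtain A where "A \<in> sets borel" "\<Phi> -` B \<inter> (UNIV \<times> {0..}) = obs -` A \<inter> (UNIV \<times> {0..})"
    by (auto simp: sets_vimage_algebra2)
  then show ?thesis
    unfolding space_PQ by (intro bexI[of _ A]) blast+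
qed

lemma F_X_measurable_PQ:
  assumes "\<Phi> \<in> borel_measurable (F_X H T)"
  shows "\<Phi> \<in> borel_measurable PQ"
proof (rule measurableI)
  fix B :: "'a set" assume "B \<in> sets borel"
  then obtain A where A [measurable]: "A \<in> sets borel" and "\<forall>x\<in>space PQ. \<Phi> x \<in> B \<longleftrightarrow> obs x \<in> A"
    using F_X_measurable_imp[OF assms] by blast
  then have eq: "\<Phi> -` B \<inter> space PQ = obs -` A \<inter> space PQ"
    by auto
  have "obs \<in> borel_measurable PQ"
    by (rule measurable_coordinatewise_then_product) simp
  then show "\<Phi> -` B \<inter> space PQ \<in> sets PQ"
    unfolding eq using A by (rule measurable_sets)
qed simp

text \<open>For frozen \<open>\<tau>\<close> the term \<open>a * \<tau>\<close> is merely a shift of the phase, so integration by parts on path space applies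
  unchanged.\<close>

definition product_test :: "real \<Rightarrow> nat \<Rightarrow> (nat \<Rightarrow> real) \<Rightarrow> real \<Rightarrow> real \<Rightarrow> wpath \<times> real \<Rightarrow> real" where
  "product_test s m b a \<theta> x = test_weight s m b grid (\<theta> + a * snd x) (fst x)"

definition product_adjoint :: "real \<Rightarrow> nat \<Rightarrow> (nat \<Rightarrow> real) \<Rightarrow> real \<Rightarrow> real \<Rightarrow> wpath \<times> real \<Rightarrow> real" where
  "product_adjoint s m b a \<theta> x = adjoint_weight s m b grid (\<theta> + a * snd x) (fst x)"

lemma product_test_measurable [measurable]: "product_test s m b a \<theta> \<in> borel_measurable PQ"
  unfolding product_test_def test_weight_def by measurable

lemma product_adjoint_measurable [measurable]: "product_adjoint s m b a \<theta> \<in> borel_measurable PQ"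
  unfolding product_adjoint_def adjoint_weight_def by measurable

lemma product_test_bound: "\<bar>product_test s m b a \<theta> x\<bar> \<le> 1"
  by (simp add: product_test_def test_weight_bound)

text \<open>Integrability of \<open>D\<close> is a hypothesis because \<open>R_cov H (t \<tau>\<^sub>H) s\<close> can be unbounded in \<open>\<tau>\<close>; along the sequence it
  follows for large indices from convergence of the gradients.\<close>

lemma cylinder_gradient:
  assumes "F \<in> FCb H T" and s: "0 < s"
  obtains D B where "D \<in> borel_measurable PQ" "F \<in> borel_measurable PQ" "\<And>x. \<bar>F x\<bar> \<le> B"
    and "\<And>x. x \<in> space PQ \<Longrightarrow> grad1 H F x \<in> cm_space H"
    and "\<And>x. x \<in> space PQ \<Longrightarrow> ev (grad1 H F x) s = D x"
    and "\<And>m b a \<theta>. integrable PQ D \<Longrightarrow>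
      (\<integral>x. D x * product_test s m b a \<theta> x \<partial>PQ) = (\<integral>x. F x * product_adjoint s m b a \<theta> x \<partial>PQ)"
proof -
  obtain n t0 f where t0: "\<And>i. i < n \<Longrightarrow> 0 < t0 i" and f: "f \<in> Cb_infinity n"
    and F0: "F = (\<lambda>(w, \<tau>). f (\<lambda>i. ev w (t0 i * tau_H H \<tau>)))"
    using assms unfolding FCb_def by blast
  \<comment> \<open>As \<open>f\<close> depends on the first \<open>n\<close> coordinates, the remaining times can be set to \<open>0\<close>; then all of them are
      nonnegative and all coordinates measurable.\<close>
  define t where "t i = (if i < n then t0 i else 0)" for i
  have t: "0 \<le> t i" for i
    using t0 by (auto simp: t_def less_imp_le)
  have F: "F = (\<lambda>(w, \<tau>). f (\<lambda>i. ev w (t i * tau_H H \<tau>)))"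
    unfolding F0 by (auto simp: fun_eq_iff t_def intro!: Cb_infinity_cong[OF f])
  define X where "X x = (\<lambda>i. ev (fst x) (t i * tau_H H (snd x)))" for x :: "wpath \<times> real"
  have F_X: "F x = f (X x)" for x
    by (simp add: F X_def split_beta')
  define D where "D x = (\<Sum>i<n. partial_deriv i f (X x) * R_cov H (t i * tau_H H (snd x)) s)" for x
  have tau_nonneg: "0 \<le> t i * tau_H H \<tau>" for i \<tau>
    using t by (simp add: tau_H_def)
  have tau_meas [measurable]: "(\<lambda>x. t i * tau_H H (snd x)) \<in> borel_measurable PQ" for i
    unfolding tau_H_def by measurable
  have X_meas [measurable]: "X \<in> borel_measurable PQ"
    unfolding X_def by (intro measurable_coordinatewise_then_product ev_random_time_measurable tau_meas tau_nonneg)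
  have f_meas [measurable]: "f \<in> borel_measurable borel"
    by (intro borel_measurable_continuous_onI Cb_infinity_continuous[OF f])
  have F_meas: "F \<in> borel_measurable PQ"
    unfolding F_X[abs_def] by measurable
  have pd_meas: "(\<lambda>x. partial_deriv i f (X x)) \<in> borel_measurable PQ" if "i < n" for i
    by (rule measurable_compose[OF X_meas])
      (intro borel_measurable_continuous_onI partial_deriv_continuous[OF f that])
  have R_meas: "(\<lambda>x. R_cov H (t i * tau_H H (snd x)) s) \<in> borel_measurable PQ" for i
    unfolding R_cov_def by measurable
  have D_meas: "D \<in> borel_measurable PQ"
    unfolding D_def by (intro borel_measurable_sum borel_measurable_times pd_meas R_meas) simp
  obtain B where B: "\<And>x. \<bar>f x\<bar> \<le> B"
    using Cb_infinity_bounded[OF f] by (auto simp: bounded_iff)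
  have grad: "grad1 H F x = (\<Sum>i<n. partial_deriv i f (X x) *\<^sub>R R_path H (t i * tau_H H (snd x)))" for x
    using grad1_cylinder[OF f t, where w = "fst x" and \<tau> = "snd x"] by (simp add: F X_def)
  show ?thesis
  proof (rule that[OF D_meas F_meas])
    show "\<bar>F x\<bar> \<le> B" for x
      using B by (simp add: F_X)
    show "grad1 H F x \<in> cm_space H" for x
      unfolding grad by (intro subsetD[OF cm_span_subset] cm_span_sum tau_nonneg)
    show "ev (grad1 H F x) s = D x" for x
      unfolding grad D_def using s by (intro ev_R_path_sum tau_nonneg) simp
    fix m b a \<theta>
    assume int: "integrable PQ D"
    define C where "C = 1 + s powr (2 * H) + \<bar>\<Sum>j<m. b j * R_cov H (grid j) s\<bar>"
    have "integrable PQ (\<lambda>x. D x * product_test s m b a \<theta> x)"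
    proof (rule Bochner_Integration.integrable_bound[OF int])
      show "(\<lambda>x. D x * product_test s m b a \<theta> x) \<in> borel_measurable PQ"
        using D_meas by measurable
    qed (auto simp: abs_mult product_test_bound intro!: AE_I2 mult_left_le)
    then have int1: "integrable PQ (\<lambda>(w, \<tau>). D (w, \<tau>) * product_test s m b a \<theta> (w, \<tau>))"
      by (simp add: split_beta')
    have "integrable PQ (\<lambda>x. F x * product_adjoint s m b a \<theta> x)"
    proof (rule PQ.integrable_const_bound[where B = "B * C"])
      have "0 \<le> B"
        using B[of undefined] by linarith
      then show "AE x in PQ. norm (F x * product_adjoint s m b a \<theta> x) \<le> B * C"
        using B adjoint_weight_bound
        by (intro AE_I2) (auto simp: abs_mult F_X C_def product_adjoint_def intro!: mult_mono)
    qed (use F_meas in measurable)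
    then have int2: "integrable PQ (\<lambda>(w, \<tau>). F (w, \<tau>) * product_adjoint s m b a \<theta> (w, \<tau>))"
      by (simp add: split_beta')
    have "(\<integral>x. D x * product_test s m b a \<theta> x \<partial>PQ) = (\<integral>\<tau>. (\<integral>w. D (w, \<tau>) * product_test s m b a \<theta> (w, \<tau>) \<partial>P) \<partial>Q)"
      using integral_snd[OF int1] by (simp add: split_beta')
    also have "\<dots> = (\<integral>\<tau>. (\<integral>w. F (w, \<tau>) * product_adjoint s m b a \<theta> (w, \<tau>) \<partial>P) \<partial>Q)"
    proof (rule Bochner_Integration.integral_cong[OF refl])
      fix \<tau>
      show "(\<integral>w. D (w, \<tau>) * product_test s m b a \<theta> (w, \<tau>) \<partial>P) = (\<integral>w. F (w, \<tau>) * product_adjoint s m b a \<theta> (w, \<tau>) \<partial>P)"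
        unfolding D_def F_X X_def product_test_def product_adjoint_def fst_conv snd_conv
        by (rule cylinder_integration_by_parts[OF f tau_nonneg grid_nonneg s])
    qed
    also have "\<dots> = (\<integral>x. F x * product_adjoint s m b a \<theta> x \<partial>PQ)"
      using integral_snd[OF int2] by (simp add: split_beta')
    finally show "(\<integral>x. D x * product_test s m b a \<theta> x \<partial>PQ) = (\<integral>x. F x * product_adjoint s m b a \<theta> x \<partial>PQ)" .
  qed
qed

text \<open>The factor \<open>cauchy_weight (w(s))\<close> of the test functions is attached to \<open>\<Phi>\<close>. Being positive, it preserves the sign
  of \<open>\<Phi>\<close>, and the sign events \<open>{\<Phi> > 0}\<close> and \<open>{\<Phi> < 0}\<close> are of the form to which \<open>cos_uniqueness\<close> applies.\<close>

lemma test_orthogonal_imp_AE_zero: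
  assumes \<Phi>: "\<Phi> \<in> borel_measurable (F_X H T)" and int: "integrable PQ \<Phi>"
    and orth: "\<And>m b a \<theta>. (\<integral>x. \<Phi> x * product_test s m b a \<theta> x \<partial>PQ) = 0"
  shows "AE x in PQ. \<Phi> x = (0::real)"
proof -
  note [measurable] = F_X_measurable_PQ[OF \<Phi>]
  let ?\<rho> = "\<lambda>x. cauchy_weight (ev (fst x) s)"
  have int_\<rho>: "integrable PQ (\<lambda>x. \<Phi> x * ?\<rho> x)"
    by (rule Bochner_Integration.integrable_bound[OF int])
      (use cauchy_weight_bounds(1) in \<open>auto simp: abs_mult intro!: AE_I2 mult_left_le\<close>)
  have zero: "(\<integral>x. (\<Phi> x * ?\<rho> x) * indicator A (obs x) \<partial>PQ) = 0" if "A \<in> sets borel" for A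
  proof -
    have "(\<integral>x. (\<Phi> x * ?\<rho> x) * indicator A (\<lambda>j. obs x j) \<partial>PQ) = 0"
    proof (rule cos_uniqueness[OF _ int_\<rho> _ that])
      fix m \<theta> and b :: "nat \<Rightarrow> real"
      show "(\<integral>x. (\<Phi> x * ?\<rho> x) * cos (\<theta> + (\<Sum>j<m. b j * obs x j)) \<partial>PQ) = 0"
      proof (cases m)
        case 0
        then show ?thesis
          using orth[of 0 b 0 \<theta>] by (simp add: product_test_def test_weight_def mult.assoc)
      next
        case (Suc m')
        then have "(\<Sum>j<m. b j * obs x j) = b 0 * snd x + (\<Sum>j<m'. b (Suc j) * ev (fst x) (grid j))" for x
          by (simp add: sum.lessThan_Suc_shift obs_def del: sum.lessThan_Suc)
        then show ?thesis
          using orth[of m' "\<lambda>j. b (Suc j)" "b 0" \<theta>]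
          by (simp add: product_test_def test_weight_def mult.assoc add.assoc)
      qed
    qed simp
    then show ?thesis
      by simp
  qed
  \<comment> \<open>The factor \<open>c\<close> is \<open>1\<close> or \<open>-1\<close>, covering both signs.\<close>
  have sign: "AE x in PQ. \<not> 0 < c * \<Phi> x" for c :: real
  proof -
    have "{y. 0 < c * y} \<in> sets borel"
      by measurable
    then obtain A where A [measurable]: "A \<in> sets borel" and eq: "\<And>x. x \<in> space PQ \<Longrightarrow> 0 < c * \<Phi> x \<longleftrightarrow> obs x \<in> A"
      using F_X_measurable_imp[OF \<Phi>, of "{y. 0 < c * y}"] by auto
    have [measurable]: "obs \<in> borel_measurable PQ"
      by (rule measurable_coordinatewise_then_product) simp
    let ?g = "\<lambda>x. c * ((\<Phi> x * ?\<rho> x) * indicator A (obs x))"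
    have "integrable PQ (\<lambda>x. (\<Phi> x * ?\<rho> x) * indicator A (obs x))"
      by (rule Bochner_Integration.integrable_bound[OF int_\<rho>]) (auto simp: indicator_def)
    then have "integrable PQ ?g"
      by simp
    moreover have nonneg: "AE x in PQ. 0 \<le> ?g x"
      using eq cauchy_weight_pos
      by (intro AE_I2) (auto simp: indicator_def mult.assoc[symmetric] less_imp_le intro!: mult_nonneg_nonneg)
    moreover have "(\<integral>x. ?g x \<partial>PQ) = 0"
      using zero[OF A] by simp
    ultimately have "AE x in PQ. ?g x = 0"
      using integral_nonneg_eq_0_iff_AE by blast
    then show ?thesis
      using AE_space
    proof eventually_elim
      case (elim x)
      then show ?case
        using eq[of x] cauchy_weight_pos[of "ev (fst x) s"] by (auto simp: indicator_def)
    qed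
  qed
  show ?thesis
    using sign[of 1] sign[of "-1"] by eventually_elim simp
qed

end

section \<open>Closability\<close>

context time_changed_fbm
begin

text \<open>The gradients are compared through their values at \<open>s\<close>, which are measurable in \<open>x\<close> and dominated by the
  Cameron--Martin norm. Both error terms \<open>E[(D\<^sub>s F\<^sub>n - \<Phi>) G]\<close> and \<open>E[F\<^sub>n G\<^sup>*]\<close> then tend to zero.\<close>

lemma gradient_limit_AE_zero_at:
  fixes F :: "nat \<Rightarrow> wpath \<times> real \<Rightarrow> real" and Z :: "wpath \<times> real \<Rightarrow> wpath"
  assumes p: "1 \<le> p" and q: "1 \<le> q" and s: "0 < s"
    and F: "\<And>n. F n \<in> FCb H T"
    and F_lim: "(\<lambda>n. \<integral>\<^sup>+ x. ennreal (\<bar>F n x\<bar> powr q) \<partial>PQ) \<longlonglongrightarrow> 0"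
    and Z: "Z \<in> F_X H T \<rightarrow>\<^sub>M cm_borel H"
    and Z_int: "(\<integral>\<^sup>+ x. ennreal (cm_norm H (Z x) powr p) \<partial>PQ) < \<infinity>"
    and grad_lim: "(\<lambda>n. \<integral>\<^sup>+ x. ennreal (cm_norm H (grad1 H (F n) x - Z x) powr p) \<partial>PQ) \<longlonglongrightarrow> 0"
  shows "AE x in PQ. ev (Z x) s = 0"
proof -
  define \<Phi> where "\<Phi> x = ev (Z x) s" for x
  have \<Phi>_F_X: "\<Phi> \<in> borel_measurable (F_X H T)"
    unfolding \<Phi>_def using s by (intro measurable_compose[OF Z ev_measurable_cm_borel]) simp
  note [measurable] = F_X_measurable_PQ[OF \<Phi>_F_X]
  have Z_space: "Z x \<in> cm_space H" if "x \<in> space PQ" for x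
    using measurable_space[OF Z, of x] that by (simp add: space_F_X space_PQ space_cm_borel)
  define c where "c = s powr H"
  have c: "0 < c"
    using s by (simp add: c_def)
  have ev_bound: "\<bar>ev h s\<bar> / c \<le> cm_norm H h" if "h \<in> cm_space H" for h
    using ev_le_cm_norm[OF that, of s] s c by (simp add: c_def field_simps)
  have \<Phi>_int: "integrable PQ \<Phi>"
  proof -
    have "integrable PQ (\<lambda>x. \<Phi> x / c)"
    proof (rule integrableI_bounded)
      have le: "y \<le> 1 + y powr p" if "0 \<le> y" for y :: real
      proof (cases "y \<le> 1")
        case False
        then have "y powr 1 \<le> y powr p"
          using p by (intro powr_mono) auto
        then show ?thesis
          using False by simp
      qed (simp add: add_increasing2)
      have "(\<integral>\<^sup>+ x. ennreal (norm (\<Phi> x / c)) \<partial>PQ) \<le> (\<integral>\<^sup>+ x. 1 + ennreal (\<bar>\<Phi> x / c\<bar> powr p) \<partial>PQ)"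
      proof (intro nn_integral_mono)
        fix x
        have "ennreal \<bar>\<Phi> x / c\<bar> \<le> ennreal (1 + \<bar>\<Phi> x / c\<bar> powr p)"
          using le[of "\<bar>\<Phi> x / c\<bar>"] by (intro ennreal_leI) simp
        then show "ennreal (norm (\<Phi> x / c)) \<le> 1 + ennreal (\<bar>\<Phi> x / c\<bar> powr p)"
          by simp
      qed
      also have "\<dots> = emeasure PQ (space PQ) + (\<integral>\<^sup>+ x. ennreal (\<bar>\<Phi> x / c\<bar> powr p) \<partial>PQ)"
        by (subst nn_integral_add) auto
      also have "\<dots> \<le> emeasure PQ (space PQ) + (\<integral>\<^sup>+ x. ennreal (cm_norm H (Z x) powr p) \<partial>PQ)"
      proof (intro add_left_mono nn_integral_mono ennreal_leI powr_mono2)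
        fix x assume "x \<in> space PQ"
        then show "\<bar>\<Phi> x / c\<bar> \<le> cm_norm H (Z x)"
          using ev_bound[OF Z_space] c by (simp add: \<Phi>_def)
      qed (use p in auto)
      also have "\<dots> < \<infinity>"
        using Z_int by (simp add: PQ.emeasure_eq_measure)
      finally show "(\<integral>\<^sup>+ x. ennreal (norm (\<Phi> x / c)) \<partial>PQ) < \<infinity>" .
    qed simp
    from integrable_mult_right[OF this, of c] show ?thesis
      using c by simp
  qed
  define represents where "represents n D \<longleftrightarrow> D \<in> borel_measurable PQ \<and> F n \<in> borel_measurable PQ \<and>
      (\<exists>B. \<forall>x. \<bar>F n x\<bar> \<le> B) \<and>
      (\<forall>x\<in>space PQ. grad1 H (F n) x \<in> cm_space H \<and> ev (grad1 H (F n) x) s = D x) \<and>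
      (integrable PQ D \<longrightarrow> (\<forall>m b a \<theta>. (\<integral>x. D x * product_test s m b a \<theta> x \<partial>PQ) =
        (\<integral>x. F n x * product_adjoint s m b a \<theta> x \<partial>PQ)))" for n D
  have "\<exists>D. represents n D" for n
    unfolding represents_def by (rule cylinder_gradient[OF F[of n] s]) blast
  then obtain D where D: "\<And>n. represents n (D n)"
    by metis
  have D_meas [measurable]: "D n \<in> borel_measurable PQ"
    and F_meas [measurable]: "F n \<in> borel_measurable PQ"
    and F_bound: "\<exists>B. \<forall>x. \<bar>F n x\<bar> \<le> B"
    and grad: "x \<in> space PQ \<Longrightarrow> grad1 H (F n) x \<in> cm_space H \<and> ev (grad1 H (F n) x) s = D n x"
    and ibp: "integrable PQ (D n) \<Longrightarrow> (\<integral>x. D n x * product_test s m b a \<theta> x \<partial>PQ) =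
        (\<integral>x. F n x * product_adjoint s m b a \<theta> x \<partial>PQ)" for n x m b a \<theta>
    using D[of n] unfolding represents_def by blast+
  define d where "d n x = \<bar>D n x - \<Phi> x\<bar> / c" for n x
  have d_meas [measurable]: "d n \<in> borel_measurable PQ" for n
    unfolding d_def by measurable
  have d_lim: "(\<lambda>n. \<integral>\<^sup>+ x. ennreal (d n x) \<partial>PQ) \<longlonglongrightarrow> 0"
  proof (rule nn_integral_powr_tendsto_0[OF PQ.finite_measure_axioms d_meas _ p])
    show "0 \<le> d n x" for n x
      using c by (simp add: d_def)
    have "(\<integral>\<^sup>+ x. ennreal (d n x powr p) \<partial>PQ) \<le> (\<integral>\<^sup>+ x. ennreal (cm_norm H (grad1 H (F n) x - Z x) powr p) \<partial>PQ)" for n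
    proof (intro nn_integral_mono ennreal_leI powr_mono2)
      fix x assume x: "x \<in> space PQ"
      then show "d n x \<le> cm_norm H (grad1 H (F n) x - Z x)"
        using ev_bound[OF cm_space_diff[OF _ Z_space[OF x]], of "grad1 H (F n) x"] grad[OF x, of n]
        by (simp add: d_def \<Phi>_def)
    qed (use p c in \<open>auto simp: d_def\<close>)
    then show "(\<lambda>n. \<integral>\<^sup>+ x. ennreal (d n x powr p) \<partial>PQ) \<longlonglongrightarrow> 0"
      by (intro tendsto_sandwich[OF _ _ tendsto_const grad_lim]) auto
  qed
  have F_lim1: "(\<lambda>n. \<integral>\<^sup>+ x. ennreal \<bar>F n x\<bar> \<partial>PQ) \<longlonglongrightarrow> 0"
    by (rule nn_integral_powr_tendsto_0[OF PQ.finite_measure_axioms _ _ q F_lim]) auto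
  have "\<forall>\<^sub>F n in sequentially. (\<integral>\<^sup>+ x. ennreal (d n x) \<partial>PQ) < 1"
    by (rule order_tendstoD(2)[OF d_lim]) simp
  then have diff_int: "\<forall>\<^sub>F n in sequentially. integrable PQ (\<lambda>x. D n x - \<Phi> x)"
  proof eventually_elim
    case (elim n)
    have "integrable PQ (\<lambda>x. (D n x - \<Phi> x) / c)"
    proof (rule integrableI_bounded)
      have "(\<integral>\<^sup>+ x. ennreal (norm ((D n x - \<Phi> x) / c)) \<partial>PQ) = (\<integral>\<^sup>+ x. ennreal (d n x) \<partial>PQ)"
        using c by (simp add: d_def)
      also have "\<dots> < \<infinity>"
        using elim by (rule less_trans) simp
      finally show "(\<integral>\<^sup>+ x. ennreal (norm ((D n x - \<Phi> x) / c)) \<partial>PQ) < \<infinity>" .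
    qed simp
    from integrable_mult_right[OF this, of c] show ?case
      using c by simp
  qed
  have orth: "(\<integral>x. \<Phi> x * product_test s m b a \<theta> x \<partial>PQ) = 0" for m b a \<theta>
  proof -
    let ?G = "product_test s m b a \<theta>" and ?K = "product_adjoint s m b a \<theta>"
    define C where "C = 1 + s powr (2 * H) + \<bar>\<Sum>j<m. b j * R_cov H (grid j) s\<bar>"
    have C: "0 \<le> C" "\<And>x. \<bar>?K x\<bar> \<le> C"
      using adjoint_weight_bound by (auto simp: C_def product_adjoint_def)
    have test_int: "integrable PQ (\<lambda>x. g x * ?G x)" if "integrable PQ g" for g
    proof (rule Bochner_Integration.integrable_bound[OF that])
      show "(\<lambda>x. g x * ?G x) \<in> borel_measurable PQ"
        using borel_measurable_integrable[OF that] by measurable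
    qed (auto simp: abs_mult product_test_bound intro!: AE_I2 mult_left_le)
    have "\<forall>\<^sub>F n in sequentially. ennreal \<bar>\<integral>x. \<Phi> x * ?G x \<partial>PQ\<bar> \<le>
        ennreal c * (\<integral>\<^sup>+ x. ennreal (d n x) \<partial>PQ) + ennreal C * (\<integral>\<^sup>+ x. ennreal \<bar>F n x\<bar> \<partial>PQ)"
      using diff_int
    proof eventually_elim
      case (elim n)
      have D_int: "integrable PQ (D n)"
        using Bochner_Integration.integrable_add[OF elim \<Phi>_int] by simp
      obtain B where B: "\<And>x. \<bar>F n x\<bar> \<le> B"
        using F_bound by blast
      have B0: "0 \<le> B"
        using B[of undefined] by linarith
      have FK_int: "integrable PQ (\<lambda>x. F n x * ?K x)"
        by (rule PQ.integrable_const_bound[where B = "B * C"])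
          (use B C B0 in \<open>auto simp: abs_mult intro!: AE_I2 mult_mono\<close>)
      have "(\<integral>x. \<Phi> x * ?G x \<partial>PQ) = (\<integral>x. D n x * ?G x - (D n x - \<Phi> x) * ?G x \<partial>PQ)"
        by (simp add: left_diff_distrib)
      also have "\<dots> = (\<integral>x. D n x * ?G x \<partial>PQ) - (\<integral>x. (D n x - \<Phi> x) * ?G x \<partial>PQ)"
        by (intro Bochner_Integration.integral_diff test_int D_int elim)
      also have "\<dots> = (\<integral>x. F n x * ?K x \<partial>PQ) - (\<integral>x. (D n x - \<Phi> x) * ?G x \<partial>PQ)"
        by (simp only: ibp[OF D_int])
      finally have "\<bar>\<integral>x. \<Phi> x * ?G x \<partial>PQ\<bar> \<le> \<bar>\<integral>x. (D n x - \<Phi> x) * ?G x \<partial>PQ\<bar> + \<bar>\<integral>x. F n x * ?K x \<partial>PQ\<bar>"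
        by linarith
      then have "ennreal \<bar>\<integral>x. \<Phi> x * ?G x \<partial>PQ\<bar> \<le>
          ennreal \<bar>\<integral>x. (D n x - \<Phi> x) * ?G x \<partial>PQ\<bar> + ennreal \<bar>\<integral>x. F n x * ?K x \<partial>PQ\<bar>"
        by (simp add: ennreal_plus[symmetric] del: ennreal_plus)
      also have "\<dots> \<le> ennreal c * (\<integral>\<^sup>+ x. ennreal (d n x) \<partial>PQ) + ennreal C * (\<integral>\<^sup>+ x. ennreal \<bar>F n x\<bar> \<partial>PQ)"
      proof (intro add_mono)
        have "ennreal \<bar>\<integral>x. (D n x - \<Phi> x) * ?G x \<partial>PQ\<bar> \<le> (\<integral>\<^sup>+ x. ennreal (norm ((D n x - \<Phi> x) * ?G x)) \<partial>PQ)"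
          using integral_norm_bound_ennreal[OF test_int[OF elim]] by simp
        also have "\<dots> \<le> (\<integral>\<^sup>+ x. ennreal c * ennreal (d n x) \<partial>PQ)"
        proof (intro nn_integral_mono)
          fix x
          have "norm ((D n x - \<Phi> x) * ?G x) \<le> \<bar>D n x - \<Phi> x\<bar>"
            unfolding real_norm_def abs_mult by (intro mult_left_le product_test_bound abs_ge_zero)
          also have "\<dots> = c * d n x"
            using c by (simp add: d_def)
          finally show "ennreal (norm ((D n x - \<Phi> x) * ?G x)) \<le> ennreal c * ennreal (d n x)"
            using c by (simp add: ennreal_mult[symmetric] d_def ennreal_leI)
        qed
        also have "\<dots> = ennreal c * (\<integral>\<^sup>+ x. ennreal (d n x) \<partial>PQ)"
          by (rule nn_integral_cmult) simp
        finally show "ennreal \<bar>\<integral>x. (D n x - \<Phi> x) * ?G x \<partial>PQ\<bar> \<le> ennreal c * (\<integral>\<^sup>+ x. ennreal (d n x) \<partial>PQ)" .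
        have "ennreal \<bar>\<integral>x. F n x * ?K x \<partial>PQ\<bar> \<le> (\<integral>\<^sup>+ x. ennreal (norm (F n x * ?K x)) \<partial>PQ)"
          using integral_norm_bound_ennreal[OF FK_int] by simp
        also have "\<dots> \<le> (\<integral>\<^sup>+ x. ennreal C * ennreal \<bar>F n x\<bar> \<partial>PQ)"
        proof (intro nn_integral_mono)
          fix x
          have "norm (F n x * ?K x) \<le> C * \<bar>F n x\<bar>"
            using mult_left_mono[OF C(2)[of x], of "\<bar>F n x\<bar>"] by (simp add: abs_mult mult.commute)
          then show "ennreal (norm (F n x * ?K x)) \<le> ennreal C * ennreal \<bar>F n x\<bar>"
            using C by (simp add: ennreal_mult[symmetric] ennreal_leI)
        qed
        also have "\<dots> = ennreal C * (\<integral>\<^sup>+ x. ennreal \<bar>F n x\<bar> \<partial>PQ)"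
          by (rule nn_integral_cmult) simp
        finally show "ennreal \<bar>\<integral>x. F n x * ?K x \<partial>PQ\<bar> \<le> ennreal C * (\<integral>\<^sup>+ x. ennreal \<bar>F n x\<bar> \<partial>PQ)" .
      qed
      finally show ?case .
    qed
    moreover have "(\<lambda>n. ennreal c * (\<integral>\<^sup>+ x. ennreal (d n x) \<partial>PQ) + ennreal C * (\<integral>\<^sup>+ x. ennreal \<bar>F n x\<bar> \<partial>PQ)) \<longlonglongrightarrow>
        ennreal c * 0 + ennreal C * 0"
      by (intro tendsto_add ennreal_tendsto_cmult d_lim F_lim1) auto
    ultimately have "ennreal \<bar>\<integral>x. \<Phi> x * ?G x \<partial>PQ\<bar> \<le> ennreal c * 0 + ennreal C * 0"
      by (intro tendsto_lowerbound) auto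
    then show ?thesis
      by simp
  qed
  have "AE x in PQ. \<Phi> x = 0"
    by (rule test_orthogonal_imp_AE_zero[OF \<Phi>_F_X \<Phi>_int orth])
  then show ?thesis
    by (simp add: \<Phi>_def)
qed

end

lemma wpath_zeroI:
  assumes "\<And>k. ev w (grid k) = 0"
  shows "w = 0"
proof (rule wpath_eqI)
  fix t
  show "ev w t = ev 0 t"
  proof (cases "0 \<le> t")
    case True
    then show ?thesis
      using LIMSEQ_unique[OF ev_grid_tendsto[OF True, of w]] assms by simp
  qed (simp add: ev_nonpos)
qed

text \<open>At \<open>s = 0\<close> the Laplace transform is the total mass, hence finite.\<close>

lemma Y_law_finite_measure:
  assumes "Y_law \<beta> Q"
  shows "finite_measure Q" and "sets Q = sets (restrict_space borel {0..})"
proof -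
  obtain M where M: "M \<in> borel_measurable borel" "\<And>\<tau>. 0 \<le> \<tau> \<Longrightarrow> 0 \<le> M \<tau>"
    and int: "\<And>s. 0 \<le> s \<Longrightarrow> has_bochner_integral (restrict_space lborel {0..}) (\<lambda>\<tau>. exp (- s * \<tau>) * M \<tau>) (mittag_leffler \<beta> (- s))"
    and Q: "Q = density (restrict_space lborel {0..}) (\<lambda>\<tau>. ennreal (M \<tau>))"
    using assms unfolding Y_law_def by blast
  show "sets Q = sets (restrict_space borel {0..})"
    unfolding Q by (simp cong: sets_restrict_space_cong)
  have M_int: "integrable (restrict_space lborel {0..}) M"
    using int[of 0] by (simp add: has_bochner_integral_iff)
  have "emeasure Q (space Q) = (\<integral>\<^sup>+ \<tau>. ennreal (M \<tau>) * indicator (space (restrict_space lborel {0..})) \<tau>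
      \<partial>restrict_space lborel {0..})"
    unfolding Q space_density using borel_measurable_integrable[OF M_int]
    by (intro emeasure_density sets.top measurable_compose[OF _ measurable_ennreal])
  also have "\<dots> = (\<integral>\<^sup>+ \<tau>. ennreal (M \<tau>) \<partial>restrict_space lborel {0..})"
    by (intro nn_integral_cong) simp
  also have "\<dots> \<le> (\<integral>\<^sup>+ \<tau>. ennreal (norm (M \<tau>)) \<partial>restrict_space lborel {0..})"
    by (intro nn_integral_mono ennreal_leI) simp
  also have "\<dots> < \<infinity>"
    using M_int by (simp add: integrable_iff_bounded)
  finally show "finite_measure Q"
    by (intro finite_measureI) simp
qed

theorem theorem4p10:
  fixes \<beta> H T p q :: real
    and P :: "wpath measure" and Q :: "real measure"
    and F :: "nat \<Rightarrow> wpath \<times> real \<Rightarrow> real" and Z :: "wpath \<times> real \<Rightarrow> wpath"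
  assumes "0 < \<beta>" "\<beta> < 1" and "1/2 < H" "H < 1" and "0 < T"
    and "1 \<le> p" "1 \<le> q"
    and "fbm_law H P" and "Y_law \<beta> Q"
    and "\<And>n. F n \<in> FCb H T"
    and "(\<lambda>n. \<integral>\<^sup>+ x. ennreal (\<bar>F n x\<bar> powr q) \<partial>(P \<Otimes>\<^sub>M Q)) \<longlonglongrightarrow> 0"
    and "Z \<in> F_X H T \<rightarrow>\<^sub>M cm_borel H"
    and "(\<integral>\<^sup>+ x. ennreal (cm_norm H (Z x) powr p) \<partial>(P \<Otimes>\<^sub>M Q)) < \<infinity>"
    and "(\<lambda>n. \<integral>\<^sup>+ x. ennreal (cm_norm H (grad1 H (F n) x - Z x) powr p) \<partial>(P \<Otimes>\<^sub>M Q)) \<longlonglongrightarrow> 0"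
  shows "AE x in P \<Otimes>\<^sub>M Q. Z x = 0"
proof -
  interpret fractional_brownian_motion H P
    using assms by unfold_locales auto
  interpret time_changed_fbm H P Q
    by (intro time_changed_fbm.intro fractional_brownian_motion_axioms
      time_changed_fbm_axioms.intro Y_law_finite_measure[OF \<open>Y_law \<beta> Q\<close>])
  have "AE x in PQ. ev (Z x) (grid k) = 0" for k
  proof (cases "0 < grid k")
    case True
    then show ?thesis
      using assms by (intro gradient_limit_AE_zero_at[of p q _ F T])
  qed (simp add: ev_nonpos)
  then have "AE x in PQ. \<forall>k. ev (Z x) (grid k) = 0"
    by (simp add: AE_all_countable)
  then show ?thesis
    by eventually_elim (auto intro: wpath_zeroI)
qed

end
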